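(* Let $D>0$ and suppose that the parameters $\kappa,\gamma,D$ satisfy (i) $A-((\kappa+1)I+\kappa M)D-I\gamma>0$, (ii) $2\pi\, C_2(\kappa,\gamma,D)\,\dfrac{\exp(2\pi\kappa I/A)}{\kappa B}\le D$, (iii) $E_2(\kappa,\gamma,D)<\kappa B$. Let $\beta(s):=\dfrac{\partial_x F[\delta_s\otimes\nu](s,\omega_c)}{F[\delta_s\otimes\nu](s,\omega_c)}$ and let $\Delta:\mathbb{R}\to(0,D)$ be the unique $2\pi$-periodic solution of $\Delta'(s)=C_2(\kappa,\gamma,D)+\beta(s)\Delta(s)$. Then there exists a $2\pi$-periodic function $\tilde\Delta:\mathbb{R}\to(0,\infty)$ such that: (1) the set $\mathcal{C}_\nu(\Delta,\tilde\Delta)$ is positively invariant: if $\mu_0\in\mathcal{C}_\nu(\Delta,\tilde\Delta)$ and $\mu\in\mathcal{C}([0,\infty);\mathcal{P}_2(\mathbb{R}^2))$ is a measure-valued solution of the Cauchy problem with initial datum $\mu_0$, then $\mu_t\in\mathcal{C}_\nu(\Delta,\tilde\Delta)$ for all $t\ge0$; (2) there exists $\mu_*\in\mathcal{C}_\nu(\Delta,\tilde\Delta)$ such that the solution $\mu$ of the Cauchy problem with initial condition $\mu_0=\mu_*$ is periodic in the sense that $\mu_{t+T_*}=(\tau_{2\pi})_\sharp\mu_t$ for all $t\ge0$, where $\tau_{2\pi}(x,\omega)=(x+2\pi,\omega)$ and $T_*:=\inf\{t\ge0: x_c[\mu_t]=x_c[\mu_0]+2\pi\}$.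
   Context: Setting. $\nu$ is a Borel probability measure on $\mathbb{R}$ with finite second moment whose support $\Omega:=\operatorname{supp}(\nu)$ is bounded; $\gamma:=\sup_{\omega,\omega'\in\Omega}|\omega-\omega'|$ and $\omega_c:=\int\omega\,\nu(d\omega)$. $\mathcal{P}_2(\mathbb{R}^2)$ is the set of Borel probability measures on $\mathbb{R}^2$ with finite second moment and $\mathcal{P}_2^\nu(\mathbb{R}^2)$ the subset of $\mu$ with $\mu(\mathbb{R}\times B)=\nu(B)$ for all Borel $B$. $W_p$ is the $p$-Wasserstein distance. Each $\mu\in\mathcal{P}_2^\nu(\mathbb{R}^2)$ is disintegrated as $\mu(dx,d\omega)=\mu(dx,\omega)\,\nu(d\omega)$ with conditional probability measures $\mu(\cdot,\omega)$ on $\mathbb{R}$. $x_c[\mu]:=\int x\,\mu(dx,d\omega)$, and $\operatorname{diam}_x(\operatorname{supp}\mu):=\sup\{|x-x'|:(x,\omega),(x',\omega')\in\operatorname{supp}\mu\}$. Flux. $F$ assigns to each $\mu\in\mathcal{P}_2^\nu(\mathbb{R}^2)$ a function $F[\mu]:\mathbb{R}^2\to\mathbb{R}$; $\partial_x,\partial_\omega$ denote partial derivatives of $(x,\omega)\mapsto F[\mu](x,\omega)$ with $\mu$ held fixed. There are constants $A,B,I,M>0$ and $\kappa>0$ with: (A1) for all $\mu,\mu'\in\mathcal{P}_2^\nu(\mathbb{R}^2)$ and $\alpha\in\{0,1\}$, $\sup_{(x,\omega)\in\mathbb{R}\times\Omega}|\partial_x^\alpha F[\mu](x,\omega)-\partial_x^\alpha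 F[\mu'](x,\omega)|\le\kappa M W_1(\mu,\mu')$; (A2) each $F[\mu]$ is $C^2(\mathbb{R}^2)$ with $\|\partial_xF[\mu]\|_\infty\le\kappa I$, $\|\partial_x^2F[\mu]\|_\infty\le\kappa I$, $\|\partial_\omega F[\mu]\|_\infty\le I$; (A3) $F[(\tau_{2\pi})_\sharp\mu](x+2\pi,\omega)=F[\mu](x,\omega)$ for all $\mu$ and $(x,\omega)$, where $\tau_{2\pi}(x,\omega)=(x+2\pi,\omega)$; (A4) $\inf_{x\in\mathbb{R}}F[\delta_x\otimes\nu](x,\omega_c)\ge A$; (A5) $\int_0^{2\pi}\frac{\partial_xF[\delta_x\otimes\nu](x,\omega_c)}{F[\delta_x\otimes\nu](x,\omega_c)}\,dx\le-\kappa B$. Equation. The Cauchy problem is $\partial_t\mu+\partial_x(F[\mu]\mu)=0$, $\mu|_{t=0}=\mu_0$. A measure-valued solution on $[0,T)$ with initial datum $\mu_0\in\mathcal{P}_2^\nu(\mathbb{R}^2)$ is $\mu\in\mathcal{C}([0,T);\mathcal{P}_2(\mathbb{R}^2))$ (its $\omega$-marginal stays $\nu$, so $F[\mu_t]$ is defined) such that $t\mapsto\int\varphi\,d\mu_t$ is continuous for every $\varphi\in\mathcal{C}_0(\mathbb{R}^2)$ and $\int\varphi(t)\,d\mu_t=\int\varphi(0)\,d\mu_0+\int_0^t\int(\partial_s\varphi+F[\mu_s]\partial_x\varphi)\,d\mu_s\,ds$ for all $\varphi\in\mathcal{C}^1_0([0,T)\times\mathbb{R}^2)$; global means $T=\infty$.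 Constants: $C_1:=\kappa(M+I)D^2+2I\gamma$; $C_2:=\frac{C_1}{A}+\frac{(((\kappa+1)I+\kappa M)D+I\gamma)(\kappa ID+C_1)}{A(A-((\kappa+1)I+\kappa M)D-I\gamma)}$; $E_2:=\frac{\kappa}{A-((\kappa+1)I+\kappa M)D-I\gamma}\Big(D(\tfrac{3I}{2}+M)+I\gamma+\frac{I(\kappa(I+M)D+I\gamma)}{A}\Big)$. For positive functions $\Delta,\tilde\Delta$, $\mathcal{C}_\nu(\Delta,\tilde\Delta)$ is the set of $\mu\in\mathcal{P}_2^\nu(\mathbb{R}^2)$ with (i) $\operatorname{diam}_x(\operatorname{supp}\mu)\le\Delta(x_c[\mu])$ and (ii) $W_2(\mu(\cdot,\omega),\mu(\cdot,\omega'))\le\tilde\Delta(x_c[\mu])|\omega-\omega'|$ for all $\omega,\omega'\in\Omega$. *)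

theory Defs
  imports "HOL-Analysis.Analysis" "HOL-Probability.Probability"
begin

definition msupp :: "'a::topological_space measure \<Rightarrow> 'a set" where
  "msupp M = {z. \<forall>U. open U \<longrightarrow> z \<in> U \<longrightarrow> emeasure M U \<noteq> 0}"

definition P2 :: "'a::euclidean_space measure set" where
  "P2 = {\<mu>. prob_space \<mu> \<and> sets \<mu> = sets borel \<and> integrable \<mu> (\<lambda>z. (norm z)^2)}"

definition P2nu :: "real measure \<Rightarrow> (real \<times> real) measure set" where
  "P2nu \<nu> = {\<mu> \<in> P2. \<forall>B \<in> sets borel. emeasure \<mu> (UNIV \<times> B) = emeasure \<nu> B}"

definition couplings :: "'a::metric_space measure \<Rightarrow> 'a measure \<Rightarrow> ('a \<times> 'a) measure set" where
  "couplings M N = {\<pi>. prob_space \<pi> \<and> sets \<pi> = sets borel \<and>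
      distr \<pi> borel fst = M \<and> distr \<pi> borel snd = N}"

definition wcost :: "real \<Rightarrow> 'a::metric_space measure \<Rightarrow> 'a measure \<Rightarrow> ennreal" where
  "wcost p M N = (INF \<pi> \<in> couplings M N. \<integral>\<^sup>+ z. ennreal (dist (fst z) (snd z) powr p) \<partial>\<pi>)"

text \<open>p-Wasserstein distance (meaningful when wcost is finite, e.g. on P2).\<close>
definition wasserstein :: "real \<Rightarrow> 'a::metric_space measure \<Rightarrow> 'a measure \<Rightarrow> real" where
  "wasserstein p M N = (enn2real (wcost p M N)) powr (1 / p)"

definition xc :: "(real \<times> real) measure \<Rightarrow> real" where
  "xc \<mu> = (\<integral> z. fst z \<partial>\<mu>)"

definition tau2pi :: "real \<times> real \<Rightarrow> real \<times> real" where
  "tau2pi z = (fst z + 2 * pi, snd z)"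

definition disintegration :: "real measure \<Rightarrow> (real \<times> real) measure \<Rightarrow> (real \<Rightarrow> real measure) \<Rightarrow> bool" where
  "disintegration \<nu> \<mu> K \<longleftrightarrow>
     (\<forall>\<omega>. prob_space (K \<omega>) \<and> sets (K \<omega>) = sets borel) \<and>
     (\<forall>A \<in> sets borel.
        (\<lambda>\<omega>. emeasure (K \<omega>) {x. (x, \<omega>) \<in> A}) \<in> borel_measurable \<nu> \<and>
        emeasure \<mu> A = (\<integral>\<^sup>+ \<omega>. emeasure (K \<omega>) {x. (x, \<omega>) \<in> A} \<partial>\<nu>))"

definition C1_fun :: "('a::euclidean_space \<Rightarrow> real) \<Rightarrow> bool" where
  "C1_fun f \<longleftrightarrow> (\<exists>Df :: 'a \<Rightarrow> 'a \<Rightarrow>\<^sub>L real.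
      (\<forall>z. (f has_derivative blinfun_apply (Df z)) (at z)) \<and> continuous_on UNIV Df)"

definition C2_fun :: "('a::euclidean_space \<Rightarrow> real) \<Rightarrow> bool" where
  "C2_fun f \<longleftrightarrow> (\<exists>(Df :: 'a \<Rightarrow> 'a \<Rightarrow>\<^sub>L real) (D2f :: 'a \<Rightarrow> 'a \<Rightarrow>\<^sub>L ('a \<Rightarrow>\<^sub>L real)).
      (\<forall>z. (f has_derivative blinfun_apply (Df z)) (at z)) \<and>
      (\<forall>z. (Df has_derivative blinfun_apply (D2f z)) (at z)) \<and> continuous_on UNIV D2f)"

type_synonym flux = "(real \<times> real) measure \<Rightarrow> real \<Rightarrow> real \<Rightarrow> real"

definition dxF :: "flux \<Rightarrow> (real \<times> real) measure \<Rightarrow> real \<Rightarrow> real \<Rightarrow> real" where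
  "dxF F \<mu> x \<omega> = deriv (\<lambda>y. F \<mu> y \<omega>) x"

definition dxxF :: "flux \<Rightarrow> (real \<times> real) measure \<Rightarrow> real \<Rightarrow> real \<Rightarrow> real" where
  "dxxF F \<mu> x \<omega> = deriv (\<lambda>y. dxF F \<mu> y \<omega>) x"

definition dwF :: "flux \<Rightarrow> (real \<times> real) measure \<Rightarrow> real \<Rightarrow> real \<Rightarrow> real" where
  "dwF F \<mu> x \<omega> = deriv (\<lambda>v. F \<mu> x v) \<omega>"

definition C0_fun :: "(real \<times> real \<Rightarrow> real) \<Rightarrow> bool" where
  "C0_fun \<phi> \<longleftrightarrow> continuous_on UNIV \<phi> \<and> (\<phi> \<longlongrightarrow> 0) at_infinity"

text \<open>Test functions C^1_0([0,infinity) x R^2): C^1 functions of (t,(x,omega)) whose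
  support in [0,infinity) x R^2 is bounded (hence compact).\<close>
definition test_fun :: "(real \<times> (real \<times> real) \<Rightarrow> real) \<Rightarrow> bool" where
  "test_fun \<phi> \<longleftrightarrow> C1_fun \<phi> \<and> bounded {z. \<phi> z \<noteq> 0 \<and> fst z \<ge> 0}"

text \<open>Global measure-valued solution of d_t mu + d_x(F[mu] mu) = 0, mu(0) = mu0.\<close>
definition mv_solution :: "flux \<Rightarrow> real measure \<Rightarrow> (real \<times> real) measure \<Rightarrow>
    (real \<Rightarrow> (real \<times> real) measure) \<Rightarrow> bool" where
  "mv_solution F \<nu> \<mu>0 \<mu> \<longleftrightarrow>
     \<mu> 0 = \<mu>0 \<and>
     (\<forall>t\<ge>0. \<mu> t \<in> P2nu \<nu>) \<and>
     (\<forall>t\<ge>0. ((\<lambda>s. wasserstein 2 (\<mu> s) (\<mu> t)) \<longlongrightarrow> 0) (at t within {0..})) \<and>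
     (\<forall>\<phi>. C0_fun \<phi> \<longrightarrow> continuous_on {0..} (\<lambda>t. \<integral> z. \<phi> z \<partial>(\<mu> t))) \<and>
     (\<forall>\<phi>. test_fun \<phi> \<longrightarrow> (\<forall>t\<ge>0.
        (\<integral> z. \<phi> (t, z) \<partial>(\<mu> t)) =
          (\<integral> z. \<phi> (0, z) \<partial>\<mu>0) +
          integral {0..t} (\<lambda>s. \<integral> z. (deriv (\<lambda>r. \<phi> (r, z)) s
               + F (\<mu> s) (fst z) (snd z) * deriv (\<lambda>y. \<phi> (s, (y, snd z))) (fst z)) \<partial>(\<mu> s))))"

definition C_nu :: "real measure \<Rightarrow> (real \<Rightarrow> real) \<Rightarrow> (real \<Rightarrow> real) \<Rightarrow> (real \<times> real) measure set" where
  "C_nu \<nu> \<Delta> \<Delta>t = {\<mu> \<in> P2nu \<nu>.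
      (\<forall>z \<in> msupp \<mu>. \<forall>z' \<in> msupp \<mu>. \<bar>fst z - fst z'\<bar> \<le> \<Delta> (xc \<mu>)) \<and>
      (\<exists>K. disintegration \<nu> \<mu> K \<and>
         (\<forall>\<omega> \<in> msupp \<nu>. \<forall>\<omega>' \<in> msupp \<nu>.
            wcost 2 (K \<omega>) (K \<omega>') < \<top> \<and>
            wasserstein 2 (K \<omega>) (K \<omega>') \<le> \<Delta>t (xc \<mu>) * \<bar>\<omega> - \<omega>'\<bar>))}"

definition C1c :: "real \<Rightarrow> real \<Rightarrow> real \<Rightarrow> real \<Rightarrow> real \<Rightarrow> real" where
  "C1c \<kappa> M I D \<gamma> = \<kappa> * (M + I) * D^2 + 2 * I * \<gamma>"

definition C2c :: "real \<Rightarrow> real \<Rightarrow> real \<Rightarrow> real \<Rightarrow> real \<Rightarrow> real \<Rightarrow> real" where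
  "C2c A \<kappa> M I D \<gamma> =
     C1c \<kappa> M I D \<gamma> / A +
     ((((\<kappa> + 1) * I + \<kappa> * M) * D + I * \<gamma>) * (\<kappa> * I * D + C1c \<kappa> M I D \<gamma>)) /
       (A * (A - ((\<kappa> + 1) * I + \<kappa> * M) * D - I * \<gamma>))"

definition E2c :: "real \<Rightarrow> real \<Rightarrow> real \<Rightarrow> real \<Rightarrow> real \<Rightarrow> real \<Rightarrow> real" where
  "E2c A \<kappa> M I D \<gamma> =
     \<kappa> / (A - ((\<kappa> + 1) * I + \<kappa> * M) * D - I * \<gamma>) *
     (D * (3 * I / 2 + M) + I * \<gamma> + I * (\<kappa> * (I + M) * D + I * \<gamma>) / A)"

end

theory Submission
  imports Defs "HOL-Complex_Analysis.Great_Picard"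
begin

text \<open>If \<open>r t = \<Delta> (x\<^sub>c t)\<close> and
  \<open>a t\<close> is the slope of the flux of the concentrated state at \<open>x\<^sub>c t\<close>, the equation for \<open>\<Delta>\<close> gives
  \<open>r' \<ge> C\<^sub>1 + a r\<close>. The distance of two particles in the support satisfies \<open>p' \<le> a p + C\<^sub>1\<close>, which
  yields the diameter bound, and also \<open>p' \<le> (a + C\<^sub>1 / D) p + I |\<omega> - \<omega>'|\<close>. Since \<open>r\<close> stays
  strictly below \<open>D\<close>, it grows strictly faster than the linear part, so \<open>p / r\<close> is contracted and
  every large multiple of \<open>\<Delta>\<close> is an admissible choice of \<open>\<Delta>\<^sub>t\<close>.

  A solution of the Cauchy problem is the image of its initial datum under the characteristics:
  testing the equation with bumps whose edges move slightly faster than the characteristics bounds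
  the transported mass of boxes from below, and equality follows because the total mass is fixed.

  For the periodic solution it suffices to look at data carried by the graph of a Lipschitz function
  \<open>x = X(\<omega>)\<close> with mean \<open>0\<close>. These functions form a compact convex set, which the map \<open>X \<mapsto> X\<^sub>T - 2\<pi>\<close>
  at the first time \<open>T\<close> at which the mean reaches \<open>2\<pi>\<close> sends continuously into itself; Schauder's theorem applies.\<close>

section \<open>Differential inequalities and differential equations\<close>

text \<open>Fluxes of different measures are compared only at frequencies in \<Omega>, and the mixed
  derivative of a flux has no given bound. The first restriction is why every flow is driven by a
  Lipschitz extension of the flux in the frequency. The second is why passing to the mean frequency
  costs an additive \<open>2 * I * \<gamma>\<close>, which enters \<open>C\<^sub>1\<close>.
  \<open>C\<^sub>2\<close> is calibrated so that, with the centre moving at speed at least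
  \<open>A - \<epsilon>\<close>, the growth of \<Delta> along the centre pays for
  \<open>C\<^sub>1\<close> and also for replacing the actual centre speed by that of the
  concentrated state. The particle estimates hold only while the diameter is at most
  \<open>D\<close>. A crude bound keeps it there for a time step that depends only on the gap
  between \<Delta> and \<open>D\<close>, so the sharp bound can be continued from step to step.
  Transport by characteristics has two uses: it gives invariance for every solution, and together
  with a stability estimate it shows that a graph datum has a single solution, so periodicity holds
  for every solution starting at the fixed graph.\<close>

lemma diff_ineq_nonpos:
  fixes u u' :: "real \<Rightarrow> real"
  assumes ab: "a \<le> b"
    and der: "\<And>t. t \<in> {a..b} \<Longrightarrow> (u has_real_derivative u' t) (at t within {a..b})"
    and ineq: "\<And>t. t \<in> {a..b} \<Longrightarrow> u t > 0 \<Longrightarrow> u' t \<le> L * u t"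
    and init: "u a \<le> 0"
  shows "u b \<le> 0"
proof (rule ccontr)
  assume "\<not> u b \<le> 0"
  then have ub: "u b > 0" by simp
  have cont: "continuous_on {a..b} u"
    by (rule DERIV_continuous_on[OF der])
  \<comment> \<open>The last time \<open>t0\<close> at which \<open>u\<close> is nonpositive. After
    it \<open>u\<close> is positive, so the differential inequality is needed only there; later
    applications may use the sign of the compared quantity when they verify it.\<close>
  define S where "S = {t \<in> {a..b}. u t \<le> 0}"
  have "closed S"
    using continuous_closed_preimage[OF cont closed_real_atLeastAtMost closed_atMost, of 0]
    by (simp add: S_def vimage_def Int_def)
  moreover have "bounded S"
    by (rule bounded_subset[of "{a..b}"]) (auto simp: S_def)
  moreover have "a \<in> S" using ab init by (simp add: S_def)
  ultimately obtain t0 where t0: "t0 \<in> S" "\<And>t. t \<in> S \<Longrightarrow> t \<le> t0"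
    using compact_attains_sup[of S] by (auto simp: compact_eq_bounded_closed)
  have t0b: "t0 < b" "a \<le> t0" "u t0 \<le> 0"
    using t0(1) ub by (auto simp: S_def less_le)
  have upos: "u t > 0" if "t0 < t" "t \<le> b" for t
    using t0(2)[of t] that t0b by (force simp: S_def)
  have "exp (- L * b) * u b \<le> exp (- L * t0) * u t0"
  proof (rule DERIV_nonpos_imp_decreasing_open[of t0 b "\<lambda>t. exp (- L * t) * u t"])
    fix t assume t: "t0 < t" "t < b"
    have "(u has_real_derivative u' t) (at t)"
      using der[of t] t t0b by (simp add: at_within_Icc_at)
    then have "((\<lambda>t. exp (- L * t) * u t) has_real_derivative exp (- L * t) * (u' t - L * u t)) (at t)"
      by (auto intro!: derivative_eq_intros simp: algebra_simps)
    moreover have "exp (- L * t) * (u' t - L * u t) \<le> 0"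
      using ineq[of t] upos[of t] t t0b by (intro mult_nonneg_nonpos) auto
    ultimately show "\<exists>y. ((\<lambda>t. exp (- L * t) * u t) has_real_derivative y) (at t) \<and> y \<le> 0"
      by blast
  qed (use t0b in \<open>auto intro!: continuous_intros continuous_on_subset[OF cont]\<close>)
  moreover have "exp (- L * t0) * u t0 \<le> 0"
    using t0b by (simp add: mult_nonneg_nonpos)
  moreover have "exp (- L * b) * u b > 0" using ub by simp
  ultimately show False by linarith
qed

lemma diff_ineq_le:
  fixes p z p' z' :: "real \<Rightarrow> real"
  assumes "a \<le> b"
    and "\<And>t. t \<in> {a..b} \<Longrightarrow> (p has_real_derivative p' t) (at t within {a..b})"
    and "\<And>t. t \<in> {a..b} \<Longrightarrow> (z has_real_derivative z' t) (at t within {a..b})"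
    and "\<And>t. t \<in> {a..b} \<Longrightarrow> p t > z t \<Longrightarrow> p' t - z' t \<le> L * (p t - z t)"
    and "p a \<le> z a"
  shows "p b \<le> z b"
  using diff_ineq_nonpos[of a b "\<lambda>t. p t - z t" "\<lambda>t. p' t - z' t" L] assms
  by (auto intro: derivative_intros)

lemma at_within_atLeast_Icc:
  fixes t :: real
  assumes "a \<le> t" "t < b"
  shows "at t within {a..b} = at t within {a..}"
  by (rule at_within_nhd[of _ "{..<b}"]) (use assms in auto)

lemma integral_has_vector_derivative_atLeast:
  fixes g :: "real \<Rightarrow> 'a::banach"
  assumes "continuous_on {0..} g" "t \<ge> 0"
  shows "((\<lambda>u. integral {0..u} g) has_vector_derivative g t) (at t within {0..})"
proof -
  have "((\<lambda>u. integral {0..u} g) has_vector_derivative g t) (at t within {0..t+1})"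
    by (rule integral_has_vector_derivative) (use assms in \<open>auto intro: continuous_on_subset\<close>)
  then show ?thesis
    using at_within_atLeast_Icc[of 0 t "t+1"] assms by simp
qed

text \<open>The increments of the Picard iterates are bounded by
  \<open>(L * t) ^ n / fact n\<close>, so the iterates converge uniformly on every bounded interval
  and no short time steps have to be glued. The Banach-valued form serves both the scalar
  characteristics and the evolution of whole graphs.\<close>

lemma picard_lindelof_global:
  fixes f :: "real \<Rightarrow> 'a::banach \<Rightarrow> 'a"
  assumes L: "0 \<le> L" and lip: "\<And>t x y. 0 \<le> t \<Longrightarrow> norm (f t x - f t y) \<le> L * norm (x - y)"
   and cont: "\<And>x. continuous_on {0..} (\<lambda>t. f t x)"
  shows "\<exists>X. X 0 = x0 \<and> (\<forall>t\<ge>0. (X has_vector_derivative f t (X t)) (at t within {0..}))"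
proof -
  \<comment> \<open>Continuity in time is assumed only for a frozen argument; the Lipschitz bound
    extends it to moving arguments.\<close>
  have fc: "continuous_on {0..} (\<lambda>s. f s (y s))" if y: "continuous_on {0..} y" for y
    unfolding continuous_on_def
  proof
    fix t :: real assume t: "t \<in> {0..}"
    have 1: "((\<lambda>s. f s (y t)) \<longlongrightarrow> f t (y t)) (at t within {0..})"
      using cont[of "y t"] t by (auto simp: continuous_on_def)
    have "((\<lambda>s. L * norm (y s - y t)) \<longlongrightarrow> L * norm (y t - y t)) (at t within {0..})"
      using y t by (intro tendsto_intros) (auto simp: continuous_on_def)
    then have "((\<lambda>s. L * norm (y s - y t)) \<longlongrightarrow> 0) (at t within {0..})" by simp
    then have "((\<lambda>s. f s (y s) - f s (y t)) \<longlongrightarrow> 0) (at t within {0..})"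
      by (rule Lim_null_comparison[rotated]) (use lip in \<open>simp_all add: eventually_at_filter\<close>)
    from tendsto_add[OF this 1] show "((\<lambda>s. f s (y s)) \<longlongrightarrow> f t (y t)) (at t within {0..})" by simp
  qed
  define P where "P = rec_nat (\<lambda>t. x0) (\<lambda>n y t. x0 + integral {0..t} (\<lambda>s. f s (y s)))"
  have P0: "P 0 = (\<lambda>t. x0)" and PS: "P (Suc n) = (\<lambda>t. x0 + integral {0..t} (\<lambda>s. f s (P n s)))" for n
    by (simp_all add: P_def)
  have Pc: "continuous_on {0..} (P n)" for n
  proof (induction n)
    case (Suc n)
    have "continuous_on {0..} (\<lambda>t. integral {0..t} (\<lambda>s. f s (P n s)))"
      by (rule continuous_on_vector_derivative)
         (use integral_has_vector_derivative_atLeast[OF fc[OF Suc]] in auto)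
    then show ?case by (simp add: PS continuous_on_add)
  qed (simp add: P0)
  have fP: "(\<lambda>s. f s (P n s)) integrable_on {0..t}" for n t
    by (intro integrable_continuous_interval continuous_on_subset[OF fc[OF Pc]]) auto
  \<comment> \<open>\<open>C\<close> comes from the first increment alone: \<open>T\<close> times a
    bound of the field at the constant path \<open>x0\<close>. Each further integration contributes
    one factor \<open>L * t / n\<close>.\<close>
  have bnd: "\<exists>C. \<forall>n. \<forall>t\<in>{0..T}. norm (P (Suc n) t - P n t) \<le> C * ((L * t) ^ n / fact n)" for T
  proof -
    have "compact ((\<lambda>s. f s x0) ` {0..T})"
      by (intro compact_continuous_image continuous_on_subset[OF cont]) auto
    then obtain C0 where C0: "C0 > 0" "\<And>s. s \<in> {0..T} \<Longrightarrow> norm (f s x0) \<le> C0"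
      by (force dest!: compact_imp_bounded simp: bounded_pos)
    define C where "C = C0 * max T 0"
    have "norm (P (Suc n) t - P n t) \<le> C * ((L * t) ^ n / fact n)" if "t \<in> {0..T}" for n t
      using that
    proof (induction n arbitrary: t)
      case 0
      have "norm (integral {0..t} (\<lambda>s. f s x0)) \<le> integral {0..t} (\<lambda>s. C0)"
        using 0 fP[of 0 t] C0 by (intro integral_norm_bound_integral) (auto simp: P0)
      also have "\<dots> \<le> C" using 0 C0 by (auto simp: C_def)
      finally show ?case using 0 by (simp add: PS P0)
    next
      case (Suc n)
      have hi: "((\<lambda>s. L * (C * ((L * s) ^ n / fact n))) has_integral
          C * ((L * t) ^ Suc n / fact (Suc n)) - C * ((L * 0) ^ Suc n / fact (Suc n))) {0..t}"
      proof (rule fundamental_theorem_of_calculus)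
        fix s assume "s \<in> {0..t}"
        have "((\<lambda>s. C * ((L * s) ^ Suc n / fact (Suc n))) has_real_derivative
              C * ((real (Suc n) * (L * s) ^ n * L) / fact (Suc n))) (at s within {0..t})"
          by (auto intro!: derivative_eq_intros simp del: fact_Suc power_Suc of_nat_Suc)
        also have "C * ((real (Suc n) * (L * s) ^ n * L) / fact (Suc n)) = L * (C * ((L * s) ^ n / fact n))"
          by (simp add: field_simps del: of_nat_Suc)
        finally show "((\<lambda>s. C * ((L * s) ^ Suc n / fact (Suc n))) has_vector_derivative
            L * (C * ((L * s) ^ n / fact n))) (at s within {0..t})"
          by (simp add: has_real_derivative_iff_has_vector_derivative)
      qed (use Suc in auto)
      have "norm (P (Suc (Suc n)) t - P (Suc n) t)
          = norm (integral {0..t} (\<lambda>s. f s (P (Suc n) s) - f s (P n s)))"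
        by (subst Henstock_Kurzweil_Integration.integral_diff[OF fP fP])
           (simp add: PS[of "Suc n"] PS[of n, THEN fun_cong, of t])
      also have "\<dots> \<le> integral {0..t} (\<lambda>s. L * (C * ((L * s) ^ n / fact n)))"
      proof (rule integral_norm_bound_integral)
        fix s assume s: "s \<in> {0..t}"
        have "norm (f s (P (Suc n) s) - f s (P n s)) \<le> L * norm (P (Suc n) s - P n s)"
          using s by (intro lip) auto
        also have "\<dots> \<le> L * (C * ((L * s) ^ n / fact n))"
          using Suc.IH[of s] s Suc.prems L by (intro mult_left_mono) auto
        finally show "norm (f s (P (Suc n) s) - f s (P n s)) \<le> L * (C * ((L * s) ^ n / fact n))" .
      qed (use hi fP in \<open>auto intro: Henstock_Kurzweil_Integration.integrable_diff\<close>)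
      also have "\<dots> = C * ((L * t) ^ Suc n / fact (Suc n))"
        using integral_unique[OF hi] by simp
      finally show ?case .
    qed
    then show ?thesis by blast
  qed
  define X where "X t = x0 + (\<Sum>k. P (Suc k) t - P k t)" for t
  have Psum: "P n t = x0 + (\<Sum>k<n. P (Suc k) t - P k t)" for n t
    by (induction n) (simp_all add: P0 algebra_simps)
  have ul: "uniform_limit {0..T} P X sequentially" for T
  proof -
    obtain C where C: "\<And>n t. t\<in>{0..T} \<Longrightarrow> norm (P (Suc n) t - P n t) \<le> C * ((L * t) ^ n / fact n)"
      using bnd by blast
    have C': "norm (P (Suc n) t - P n t) \<le> max C 0 * ((L * T) ^ n / fact n)" if "t \<in> {0..T}" for n t
    proof -
      have "C * ((L * t) ^ n / fact n) \<le> max C 0 * ((L * t) ^ n / fact n)"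
        using that L by (intro mult_right_mono) auto
      also have "\<dots> \<le> max C 0 * ((L * T) ^ n / fact n)"
        using that L by (intro mult_left_mono divide_right_mono power_mono) auto
      finally show ?thesis using C[OF that, of n] by simp
    qed
    have "summable (\<lambda>n. (L * T) ^ n / fact n)"
      using summable_exp[of "L*T"] by (simp add: field_simps)
    then have sm: "summable (\<lambda>n. max C 0 * ((L * T) ^ n / fact n))"
      by (rule summable_mult)
    define dP where "dP n t = P (Suc n) t - P n t" for n t
    have "uniform_limit {0..T} (\<lambda>n t. \<Sum>k<n. dP k t) (\<lambda>t. \<Sum>k. dP k t) sequentially"
      using C' by (intro Weierstrass_m_test[OF _ sm]) (simp add: dP_def)
    from uniform_limit_add[OF uniform_limit_const[where c="\<lambda>_. x0"] this]
    have "uniform_limit {0..T} (\<lambda>n t. x0 + (\<Sum>k<n. dP k t)) (\<lambda>t. x0 + (\<Sum>k. dP k t)) sequentially" .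
    moreover have "(\<lambda>n t. x0 + (\<Sum>k<n. dP k t)) = P"
      unfolding fun_eq_iff dP_def using Psum by metis
    moreover have "(\<lambda>t. x0 + (\<Sum>k. dP k t)) = X"
      by (simp add: fun_eq_iff dP_def X_def)
    ultimately show ?thesis by simp
  qed
  have Xc: "continuous_on {0..} X"
  proof -
    have "continuous_on {0..T} X" for T
      by (rule uniform_limit_theorem[OF _ ul])
         (auto intro!: always_eventually intro: continuous_on_subset[OF Pc])
    then show ?thesis
      unfolding continuous_on_eq_continuous_within continuous_within
      using at_within_atLeast_Icc[of 0] by (metis atLeastAtMost_iff atLeast_iff less_add_one less_imp_le)
  qed
  have Xeq: "X t = x0 + integral {0..t} (\<lambda>s. f s (X s))" if t: "t \<ge> 0" for t
  proof -
    have "uniform_limit {0..t} (\<lambda>n s. f s (P n s)) (\<lambda>s. f s (X s)) sequentially"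
    proof (rule uniform_limitI)
      fix e :: real assume e: "e > 0"
      have "\<forall>\<^sub>F n in sequentially. \<forall>s\<in>{0..t}. dist (P n s) (X s) < e / (L + 1)"
        using uniform_limitD[OF ul, of "e / (L+1)"] e L by simp
      then show "\<forall>\<^sub>F n in sequentially. \<forall>s\<in>{0..t}. dist (f s (P n s)) (f s (X s)) < e"
      proof eventually_elim
        case (elim n)
        show ?case
        proof
          fix s assume s: "s \<in> {0..t}"
          have "dist (f s (P n s)) (f s (X s)) \<le> L * dist (P n s) (X s)"
            using lip[of s] s by (simp add: dist_norm)
          also have "\<dots> \<le> L * (e / (L + 1))"
            using elim s L by (intro mult_left_mono) (auto simp: less_imp_le)
          also have "\<dots> < e" using e L by (simp add: field_simps)
          finally show "dist (f s (P n s)) (f s (X s)) < e" .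
        qed
      qed
    qed
    then obtain I J where IJ: "\<And>n. ((\<lambda>s. f s (P n s)) has_integral I n) {0..t}"
      "((\<lambda>s. f s (X s)) has_integral J) {0..t}" "I \<longlonglongrightarrow> J"
      by (rule uniform_limit_integral) (auto intro: continuous_on_subset[OF fc[OF Pc]])
    have "(\<lambda>n. P (Suc n) t) \<longlonglongrightarrow> x0 + J"
      using integral_unique[OF IJ(1)] IJ(3) by (simp add: PS tendsto_add)
    moreover have "(\<lambda>n. P (Suc n) t) \<longlonglongrightarrow> X t"
      by (rule LIMSEQ_Suc, rule tendsto_uniform_limitI[OF ul[of t]]) (use t in auto)
    ultimately have "X t = x0 + J" using LIMSEQ_unique by blast
    then show ?thesis using integral_unique[OF IJ(2)] by simp
  qed
  have "(X has_vector_derivative f t (X t)) (at t within {0..})" if t: "t \<ge> 0" for t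
  proof -
    have "((\<lambda>t. x0 + integral {0..t} (\<lambda>s. f s (X s))) has_vector_derivative f t (X t)) (at t within {0..})"
      using has_vector_derivative_add[OF has_vector_derivative_const
          integral_has_vector_derivative_atLeast[OF fc[OF Xc] t], of x0] by simp
    then show ?thesis
      by (rule has_vector_derivative_transform[rotated 2]) (use t Xeq in auto)
  qed
  moreover have "X 0 = x0" using Xeq[of 0] by simp
  ultimately show ?thesis by blast
qed

section \<open>Differentiation under the integral sign\<close>

text \<open>The exceptional null set is the same for all times: the mean value theorem along the
  path of a single \<open>z\<close> then bounds its difference quotients by \<bar>C\<bar>, and
  dominated convergence applies. One-sided derivatives at the ends of the interval are included
  because the flows start at time 0.\<close>

lemma has_real_derivative_integral_dominated:
  fixes f f' :: "real \<Rightarrow> 'z \<Rightarrow> real"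
  assumes fin: "finite_measure N" and s: "s \<in> {a..b}"
    and der: "AE z in N. \<forall>r\<in>{a..b}. ((\<lambda>r. f r z) has_real_derivative f' r z) (at r within {a..b}) \<and> \<bar>f' r z\<bar> \<le> C"
    and int: "\<And>r. r \<in> {a..b} \<Longrightarrow> integrable N (f r)"
    and meas: "f' s \<in> borel_measurable N"
  shows "((\<lambda>r. \<integral>z. f r z \<partial>N) has_real_derivative (\<integral>z. f' s z \<partial>N)) (at s within {a..b})"
proof -
  interpret finite_measure N by fact
  have "((\<lambda>r. ((\<integral>z. f r z \<partial>N) - (\<integral>z. f s z \<partial>N)) / (r - s)) \<longlongrightarrow> (\<integral>z. f' s z \<partial>N)) (at s within {a..b})"
    unfolding tendsto_at_iff_sequentially
  proof (intro allI impI)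
    fix X :: "nat \<Rightarrow> real" assume X: "\<forall>i. X i \<in> {a..b} - {s}" "X \<longlonglongrightarrow> s"
    have "(\<lambda>i. \<integral>z. (f (X i) z - f s z) / (X i - s) \<partial>N) \<longlonglongrightarrow> (\<integral>z. f' s z \<partial>N)"
    proof (rule integral_dominated_convergence[where w="\<lambda>_. \<bar>C\<bar>"])
      show "(\<lambda>z. (f (X i) z - f s z) / (X i - s)) \<in> borel_measurable N" for i
        using int[of "X i"] int[OF s] X by (intro borel_measurable_divide borel_measurable_diff) auto
      show "AE z in N. (\<lambda>i. (f (X i) z - f s z) / (X i - s)) \<longlonglongrightarrow> f' s z"
        using der
      proof eventually_elim
        case (elim z)
        then have "((\<lambda>r. (f r z - f s z) / (r - s)) \<longlongrightarrow> f' s z) (at s within {a..b})"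
          using s by (auto simp: has_field_derivative_iff)
        then show ?case
          unfolding tendsto_at_iff_sequentially using X by (auto simp: o_def)
      qed
      show "AE z in N. norm ((f (X i) z - f s z) / (X i - s)) \<le> \<bar>C\<bar>" for i
        using der
      proof eventually_elim
        case (elim z)
        have "norm (f (X i) z - f s z) \<le> C * norm (X i - s)"
          by (rule field_differentiable_bound[of "{a..b}" "\<lambda>r. f r z" "\<lambda>r. f' r z"])
             (use elim X s in auto)
        moreover have "C * norm (X i - s) \<le> \<bar>C\<bar> * norm (X i - s)"
          by (intro mult_right_mono) auto
        ultimately have "norm (f (X i) z - f s z) \<le> \<bar>C\<bar> * norm (X i - s)" by linarith
        then show ?case using X by (simp add: divide_le_eq)
      qed
    qed (use meas in auto)
    moreover have "(\<integral>z. (f (X i) z - f s z) / (X i - s) \<partial>N) = ((\<integral>z. f (X i) z \<partial>N) - (\<integral>z. f s z \<partial>N)) / (X i - s)" for i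
      using int[of "X i"] int[OF s] X by simp
    ultimately show "((\<lambda>r. ((\<integral>z. f r z \<partial>N) - (\<integral>z. f s z \<partial>N)) / (r - s)) \<circ> X) \<longlonglongrightarrow> (\<integral>z. f' s z \<partial>N)"
      by (simp only: o_def)
  qed
  then show ?thesis by (simp add: has_field_derivative_iff)
qed

section \<open>Continuously differentiable cut-off functions\<close>

lemma C1_fun_continuous: "C1_fun f \<Longrightarrow> continuous_on UNIV f"
  unfolding C1_fun_def by (meson continuous_at_imp_continuous_on has_derivative_continuous)

lemma C1_fun_bounded_linear: "bounded_linear f \<Longrightarrow> C1_fun f"
  unfolding C1_fun_def
  by (intro exI[of _ "\<lambda>_. Blinfun f"]) (auto simp: bounded_linear_Blinfun_apply bounded_linear_imp_has_derivative)

lemma C1_fun_const: "C1_fun (\<lambda>_::'a::euclidean_space. c)"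
proof -
  have 1: "blinfun_apply (0 :: 'a \<Rightarrow>\<^sub>L real) = (\<lambda>_. 0)" by (rule ext) simp
  have 2: "((\<lambda>_. c) has_derivative blinfun_apply (0 :: 'a \<Rightarrow>\<^sub>L real)) (at z)" for z
    unfolding 1 by (rule has_derivative_const)
  show ?thesis
    unfolding C1_fun_def
    by (rule exI[of _ "\<lambda>_. 0"]) (use 2 in simp)
qed

lemma C1_fun_diff: "C1_fun f \<Longrightarrow> C1_fun g \<Longrightarrow> C1_fun (\<lambda>z. f z - g z)"
  unfolding C1_fun_def
proof (elim exE conjE)
  fix Df Dg :: "'a \<Rightarrow> 'a \<Rightarrow>\<^sub>L real"
  assume "\<forall>z. (f has_derivative blinfun_apply (Df z)) (at z)" "continuous_on UNIV Df"
     "\<forall>z. (g has_derivative blinfun_apply (Dg z)) (at z)" "continuous_on UNIV Dg"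
  then show "\<exists>D. (\<forall>z. ((\<lambda>z. f z - g z) has_derivative blinfun_apply (D z)) (at z)) \<and> continuous_on UNIV D"
    by (intro exI[of _ "\<lambda>z. Df z - Dg z"])
       (auto intro!: continuous_intros derivative_eq_intros simp: blinfun.diff_left)
qed

lemma C1_fun_mult: "C1_fun f \<Longrightarrow> C1_fun g \<Longrightarrow> C1_fun (\<lambda>z. f z * g z)"
proof -
  assume fg: "C1_fun f" "C1_fun g"
  then obtain Df Dg :: "'a \<Rightarrow> 'a \<Rightarrow>\<^sub>L real" where
    "\<And>z. (f has_derivative blinfun_apply (Df z)) (at z)" "continuous_on UNIV Df"
    "\<And>z. (g has_derivative blinfun_apply (Dg z)) (at z)" "continuous_on UNIV Dg"
    unfolding C1_fun_def by blast
  then show "C1_fun (\<lambda>z. f z * g z)"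
    unfolding C1_fun_def using C1_fun_continuous[OF fg(1)] C1_fun_continuous[OF fg(2)]
    by (intro exI[of _ "\<lambda>z. f z *\<^sub>R Dg z + g z *\<^sub>R Df z"])
       (auto intro!: continuous_intros derivative_eq_intros simp: blinfun.add_left blinfun.scaleR_left)
qed

lemma C1_fun_compose:
  assumes f: "C1_fun f" and h: "\<And>u. (h has_real_derivative h' u) (at u)" "continuous_on UNIV h'"
  shows "C1_fun (\<lambda>z. h (f z))"
proof -
  obtain Df :: "'a \<Rightarrow> 'a \<Rightarrow>\<^sub>L real" where
    Df: "\<And>z. (f has_derivative blinfun_apply (Df z)) (at z)" "continuous_on UNIV Df"
    using f unfolding C1_fun_def by blast
  have "((\<lambda>z. h (f z)) has_derivative blinfun_apply (h' (f z) *\<^sub>R Df z)) (at z)" for z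
    using has_derivative_compose[OF Df(1) h(1)[unfolded has_field_derivative_def], of z]
    by (simp add: blinfun.scaleR_left[abs_def])
  moreover have "continuous_on UNIV (\<lambda>z. h' (f z) *\<^sub>R Df z)"
    by (intro continuous_intros Df(2) continuous_on_compose2[OF h(2) C1_fun_continuous[OF f]]) auto
  ultimately show ?thesis unfolding C1_fun_def by (intro exI[of _ "\<lambda>z. h' (f z) *\<^sub>R Df z"]) simp
qed

definition possq :: "real \<Rightarrow> real" where "possq u = (max 0 u)\<^sup>2"

lemma possq_deriv: "(possq has_real_derivative 2 * max 0 u) (at u)"
proof -
  have "possq = (\<lambda>u. if u \<in> {0..} then u\<^sup>2 else 0)"
    by (auto simp: possq_def fun_eq_iff)
  moreover have "((\<lambda>u. if u \<in> {0..} then u\<^sup>2 else 0) has_vector_derivative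
      (if u \<in> {0..} then 2 * u else 0)) (at u within UNIV)"
    by (rule has_vector_derivative_If_within_closures[where T="{..<0}"])
       (auto intro!: derivative_eq_intros simp: has_real_derivative_iff_has_vector_derivative[symmetric])
  ultimately show ?thesis
    by (simp add: has_real_derivative_iff_has_vector_derivative max_def split: if_splits)
qed

text \<open>A nonincreasing C^1 cut-off, equal to 1 for \<open>u \<le> 0\<close> and to 0 for
  \<open>u \<ge> 1\<close>. Nesting \<open>possq\<close> twice makes both junctions differentiable
  with derivative 0.\<close>

definition ramp :: "real \<Rightarrow> real" where "ramp u = possq (1 - possq u)"
definition ramp' :: "real \<Rightarrow> real" where "ramp' u = - 4 * max 0 (1 - possq u) * max 0 u"

lemma ramp_deriv: "(ramp has_real_derivative ramp' u) (at u)"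
proof -
  have "((\<lambda>u. possq (1 - possq u)) has_real_derivative (2 * max 0 (1 - possq u)) * (0 - 2 * max 0 u)) (at u)"
    by (intro DERIV_chain2[OF possq_deriv] DERIV_diff DERIV_const possq_deriv)
  then show ?thesis by (simp add: ramp_def[abs_def] ramp'_def mult.assoc)
qed

lemma possq_continuous: "continuous_on UNIV possq"
  using possq_deriv by (meson DERIV_isCont continuous_at_imp_continuous_on)

lemma ramp'_continuous: "continuous_on UNIV ramp'"
  unfolding ramp'_def by (intro continuous_intros possq_continuous)

lemma ramp_continuous: "continuous_on UNIV ramp"
  using ramp_deriv by (meson DERIV_isCont continuous_at_imp_continuous_on)

lemma ramp_eq_1: "u \<le> 0 \<Longrightarrow> ramp u = 1" by (simp add: ramp_def possq_def)
lemma ramp_eq_0: "1 \<le> u \<Longrightarrow> ramp u = 0" by (simp add: ramp_def possq_def)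
lemma ramp_nonneg: "0 \<le> ramp u" by (simp add: ramp_def possq_def)
lemma ramp'_nonpos: "ramp' u \<le> 0"
  by (simp add: ramp'_def mult_nonneg_nonneg)
lemma ramp'_eq_0: "u \<le> 0 \<or> 1 \<le> u \<Longrightarrow> ramp' u = 0"
  by (auto simp: ramp'_def possq_def)
lemma ramp_antimono: "u \<le> v \<Longrightarrow> ramp v \<le> ramp u"
  by (rule DERIV_nonpos_imp_nonincreasing) (use ramp_deriv ramp'_nonpos in blast)+
lemma ramp_le_1: "ramp u \<le> 1"
  using ramp_antimono[of "min u 0" u] ramp_eq_1[of "min u 0"] by simp

lemma C1_fun_ramp: "C1_fun f \<Longrightarrow> C1_fun (\<lambda>z. ramp (f z))"
  by (rule C1_fun_compose[OF _ ramp_deriv ramp'_continuous])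

text \<open>Test functions must be C^1 at negative times as well, whereas characteristics exist for
  \<open>t \<ge> 0\<close> only. Continuing a curve by its tangent at 0 keeps the derivative
  continuous.\<close>

lemma extend_derivative_below_0:
  fixes y g :: "real \<Rightarrow> real"
  assumes "\<And>t. t \<ge> 0 \<Longrightarrow> (y has_real_derivative g t) (at t within {0..})"
  shows "((\<lambda>t. if t \<in> {0..} then y t else y 0 + t * g 0) has_real_derivative g (max 0 t)) (at t)"
proof -
  have "((\<lambda>t. if t \<in> {0..} then y t else y 0 + t * g 0) has_vector_derivative
      (if t \<in> {0..} then g t else g 0)) (at t within UNIV)"
    using assms
    by (intro has_vector_derivative_If_within_closures[where T="{..<0}" and f'=g])
       (auto intro!: derivative_eq_intros simp: has_real_derivative_iff_has_vector_derivative[symmetric] insert_absorb)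
  then show ?thesis
    by (simp add: has_real_derivative_iff_has_vector_derivative max_def split: if_splits)
qed

section \<open>Schauder's fixed point theorem\<close>

text \<open>Kuhn's combinatorial lemma on a fine grid. Points are functions on the naturals of which
  the first \<open>n\<close> values matter, because \<open>n\<close> will be the size of a net and
  cannot be a type.\<close>

lemma approx_brouwer_cube:
  fixes f :: "(nat \<Rightarrow> real) \<Rightarrow> nat \<Rightarrow> real" and n :: nat
  defines "Q \<equiv> {x. \<forall>i<n. 0 \<le> x i \<and> x i \<le> 1}"
  assumes maps: "\<And>x i. x \<in> Q \<Longrightarrow> i < n \<Longrightarrow> 0 \<le> f x i \<and> f x i \<le> 1"
   and uc: "\<And>e. e > 0 \<Longrightarrow> \<exists>d>0. \<forall>x\<in>Q. \<forall>y\<in>Q. (\<forall>i<n. \<bar>x i - y i\<bar> \<le> d) \<longrightarrow> (\<forall>i<n. \<bar>f x i - f y i\<bar> \<le> e)"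
   and e: "e > 0"
  shows "\<exists>x\<in>Q. \<forall>i<n. \<bar>f x i - x i\<bar> \<le> e"
proof -
  obtain d where d: "d > 0" "\<And>x y i. x \<in> Q \<Longrightarrow> y \<in> Q \<Longrightarrow> (\<And>i. i < n \<Longrightarrow> \<bar>x i - y i\<bar> \<le> d) \<Longrightarrow> i < n \<Longrightarrow> \<bar>f x i - f y i\<bar> \<le> e/2"
    using uc[of "e/2"] e by (metis half_gt_zero)
  \<comment> \<open>The mesh lies below \<open>d\<close>, so that vertices of one cell have close
    images, and below \<open>e/2\<close>, so that moving to a neighbouring vertex is
    harmless.\<close>
  obtain p :: nat where p: "p > 0" "1 / real p < min d (e/2)"
    using real_arch_inverse[of "min d (e/2)"] d e by (auto simp: inverse_eq_divide)
  define X where "X r = (\<lambda>j. real (r j) / real p)" for r :: "nat \<Rightarrow> nat"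
  \<comment> \<open>Label 0 records that coordinate \<open>i\<close> is not decreased by
    \<open>f\<close>, label 1 that it is. The two faces carry the labels prescribed by Kuhn's lemma;
    they agree with this reading since \<open>f\<close> maps into the cube.\<close>
  define label where "label x i = (if x i = 0 then 0 else if x i = p then 1 else if f (X x) i \<ge> X x i then 0 else (1::nat))"
    for x :: "nat \<Rightarrow> nat" and i
  obtain q where q: "\<forall>i<n. q i < p"
    "\<forall>i<n. \<exists>r s. (\<forall>j<n. q j \<le> r j \<and> r j \<le> q j + 1) \<and> (\<forall>j<n. q j \<le> s j \<and> s j \<le> q j + 1) \<and> label r i \<noteq> label s i"
    by (rule kuhn_lemma[of p n label]) (use p in \<open>auto simp: label_def\<close>)
  have XQ: "X r \<in> Q" if "\<And>j. j < n \<Longrightarrow> r j \<le> p" for r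
    using that p by (auto simp: Q_def X_def)
  have l0: "X r i \<le> f (X r) i" if "label r i = 0" "i < n" "\<And>j. j < n \<Longrightarrow> r j \<le> p" for r i
    using that maps[OF XQ[OF that(3)] that(2)] p by (auto simp: label_def X_def split: if_splits)
  have l1: "f (X r) i \<le> X r i" if "label r i \<noteq> 0" "i < n" "\<And>j. j < n \<Longrightarrow> r j \<le> p" for r i
    using that maps[OF XQ[OF that(3)] that(2)] p by (auto simp: label_def X_def split: if_splits)
  have "\<bar>f (X q) i - X q i\<bar> \<le> e" if i: "i < n" for i
  proof -
    have near: "X q j \<le> X r j \<and> X r j \<le> X q j + 1 / real p" if "q j \<le> r j \<and> r j \<le> q j + 1" for r j
    proof -
      have "real (r j) \<le> real (q j) + 1" using that by linarith
      then show ?thesis using that p by (simp add: X_def add_divide_distrib[symmetric] divide_right_mono)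
    qed
    have *: "X q i - e \<le> f (X q) i" if rl: "label r i = 0" and rle: "\<forall>j<n. q j \<le> r j \<and> r j \<le> q j + 1" for r
    proof -
      have rp: "r j \<le> p" if "j < n" for j
        using spec[OF q(1), of j] spec[OF rle, of j] that by linarith
      have dn: "\<bar>X r j - X q j\<bar> \<le> d" if "j < n" for j
        using near[of j r] rle that p(2) by (auto simp: abs_le_iff)
      have "\<bar>f (X r) i - f (X q) i\<bar> \<le> e/2"
        by (rule d(2)[OF XQ XQ _ i]) (use rp q(1) dn in \<open>auto intro: less_imp_le\<close>)
      moreover have "X q i \<le> X r i" using near[of i r] rle i by blast
      ultimately show ?thesis using l0[OF rl i rp] e by linarith
    qed
    have **: "f (X q) i \<le> X q i + e" if rl: "label r i \<noteq> 0" and rle: "\<forall>j<n. q j \<le> r j \<and> r j \<le> q j + 1" for r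
    proof -
      have rp: "r j \<le> p" if "j < n" for j
        using spec[OF q(1), of j] spec[OF rle, of j] that by linarith
      have dn: "\<bar>X r j - X q j\<bar> \<le> d" if "j < n" for j
        using near[of j r] rle that p(2) by (auto simp: abs_le_iff)
      have "\<bar>f (X r) i - f (X q) i\<bar> \<le> e/2"
        by (rule d(2)[OF XQ XQ _ i]) (use rp q(1) dn in \<open>auto intro: less_imp_le\<close>)
      moreover have "X r i \<le> X q i + 1 / real p" using near[of i r] rle i by blast
      moreover have "1 / real p < e / 2" using p(2) by simp
      ultimately show ?thesis using l1[OF rl i rp] by linarith
    qed
    obtain r s where rs: "\<forall>j<n. q j \<le> r j \<and> r j \<le> q j + 1" "\<forall>j<n. q j \<le> s j \<and> s j \<le> q j + 1" "label r i \<noteq> label s i"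
      using q(2) i by blast
    have "label r i = 0 \<or> label s i = 0" "label r i \<noteq> 0 \<or> label s i \<noteq> 0"
      using rs(3) by (auto simp: label_def split: if_splits)
    then have "X q i - e \<le> f (X q) i" "f (X q) i \<le> X q i + e"
      using * ** rs by blast+
    then show ?thesis by (simp add: abs_le_iff)
  qed
  moreover have "X q \<in> Q" using q(1) by (intro XQ) (auto simp: less_imp_le)
  ultimately show ?thesis by blast
qed

lemma quotient_diff_le:
  fixes a a' m m' :: real
  assumes "1 \<le> m" "1 \<le> m'" "0 \<le> a'" "a' \<le> m'"
  shows "\<bar>a / m - a' / m'\<bar> \<le> \<bar>a - a'\<bar> + \<bar>m - m'\<bar>"
proof -
  have "a / m - a' / m' = (a - a') / m + (a' / m') * ((m' - m) / m)"
    using assms by (simp add: field_simps)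
  also have "\<bar>\<dots>\<bar> \<le> \<bar>(a - a') / m\<bar> + \<bar>(a' / m') * ((m' - m) / m)\<bar>" by (rule abs_triangle_ineq)
  also have "\<bar>(a - a') / m\<bar> \<le> \<bar>a - a'\<bar>"
    using assms mult_left_mono[of 1 m "\<bar>a - a'\<bar>"] by (simp add: divide_le_eq)
  also have "\<bar>(a' / m') * ((m' - m) / m)\<bar> \<le> 1 * \<bar>m - m'\<bar>"
    unfolding abs_mult using assms mult_left_mono[of 1 m "\<bar>m - m'\<bar>"]
    by (intro mult_mono) (auto simp: divide_le_eq abs_minus_commute)
  finally show ?thesis by simp
qed

text \<open>Schauder projection: the values of \<open>T\<close> are replaced by convex combinations
  of a finite net with spacing \<open>e/2\<close>, and the coefficients are iterated on a
  cube.\<close>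

lemma schauder_approx:
  fixes S :: "'a::real_normed_vector set"
  assumes S: "compact S" "convex S" "S \<noteq> {}" and T: "continuous_on S T" "T ` S \<subseteq> S" and e: "e > 0"
  shows "\<exists>x\<in>S. norm (T x - x) \<le> e"
proof -
  have "\<exists>k. finite k \<and> k \<subseteq> S \<and> S \<subseteq> (\<Union>x\<in>k. ball x (e/2))"
    using seq_compact_imp_totally_bounded[of S] S(1) e by (simp add: compact_eq_seq_compact_metric)
  then obtain k where k: "finite k" "k \<subseteq> S" "S \<subseteq> (\<Union>x\<in>k. ball x (e/2))" by blast
  define n where "n = card k"
  obtain y where y: "bij_betw y {0..<n} k"
    using ex_bij_betw_nat_finite[OF k(1)] n_def by blast
  have n0: "n > 0" using k S(3) by (auto simp: n_def card_gt_0_iff)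
  have yS: "y i \<in> S" if "i < n" for i
    using bij_betwE[OF y] k(2) that by auto
  define w where "w i x = max 0 (e/2 - dist x (y i))" for i x
  define W where "W x = (\<Sum>i<n. w i x)" for x
  define g where "g i x = w i x / W x" for i x
  have wpos: "0 \<le> w i x" for i x by (simp add: w_def)
  have Wpos: "W x > 0" if xS: "x \<in> S" for x
  proof -
    obtain z where "z \<in> k" "dist z x < e/2" using k(3) xS by (auto simp: dist_commute)
    moreover then obtain i where "i < n" "z = y i"
      using y by (auto simp: bij_betw_def)
    ultimately have "w i x > 0" "i < n" by (auto simp: w_def dist_commute)
    then show ?thesis
      unfolding W_def by (intro sum_pos2[of _ i]) (use wpos in auto)
  qed
  have g01: "0 \<le> g i x" "g i x \<le> 1" if "x \<in> S" "i < n" for i x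
    using Wpos[OF that(1)] wpos member_le_sum[of i "{..<n}" "\<lambda>i. w i x"] that(2)
    by (auto simp: g_def W_def divide_le_eq)
  have gsum: "(\<Sum>i<n. g i x) = 1" if "x \<in> S" for x
    using Wpos[OF that] by (simp add: g_def sum_divide_distrib[symmetric] W_def)
  have gnear: "norm ((\<Sum>i<n. g i x *\<^sub>R y i) - x) \<le> e/2" if x: "x \<in> S" for x
  proof -
    have "(\<Sum>i<n. g i x *\<^sub>R y i) - x = (\<Sum>i<n. g i x *\<^sub>R (y i - x))"
      using gsum[OF x] by (simp add: scaleR_diff_right sum_subtractf scaleR_left.sum[symmetric])
    also have "norm \<dots> \<le> (\<Sum>i<n. g i x * (e/2))"
    proof (rule sum_norm_le)
      fix i assume i: "i \<in> {..<n}"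
      show "norm (g i x *\<^sub>R (y i - x)) \<le> g i x * (e/2)"
      proof (cases "dist x (y i) < e/2")
        case True
        then show ?thesis using g01[OF x, of i] i
          using mult_left_mono[of "norm (y i - x)" "e/2" "g i x"] by (auto simp: dist_norm norm_minus_commute)
      next
        case False
        then have "g i x = 0" by (simp add: g_def w_def)
        then show ?thesis by simp
      qed
    qed
    also have "\<dots> = e/2" using gsum[OF x] by (simp add: sum_distrib_right[symmetric] sum_divide_distrib[symmetric])
    finally show ?thesis .
  qed
  define Q where "Q = {x. \<forall>i<n. 0 \<le> x i \<and> x i \<le> (1::real)}"
  \<comment> \<open>A Lipschitz retraction of the cube onto the simplex: a coefficient sum above 1
    is divided out, and a deficit is added to coordinate 0. Hence every point of the cube yields a
    point of \<open>S\<close>, and coefficients that already sum to 1 are unchanged.\<close>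
  define m where "m c = max 1 (\<Sum>i<n. c i)" for c :: "nat \<Rightarrow> real"
  define a where "a c i = c i + (if i = 0 then max 0 (1 - (\<Sum>i<n. c i)) else 0)" for c :: "nat \<Rightarrow> real" and i
  define x where "x c = (\<Sum>i<n. (a c i / m c) *\<^sub>R y i)" for c
  have asum: "(\<Sum>i<n. a c i) = m c" for c
    using n0 by (simp add: a_def m_def sum.distrib sum.delta)
  have apos: "0 \<le> a c i" if "c \<in> Q" "i < n" for c i using that by (simp add: a_def Q_def)
  have am: "a c i \<le> m c" if "c \<in> Q" "i < n" for c i
    using member_le_sum[of i "{..<n}" "a c"] apos that asum by auto
  have m1: "m c \<ge> 1" for c by (simp add: m_def)
  have xS: "x c \<in> S" if "c \<in> Q" for c
    unfolding x_def
  proof (rule convex_sum[OF _ S(2)])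
    show "(\<Sum>i<n. a c i / m c) = 1"
      using m1[of c] by (simp add: sum_divide_distrib[symmetric] asum)
  qed (use apos that m1[of c] yS in \<open>auto intro!: divide_nonneg_pos\<close>)
  \<comment> \<open>A Lipschitz constant of \<open>x\<close> for the maximum distance: a change
    \<open>d\<close> of all coordinates alters \<open>a c i\<close> by at most
    \<open>d + n * d\<close> and \<open>m c\<close> by at most \<open>n * d\<close>. The final 1
    keeps \<open>K\<close> positive.\<close>
  define K where "K = (\<Sum>i<n. (2 * real n + 1) * norm (y i)) + 1"
  have K: "K > 0" unfolding K_def by (intro add_nonneg_pos sum_nonneg) auto
  have xlip: "norm (x c - x c') \<le> K * d" if cQ: "c \<in> Q" "c' \<in> Q" and near: "\<And>i. i < n \<Longrightarrow> \<bar>c i - c' i\<bar> \<le> d" for c c' d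
  proof -
    have d0: "d \<ge> 0" using near[OF n0] by linarith
    have sd: "\<bar>(\<Sum>i<n. c i) - (\<Sum>i<n. c' i)\<bar> \<le> real n * d"
      unfolding sum_subtractf[symmetric]
      using sum_norm_le[of "{..<n}" "\<lambda>i. c i - c' i" "\<lambda>_. d"] near by simp
    have rd: "\<bar>a c i / m c - a c' i / m c'\<bar> \<le> (2 * real n + 1) * d" if i: "i < n" for i
    proof -
      have "\<bar>a c i - a c' i\<bar> \<le> d + real n * d"
        using near[OF i] sd unfolding a_def by (auto simp: max_def abs_le_iff)
      moreover have "\<bar>m c - m c'\<bar> \<le> real n * d" using sd unfolding m_def by (auto simp: max_def abs_le_iff)
      ultimately show ?thesis
        using quotient_diff_le[OF m1[of c] m1[of c'] apos[OF cQ(2) i] am[OF cQ(2) i], of "a c i"]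
        by (simp add: algebra_simps)
    qed
    have "x c - x c' = (\<Sum>i<n. (a c i / m c - a c' i / m c') *\<^sub>R y i)"
      by (simp add: x_def sum_subtractf scaleR_diff_left)
    also have "norm \<dots> \<le> (\<Sum>i<n. ((2 * real n + 1) * d) * norm (y i))"
      by (rule sum_norm_le) (use rd in \<open>auto intro!: mult_right_mono\<close>)
    also have "\<dots> = (\<Sum>i<n. (2 * real n + 1) * norm (y i)) * d"
      unfolding sum_distrib_right by (rule sum.cong) (auto simp: mult_ac)
    also have "\<dots> \<le> K * d" using d0 by (simp add: K_def distrib_right)
    finally show ?thesis .
  qed
  \<comment> \<open>Coefficients of the Schauder projection of \<open>T (x c)\<close>. If
    \<open>c\<close> is nearly fixed, \<open>x c\<close> is close to \<open>x (f c)\<close>, and the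
    latter is within \<open>e/2\<close> of \<open>T (x c)\<close>.\<close>
  define f where "f c i = g i (T (x c))" for c i
  have TS: "T (x c) \<in> S" if "c \<in> Q" for c using xS[OF that] T(2) by blast
  have gcont: "continuous_on S (g i)" for i
    unfolding g_def W_def w_def
    by (intro continuous_intros) (use Wpos[unfolded W_def w_def] in force)
  have fuc: "\<exists>d>0. \<forall>c\<in>Q. \<forall>c'\<in>Q. (\<forall>i<n. \<bar>c i - c' i\<bar> \<le> d) \<longrightarrow> (\<forall>i<n. \<bar>f c i - f c' i\<bar> \<le> r)" if r: "r > 0" for r
  proof -
    have "\<exists>d>0. \<forall>u\<in>S. \<forall>v\<in>S. dist v u < d \<longrightarrow> dist (g i (T v)) (g i (T u)) < r" for i
    proof -
      have "continuous_on S (\<lambda>u. g i (T u))"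
        by (rule continuous_on_compose2[OF gcont T])
      then show ?thesis
        using compact_uniformly_continuous[OF _ S(1)] r unfolding uniformly_continuous_on_def by blast
    qed
    then obtain dd where dd: "\<And>i. dd i > 0" "\<And>i u v. u \<in> S \<Longrightarrow> v \<in> S \<Longrightarrow> dist v u < dd i \<Longrightarrow> dist (g i (T v)) (g i (T u)) < r"
      by metis
    define d where "d = Min (dd ` {..<n}) / 2 / K"
    have dm: "Min (dd ` {..<n}) > 0" using dd(1) n0 by (subst Min_gr_iff) auto
    have "d > 0" using dm K by (simp add: d_def)
    moreover have "\<bar>f c i - f c' i\<bar> \<le> r" if "c \<in> Q" "c' \<in> Q" "\<forall>i<n. \<bar>c i - c' i\<bar> \<le> d" "i < n" for c c' i
    proof -
      have "dist (x c) (x c') \<le> K * d" using xlip[of c c' d] that by (simp add: dist_norm)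
      also have "\<dots> = Min (dd ` {..<n}) / 2" using K by (simp add: d_def)
      also have "\<dots> < Min (dd ` {..<n})" using dm by simp
      also have "\<dots> \<le> dd i" using that by auto
      finally show ?thesis
        using dd(2)[of "x c'" "x c" i] xS that by (auto simp: f_def dist_real_def intro: less_imp_le)
    qed
    ultimately show ?thesis by blast
  qed
  have "\<exists>c\<in>Q. \<forall>i<n. \<bar>f c i - c i\<bar> \<le> e/2/K"
    unfolding Q_def
  proof (rule approx_brouwer_cube)
    show "0 \<le> f c i \<and> f c i \<le> 1" if "c \<in> {x. \<forall>i<n. 0 \<le> x i \<and> x i \<le> 1}" "i < n" for c i
      using that g01[OF TS] by (auto simp: f_def Q_def)
  qed (use fuc e K in \<open>auto simp: Q_def\<close>)
  then obtain c where c: "c \<in> Q" "\<And>i. i < n \<Longrightarrow> \<bar>f c i - c i\<bar> \<le> e/2/K" by blast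
  have fQ: "f c \<in> Q" using g01[OF TS[OF c(1)]] by (auto simp: f_def Q_def)
  have "norm (x (f c) - x c) \<le> K * (e/2/K)"
    by (rule xlip[OF fQ c(1)]) (use c(2) in auto)
  then have 1: "norm (x (f c) - x c) \<le> e/2" using K by simp
  have "x (f c) = (\<Sum>i<n. g i (T (x c)) *\<^sub>R y i)"
  proof -
    have fs: "(\<Sum>i<n. f c i) = 1" using gsum[OF TS[OF c(1)]] by (simp only: f_def)
    have "a (f c) i / m (f c) = f c i" for i by (simp add: a_def m_def fs)
    then show ?thesis unfolding x_def[of "f c"] by (simp only: f_def)
  qed
  then have 2: "norm (x (f c) - T (x c)) \<le> e/2" using gnear[OF TS[OF c(1)]] by simp
  have "norm (T (x c) - x c) \<le> norm (x (f c) - x c) + norm (x (f c) - T (x c))"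
    using norm_triangle_ineq4[of "x (f c) - x c" "x (f c) - T (x c)"] by simp
  then show ?thesis using 1 2 xS[OF c(1)] by (intro bexI[of _ "x c"]) auto
qed

text \<open>The displacement attains its minimum on the compact set, and approximate fixed points
  rule out a positive minimum.\<close>

lemma schauder_fixed_point:
  fixes S :: "'a::real_normed_vector set"
  assumes S: "compact S" "convex S" "S \<noteq> {}" and T: "continuous_on S T" "T ` S \<subseteq> S"
  obtains x where "x \<in> S" "T x = x"
proof -
  have "continuous_on S (\<lambda>x. norm (T x - x))" by (intro continuous_intros T)
  from continuous_attains_inf[OF S(1) S(3) this]
  obtain x where x: "x \<in> S" "\<And>y. y \<in> S \<Longrightarrow> norm (T x - x) \<le> norm (T y - y)" by blast
  have "T x = x"
  proof (rule ccontr)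
    assume "T x \<noteq> x"
    then have "norm (T x - x) / 2 > 0" by simp
    from schauder_approx[OF S T this] obtain y where "y \<in> S" "norm (T y - y) \<le> norm (T x - x) / 2" by blast
    with x(2)[of y] \<open>norm (T x - x) / 2 > 0\<close> show False by linarith
  qed
  with x that show ?thesis by blast
qed

section \<open>Supports, couplings and Wasserstein distances\<close>

lemma closed_msupp: "closed (msupp M)"
proof -
  have "- msupp M = \<Union>{U. open U \<and> emeasure M U = 0}"
    by (auto simp: msupp_def)
  then have "open (- msupp M)" by (metis (mono_tags, lifting) mem_Collect_eq open_Union)
  then show ?thesis by (simp add: closed_def)
qed

text \<open>By Lindelof's theorem the union of all open null sets is already the union of countably
  many of them.\<close>

lemma AE_msupp:
  fixes M :: "'a::second_countable_topology measure"
  assumes "sets M = sets borel"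
  shows "AE z in M. z \<in> msupp M"
proof -
  define \<F> where "\<F> = {U. open U \<and> emeasure M U = 0}"
  obtain \<F>' where F': "\<F>' \<subseteq> \<F>" "countable \<F>'" "\<Union>\<F>' = \<Union>\<F>"
    using Lindelof[of \<F>] by (auto simp: \<F>_def)
  have "\<Union>\<F>' \<in> null_sets M"
    using null_sets_UN'[OF F'(2), of "\<lambda>U. U" M] F'(1) assms
    by (force simp: \<F>_def null_sets_def)
  moreover have "\<Union>\<F>' = - msupp M"
    unfolding F'(3) by (auto simp: \<F>_def msupp_def)
  ultimately show ?thesis
    by (intro AE_I'[of "- msupp M"]) auto
qed

lemma msupp_subset_closed:
  fixes M :: "'a::second_countable_topology measure"
  assumes "sets M = sets borel" "closed C" "AE z in M. z \<in> C"
  shows "msupp M \<subseteq> C"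
proof
  fix z assume z: "z \<in> msupp M"
  show "z \<in> C"
  proof (rule ccontr)
    assume "z \<notin> C"
    then have "emeasure M (- C) \<noteq> 0"
      using z assms(2) unfolding msupp_def by (auto simp: open_Compl)
    moreover have "emeasure M (- C) = 0"
      using assms AE_iff_measurable[of "- C" M "\<lambda>z. z \<in> C"] sets_eq_imp_space_eq[OF assms(1)]
      by (auto simp: borel_closed)
    ultimately show False by simp
  qed
qed

lemma sets_borel_pair:
  "sets (borel \<Otimes>\<^sub>M borel) = sets (borel :: ('a::second_countable_topology \<times> 'b::second_countable_topology) measure)"
  by (rule arg_cong[OF borel_prod])

lemma borel_measurable_fst_snd[measurable]:
  "fst \<in> borel_measurable (borel :: ('a::second_countable_topology \<times> 'b::second_countable_topology) measure)"
  "snd \<in> borel_measurable (borel :: ('a::second_countable_topology \<times> 'b::second_countable_topology) measure)"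
  by (auto intro!: borel_measurable_continuous_onI continuous_intros)

text \<open>The joint law of \<open>f\<close> and \<open>g\<close> is a coupling. All upper bounds
  on transport costs of images below use such explicit couplings.\<close>

lemma wcost_distr_le:
  fixes f g :: "'r \<Rightarrow> 'a::{metric_space, second_countable_topology}"
  assumes \<rho>: "prob_space \<rho>" and m[measurable]: "f \<in> borel_measurable \<rho>" "g \<in> borel_measurable \<rho>"
  shows "wcost p (distr \<rho> borel f) (distr \<rho> borel g) \<le> (\<integral>\<^sup>+z. ennreal (dist (f z) (g z) powr p) \<partial>\<rho>)"
proof -
  interpret prob_space \<rho> by fact
  let ?\<pi> = "distr \<rho> borel (\<lambda>z. (f z, g z))"
  have "?\<pi> \<in> couplings (distr \<rho> borel f) (distr \<rho> borel g)"
    unfolding couplings_def by (auto simp: distr_distr[OF borel_measurable_continuous_onI borel_measurable_Pair[OF m]] o_def continuous_on_fst continuous_on_snd continuous_on_id intro!: prob_space_distr)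
  then have "wcost p (distr \<rho> borel f) (distr \<rho> borel g) \<le> (\<integral>\<^sup>+ z. ennreal (dist (fst z) (snd z) powr p) \<partial>?\<pi>)"
    unfolding wcost_def by (rule INF_lower)
  also have "\<dots> = (\<integral>\<^sup>+z. ennreal (dist (f z) (g z) powr p) \<partial>\<rho>)"
    by (subst nn_integral_distr) auto
  finally show ?thesis .
qed

lemma wasserstein_distr_le:
  fixes f g :: "'r \<Rightarrow> 'a::{metric_space, second_countable_topology}"
  assumes \<rho>: "prob_space \<rho>" and m: "f \<in> borel_measurable \<rho>" "g \<in> borel_measurable \<rho>"
    and d: "AE z in \<rho>. dist (f z) (g z) \<le> C" and C: "0 \<le> C" and p: "p > 0"
  shows "wcost p (distr \<rho> borel f) (distr \<rho> borel g) \<le> ennreal (C powr p)"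
    and "wasserstein p (distr \<rho> borel f) (distr \<rho> borel g) \<le> C"
proof -
  interpret prob_space \<rho> by fact
  have "(\<integral>\<^sup>+z. ennreal (dist (f z) (g z) powr p) \<partial>\<rho>) \<le> (\<integral>\<^sup>+z. ennreal (C powr p) \<partial>\<rho>)"
    using d by (intro nn_integral_mono_AE) (auto elim!: eventually_mono intro!: ennreal_leI powr_mono2 simp: p less_imp_le)
  then show 1: "wcost p (distr \<rho> borel f) (distr \<rho> borel g) \<le> ennreal (C powr p)"
    using wcost_distr_le[OF \<rho> m, of p] by (simp add: emeasure_space_1)
  have "enn2real (wcost p (distr \<rho> borel f) (distr \<rho> borel g)) \<le> C powr p"
    using enn2real_mono[OF 1] by simp
  then have "wasserstein p (distr \<rho> borel f) (distr \<rho> borel g) \<le> (C powr p) powr (1/p)"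
    unfolding wasserstein_def using p by (intro powr_mono2) auto
  then show "wasserstein p (distr \<rho> borel f) (distr \<rho> borel g) \<le> C"
    using C p by (simp add: powr_powr)
qed

text \<open>The product coupling has finite cost. This has to be recorded because
  \<open>enn2real\<close> sends an infinite cost to 0, which would make \<open>wasserstein\<close>
  vanish.\<close>

lemma wcost_2_finite:
  fixes \<mu> \<mu>' :: "'a::euclidean_space measure"
  assumes "\<mu> \<in> P2" "\<mu>' \<in> P2"
  shows "wcost 2 \<mu> \<mu>' < \<top>"
proof -
  have ps: "prob_space \<mu>" "prob_space \<mu>'" and s[simp, measurable_cong]: "sets \<mu> = sets borel" "sets \<mu>' = sets borel"
    and i: "integrable \<mu> (\<lambda>z. (norm z)^2)" "integrable \<mu>' (\<lambda>z. (norm z)^2)"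
    using assms by (auto simp: P2_def)
  interpret pair_prob_space \<mu> \<mu>' using ps by (simp add: pair_prob_space_def pair_sigma_finite_def prob_space_imp_sigma_finite)
  have sp: "sets (\<mu> \<Otimes>\<^sub>M \<mu>') = sets borel"
    using sets_pair_measure_cong[OF s] by (simp add: sets_borel_pair)
  have d1: "distr (\<mu> \<Otimes>\<^sub>M \<mu>') borel fst = \<mu>"
    using M2.distr_pair_fst[of \<mu>] by (metis distr_cong s(1))
  have d2: "distr (\<mu> \<Otimes>\<^sub>M \<mu>') borel snd = \<mu>'"
  proof (rule measure_eqI)
    fix X assume "X \<in> sets (distr (\<mu> \<Otimes>\<^sub>M \<mu>') borel snd)"
    then have X: "X \<in> sets borel" by simp
    have "emeasure (distr (\<mu> \<Otimes>\<^sub>M \<mu>') borel snd) X = emeasure (\<mu> \<Otimes>\<^sub>M \<mu>') (space \<mu> \<times> X)"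
      using X by (subst emeasure_distr) (auto simp: space_pair_measure sets_eq_imp_space_eq[OF s(2)] intro!: arg_cong[where f="emeasure _"])
    then show "emeasure (distr (\<mu> \<Otimes>\<^sub>M \<mu>') borel snd) X = emeasure \<mu>' X"
      using X M2.emeasure_pair_measure_Times[of "space \<mu>" \<mu> X] sets.top[of \<mu>] by (simp add: M1.emeasure_space_1)
  qed simp
  have cp: "\<mu> \<Otimes>\<^sub>M \<mu>' \<in> couplings \<mu> \<mu>'"
    unfolding couplings_def using d1 d2 sp by (auto intro: prob_space_axioms)
  have i1: "(\<integral>\<^sup>+z. ennreal ((norm (fst z))^2) \<partial>(\<mu> \<Otimes>\<^sub>M \<mu>')) < \<infinity>"
  proof -
    have "(\<integral>\<^sup>+z. ennreal ((norm (fst z))^2) \<partial>(\<mu> \<Otimes>\<^sub>M \<mu>')) = (\<integral>\<^sup>+z. ennreal ((norm z)^2) \<partial>(distr (\<mu> \<Otimes>\<^sub>M \<mu>') borel fst))"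
      by (subst nn_integral_distr) auto
    also have "\<dots> < \<infinity>" unfolding d1 using i(1) by (simp add: integrable_iff_bounded)
    finally show ?thesis .
  qed
  have i2: "(\<integral>\<^sup>+z. ennreal ((norm (snd z))^2) \<partial>(\<mu> \<Otimes>\<^sub>M \<mu>')) < \<infinity>"
  proof -
    have "(\<integral>\<^sup>+z. ennreal ((norm (snd z))^2) \<partial>(\<mu> \<Otimes>\<^sub>M \<mu>')) = (\<integral>\<^sup>+z. ennreal ((norm z)^2) \<partial>(distr (\<mu> \<Otimes>\<^sub>M \<mu>') borel snd))"
      by (subst nn_integral_distr) auto
    also have "\<dots> < \<infinity>" unfolding d2 using i(2) by (simp add: integrable_iff_bounded)
    finally show ?thesis .
  qed
  have dle: "dist x y powr 2 \<le> 2 * (norm x)\<^sup>2 + 2 * (norm y)\<^sup>2" for x y :: 'a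
  proof -
    have "dist x y ^ 2 \<le> (norm x + norm y)^2"
      by (intro power_mono) (auto simp: dist_norm norm_triangle_ineq4)
    also have "\<dots> \<le> 2 * (norm x)\<^sup>2 + 2 * (norm y)\<^sup>2"
      using sum_squares_bound[of "norm x" "norm y"] by (simp add: power2_sum)
    finally show ?thesis by (simp add: powr_numeral)
  qed
  have "wcost 2 \<mu> \<mu>' \<le> (\<integral>\<^sup>+ z. ennreal (dist (fst z) (snd z) powr 2) \<partial>(\<mu> \<Otimes>\<^sub>M \<mu>'))"
    unfolding wcost_def by (rule INF_lower[OF cp])
  also have "\<dots> \<le> (\<integral>\<^sup>+ z. 2 * ennreal ((norm (fst z))^2) + 2 * ennreal ((norm (snd z))^2) \<partial>(\<mu> \<Otimes>\<^sub>M \<mu>'))"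
  proof (rule nn_integral_mono)
    fix z :: "'a \<times> 'a"
    have "ennreal (dist (fst z) (snd z) powr 2) \<le> ennreal (2 * (norm (fst z))\<^sup>2 + 2 * (norm (snd z))\<^sup>2)"
      by (rule ennreal_leI[OF dle])
    also have "\<dots> = 2 * ennreal ((norm (fst z))^2) + 2 * ennreal ((norm (snd z))^2)"
      by (simp add: ennreal_mult)
    finally show "ennreal (dist (fst z) (snd z) powr 2) \<le> 2 * ennreal ((norm (fst z))^2) + 2 * ennreal ((norm (snd z))^2)" .
  qed
  also have "\<dots> = 2 * (\<integral>\<^sup>+ z. ennreal ((norm (fst z))^2) \<partial>(\<mu> \<Otimes>\<^sub>M \<mu>')) + 2 * (\<integral>\<^sup>+ z. ennreal ((norm (snd z))^2) \<partial>(\<mu> \<Otimes>\<^sub>M \<mu>'))"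
    by (simp add: nn_integral_add nn_integral_cmult)
  also have "\<dots> < \<top>" using i1 i2 by (simp add: ennreal_mult_less_top)
  finally show ?thesis .
qed

text \<open>The arithmetic-geometric mean inequality, applied to a coupling whose quadratic cost is
  within \<open>e\<close> of the infimum, replaces the Cauchy-Schwarz inequality. The finiteness
  assumption excludes the default value 0 on the right.\<close>

lemma wasserstein_1_le_2:
  fixes \<mu> \<mu>' :: "'a::{metric_space, second_countable_topology} measure"
  assumes fin: "wcost 2 \<mu> \<mu>' < \<top>"
  shows "wasserstein 1 \<mu> \<mu>' \<le> wasserstein 2 \<mu> \<mu>'"
proof -
  define c where "c = enn2real (wcost 2 \<mu> \<mu>')"
  have c0: "c \<ge> 0" by (simp add: c_def)
  have wc: "wcost 2 \<mu> \<mu>' = ennreal c" using fin by (simp add: c_def)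
  have le: "enn2real (wcost 1 \<mu> \<mu>') \<le> sqrt (c + e)" if e: "e > 0" for e
  proof -
    have "wcost 2 \<mu> \<mu>' < ennreal (c + e)" unfolding wc using e c0 by (simp add: ennreal_less_iff)
    then obtain \<pi> where \<pi>: "\<pi> \<in> couplings \<mu> \<mu>'"
      "(\<integral>\<^sup>+ z. ennreal (dist (fst z) (snd z) powr 2) \<partial>\<pi>) < ennreal (c + e)"
      unfolding wcost_def INF_less_iff by blast
    interpret prob_space \<pi> using \<pi> by (simp add: couplings_def)
    have [measurable_cong]: "sets \<pi> = sets (borel \<Otimes>\<^sub>M borel)" using \<pi> by (simp add: couplings_def sets_borel_pair)
    \<comment> \<open>This weight balances the two terms: if the quadratic cost equals
      \<open>s\<^sup>2\<close>, each of them contributes \<open>s / 2\<close>.\<close>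
    define s where "s = sqrt (c + e)"
    have s: "s > 0" "s * s = c + e" using c0 e by (auto simp: s_def)
    have amgm: "d \<le> d powr 2 / (2 * s) + s / 2" if "d \<ge> 0" for d
      using s that sum_squares_bound[of d s] by (simp add: powr_numeral field_simps power2_eq_square)
    have "wcost 1 \<mu> \<mu>' \<le> (\<integral>\<^sup>+ z. ennreal (dist (fst z) (snd z) powr 1) \<partial>\<pi>)"
      unfolding wcost_def by (rule INF_lower[OF \<pi>(1)])
    also have "\<dots> \<le> (\<integral>\<^sup>+ z. ennreal (1 / (2 * s)) * ennreal (dist (fst z) (snd z) powr 2) + ennreal (s / 2) \<partial>\<pi>)"
    proof (rule nn_integral_mono)
      fix z :: "'a \<times> 'a"
      have "ennreal (dist (fst z) (snd z) powr 1) \<le> ennreal (dist (fst z) (snd z) powr 2 / (2 * s) + s / 2)"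
        using amgm[of "dist (fst z) (snd z)"] by (intro ennreal_leI) auto
      also have "\<dots> = ennreal (1 / (2 * s)) * ennreal (dist (fst z) (snd z) powr 2) + ennreal (s / 2)"
        using s by (subst ennreal_mult[symmetric]) (auto simp: ennreal_plus)
      finally show "ennreal (dist (fst z) (snd z) powr 1) \<le> ennreal (1 / (2 * s)) * ennreal (dist (fst z) (snd z) powr 2) + ennreal (s / 2)" .
    qed
    also have "\<dots> = ennreal (1 / (2 * s)) * (\<integral>\<^sup>+ z. ennreal (dist (fst z) (snd z) powr 2) \<partial>\<pi>) + ennreal (s / 2)"
      by (subst nn_integral_add) (auto simp: nn_integral_cmult emeasure_space_1)
    also have "\<dots> \<le> ennreal (1 / (2 * s)) * ennreal (c + e) + ennreal (s / 2)"
      using \<pi>(2) by (intro add_right_mono mult_left_mono) (auto simp: less_imp_le)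
    also have "\<dots> = ennreal (1 / (2 * s) * (c + e) + s / 2)"
      using s c0 e by (simp add: ennreal_mult[symmetric] ennreal_plus[symmetric] del: ennreal_plus)
    also have "1 / (2 * s) * (c + e) + s / 2 = s" using s by (simp add: s(2)[symmetric])
    finally show ?thesis using enn2real_mono[of _ "ennreal s"] s by (simp add: s_def)
  qed
  have "enn2real (wcost 1 \<mu> \<mu>') \<le> sqrt c"
  proof -
    have "((\<lambda>e. sqrt (c + e)) \<longlongrightarrow> sqrt (c + 0)) (at_right 0)" by (intro tendsto_intros)
    then show ?thesis
      by (intro tendsto_lowerbound[where F="at_right 0" and f="\<lambda>e. sqrt (c + e)"])
         (auto simp: eventually_at_right_less le intro!: eventually_at_rightI[of 0 1])
  qed
  then show ?thesis by (simp add: wasserstein_def c_def powr_half_sqrt[symmetric])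
qed

section \<open>Measures with prescribed second marginal\<close>

lemma P2nu_sets: "\<mu> \<in> P2nu \<nu> \<Longrightarrow> sets \<mu> = sets borel"
  and P2nu_prob: "\<mu> \<in> P2nu \<nu> \<Longrightarrow> prob_space \<mu>"
  and P2nu_P2: "\<mu> \<in> P2nu \<nu> \<Longrightarrow> \<mu> \<in> P2"
  by (auto simp: P2nu_def P2_def)

lemma P2nu_space: "\<mu> \<in> P2nu \<nu> \<Longrightarrow> space \<mu> = UNIV"
  using sets_eq_imp_space_eq[OF P2nu_sets] by auto

lemma P2nu_emeasure_snd:
  assumes "\<mu> \<in> P2nu \<nu>" "B \<in> sets borel"
  shows "emeasure \<mu> {z. snd z \<in> B} = emeasure \<nu> B"
proof -
  have "{z :: real \<times> real. snd z \<in> B} = UNIV \<times> B" by auto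
  then show ?thesis using assms by (simp add: P2nu_def)
qed

lemma P2nu_distr_snd:
  assumes "\<mu> \<in> P2nu \<nu>" "sets \<nu> = sets borel"
  shows "distr \<mu> borel snd = \<nu>"
proof (rule measure_eqI)
  fix B assume "B \<in> sets (distr \<mu> borel snd)"
  then show "emeasure (distr \<mu> borel snd) B = emeasure \<nu> B"
    using P2nu_emeasure_snd[OF assms(1), of B] assms
    by (subst emeasure_distr) (auto simp: P2nu_space vimage_def P2nu_sets cong: measurable_cong_sets)
qed (simp add: assms)

lemma P2nu_integrable_sq:
  assumes "\<mu> \<in> P2nu \<nu>"
  shows "integrable \<mu> (\<lambda>z. (fst z)\<^sup>2)" "integrable \<mu> (\<lambda>z. (snd z)\<^sup>2)"
proof -
  have [measurable_cong]: "sets \<mu> = sets (borel \<Otimes>\<^sub>M borel)" using P2nu_sets[OF assms] by (simp add: sets_borel_pair)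
  have i: "integrable \<mu> (\<lambda>z. (norm z)^2)" using assms by (auto simp: P2nu_def P2_def)
  have n: "(norm z)^2 = (fst z)^2 + (snd z)^2" for z :: "real \<times> real" by (cases z) (simp add: norm_Pair)
  show "integrable \<mu> (\<lambda>z. (fst z)\<^sup>2)" "integrable \<mu> (\<lambda>z. (snd z)\<^sup>2)"
    by (rule Bochner_Integration.integrable_bound[OF i]; auto simp: n)+
qed

lemma P2nu_integrable_fst: "\<mu> \<in> P2nu \<nu> \<Longrightarrow> integrable \<mu> fst"
proof -
  assume a: "\<mu> \<in> P2nu \<nu>"
  interpret prob_space \<mu> using P2nu_prob[OF a] .
  have [measurable_cong]: "sets \<mu> = sets (borel \<Otimes>\<^sub>M borel)" using P2nu_sets[OF a] by (simp add: sets_borel_pair)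
  show "integrable \<mu> fst"
    by (rule square_integrable_imp_integrable[OF _ P2nu_integrable_sq(1)[OF a]]) simp
qed

text \<open>The concentrated state is obtained from any admissible \<mu> by moving every particle
  horizontally to \<open>s\<close>. The coupling thus obtained bounds the Wasserstein distance by
  the largest horizontal distance.\<close>

lemma return_pair_eq_distr:
  fixes s :: real
  assumes \<mu>: "\<mu> \<in> P2nu \<nu>" and \<nu>: "prob_space \<nu>" "sets \<nu> = sets borel"
  shows "return borel s \<Otimes>\<^sub>M \<nu> = distr \<mu> borel (\<lambda>z. (s, snd z))"
proof (rule measure_eqI)
  interpret \<nu>: prob_space \<nu> by fact
  have sp: "sets (return borel s \<Otimes>\<^sub>M \<nu>) = sets (borel :: (real \<times> real) measure)"
    using sets_pair_measure_cong[OF sets_return[of borel s] \<nu>(2)] by (simp add: sets_borel_pair)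
  then show "sets (return borel s \<Otimes>\<^sub>M \<nu>) = sets (distr \<mu> borel (\<lambda>z. (s, snd z)))" by simp
  fix X assume X0: "X \<in> sets (return borel s \<Otimes>\<^sub>M \<nu>)"
  then have X: "X \<in> sets (borel :: (real \<times> real) measure)" using sp by simp
  have sec: "Pair s -` X \<in> sets borel"
    using sets_Pair1[OF X0] \<nu> by simp
  have [measurable]: "snd \<in> borel_measurable \<mu>" using P2nu_sets[OF \<mu>] by (simp cong: measurable_cong_sets add: sets_borel_pair[symmetric])
  have "emeasure (return borel s \<Otimes>\<^sub>M \<nu>) X = (\<integral>\<^sup>+x. emeasure \<nu> (Pair x -` X) \<partial>return borel s)"
    by (rule \<nu>.emeasure_pair_measure_alt[OF X0])
  also have "\<dots> = emeasure \<nu> (Pair s -` X)"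
    by (subst nn_integral_return) (use \<nu>.measurable_emeasure_Pair[OF X0] in auto)
  also have "\<dots> = emeasure (distr \<mu> borel (\<lambda>z. (s, snd z))) X"
    using P2nu_emeasure_snd[OF \<mu> sec] X
    by (subst emeasure_distr) (auto simp: P2nu_space[OF \<mu>] vimage_def)
  finally show "emeasure (return borel s \<Otimes>\<^sub>M \<nu>) X = emeasure (distr \<mu> borel (\<lambda>z. (s, snd z))) X" .
qed

section \<open>Lipschitz extension\<close>

definition clamp_sym :: "real \<Rightarrow> real \<Rightarrow> real" where
  "clamp_sym R u = max (- R) (min R u)"

lemma clamp_sym_lipschitz: "\<bar>clamp_sym R u - clamp_sym R v\<bar> \<le> \<bar>u - v\<bar>"
  by (auto simp: clamp_sym_def)

lemma clamp_sym_id: "\<bar>u\<bar> \<le> R \<Longrightarrow> clamp_sym R u = u"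
  by (auto simp: clamp_sym_def)

lemma clamp_sym_bound: "0 \<le> R \<Longrightarrow> \<bar>clamp_sym R u\<bar> \<le> R"
  by (auto simp: clamp_sym_def)

text \<open>McShane's extension formula for \<open>L\<close>-Lipschitz functions on
  \<open>W\<close>, preceded by clamping to \<open>[-R, R]\<close>. The clamping makes the extension
  bounded and determined by its values on a compact interval, as needed for bounded continuous
  functions and for the Arzela-Ascoli theorem.\<close>

definition mcshane :: "real set \<Rightarrow> real \<Rightarrow> real \<Rightarrow> (real \<Rightarrow> real) \<Rightarrow> real \<Rightarrow> real" where
  "mcshane W R L g u = (INF w\<in>W. g w + L * \<bar>clamp_sym R u - w\<bar>)"

context
  fixes W :: "real set" and R L :: real
  assumes W: "W \<noteq> {}" "\<And>w. w \<in> W \<Longrightarrow> \<bar>w\<bar> \<le> R" and L: "0 \<le> L"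
begin

lemma INF_diff_le:
  fixes f g :: "real \<Rightarrow> real"
  assumes "\<And>w. w \<in> W \<Longrightarrow> \<bar>f w - g w\<bar> \<le> d" "bdd_below (f ` W)" "bdd_below (g ` W)"
  shows "\<bar>(INF w\<in>W. f w) - (INF w\<in>W. g w)\<bar> \<le> d"
proof -
  have "(INF w\<in>W. f w) - d \<le> (INF w\<in>W. g w)"
  proof (rule cINF_greatest[OF W(1)])
    fix w assume "w \<in> W"
    then show "(INF w\<in>W. f w) - d \<le> g w"
      using assms(1)[of w] cINF_lower[OF assms(2), of w] by (simp add: abs_le_iff)
  qed
  moreover have "(INF w\<in>W. g w) - d \<le> (INF w\<in>W. f w)"
  proof (rule cINF_greatest[OF W(1)])
    fix w assume "w \<in> W"
    then show "(INF w\<in>W. g w) - d \<le> f w"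
      using assms(1)[of w] cINF_lower[OF assms(3), of w] by (simp add: abs_le_iff)
  qed
  ultimately show ?thesis by (simp add: abs_le_iff)
qed

lemma mcshane_bdd_below:
  assumes "\<And>w. w \<in> W \<Longrightarrow> m \<le> g w"
  shows "bdd_below ((\<lambda>w. g w + L * \<bar>clamp_sym R u - w\<bar>) ` W)"
  by (rule bdd_belowI2[where m=m]) (use assms L in \<open>fastforce intro: add_increasing2\<close>)

lemma mcshane_eq:
  assumes u: "u \<in> W" and g: "\<And>w w'. w \<in> W \<Longrightarrow> w' \<in> W \<Longrightarrow> \<bar>g w - g w'\<bar> \<le> L * \<bar>w - w'\<bar>"
  shows "mcshane W R L g u = g u"
proof -
  have cl: "clamp_sym R u = u" using W(2)[OF u] by (rule clamp_sym_id)
  have lb: "g u \<le> g w + L * \<bar>u - w\<bar>" if "w \<in> W" for w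
    using g[OF u that] by (simp add: abs_le_iff)
  show ?thesis
    unfolding mcshane_def cl
  proof (rule antisym)
    show "(INF w\<in>W. g w + L * \<bar>u - w\<bar>) \<le> g u"
      using cINF_lower[of "\<lambda>w. g w + L * \<bar>u - w\<bar>" W u] u lb
      by (force intro!: bdd_belowI2)
    show "g u \<le> (INF w\<in>W. g w + L * \<bar>u - w\<bar>)"
      by (rule cINF_greatest[OF W(1) lb])
  qed
qed

lemma mcshane_lipschitz:
  assumes "\<And>w. w \<in> W \<Longrightarrow> m \<le> g w"
  shows "\<bar>mcshane W R L g u - mcshane W R L g v\<bar> \<le> L * \<bar>u - v\<bar>"
  unfolding mcshane_def
proof (rule INF_diff_le)
  fix w assume "w \<in> W"
  have "\<bar>\<bar>clamp_sym R u - w\<bar> - \<bar>clamp_sym R v - w\<bar>\<bar> \<le> \<bar>u - v\<bar>"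
    using clamp_sym_lipschitz[of R u v] by linarith
  then have "L * \<bar>\<bar>clamp_sym R u - w\<bar> - \<bar>clamp_sym R v - w\<bar>\<bar> \<le> L * \<bar>u - v\<bar>"
    using L by (rule mult_left_mono)
  moreover have "L * \<bar>\<bar>clamp_sym R u - w\<bar> - \<bar>clamp_sym R v - w\<bar>\<bar>
      = \<bar>(g w + L * \<bar>clamp_sym R u - w\<bar>) - (g w + L * \<bar>clamp_sym R v - w\<bar>)\<bar>"
    using L by (simp add: right_diff_distrib[symmetric] abs_mult)
  ultimately show "\<bar>(g w + L * \<bar>clamp_sym R u - w\<bar>) - (g w + L * \<bar>clamp_sym R v - w\<bar>)\<bar> \<le> L * \<bar>u - v\<bar>"
    by simp
qed (use mcshane_bdd_below[of m g] assms in auto)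

text \<open>This carries estimates known only at frequencies in the support over to all real
  frequencies without loss.\<close>

lemma mcshane_nonexpansive:
  assumes "\<And>w. w \<in> W \<Longrightarrow> m \<le> g w" "\<And>w. w \<in> W \<Longrightarrow> m' \<le> h w"
    and "\<And>w. w \<in> W \<Longrightarrow> \<bar>g w - h w\<bar> \<le> d"
  shows "\<bar>mcshane W R L g u - mcshane W R L h u\<bar> \<le> d"
  unfolding mcshane_def
  by (rule INF_diff_le) (use mcshane_bdd_below[of m g] mcshane_bdd_below[of m' h] assms in auto)

lemma mcshane_clamp: "mcshane W R L g (clamp_sym R u) = mcshane W R L g u"
proof -
  obtain w where "w \<in> W" using W by auto
  then have "0 \<le> R" using W(2)[of w] by simp
  then show ?thesis
    using clamp_sym_id[OF clamp_sym_bound] by (simp add: mcshane_def)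
qed

end

section \<open>Static estimates on the flux\<close>

lemma taylor_quadratic:
  fixes f f' f'' :: "real \<Rightarrow> real"
  assumes "\<And>x. (f has_real_derivative f' x) (at x)" "\<And>x. (f' has_real_derivative f'' x) (at x)"
    and C: "\<And>x. \<bar>f'' x\<bar> \<le> C"
  shows "\<bar>f y - f x - f' x * (y - x)\<bar> \<le> C / 2 * (y - x)\<^sup>2"
proof (cases "x = y")
  case False
  define d where "d = (\<lambda>m::nat. if m = 0 then f else if m = 1 then f' else f'')"
  have "\<exists>t. (if y < x then y < t \<and> t < x else x < t \<and> t < y) \<and>
      f y = (\<Sum>m<2. (d m x / fact m) * (y - x)^m) + (d 2 t / fact 2) * (y - x)^2"
    by (rule Taylor[where a="min x y" and b="max x y"])
       (use False assms in \<open>auto simp: d_def less_2_cases_iff\<close>)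
  then obtain t where "f y = f x + f' x * (y - x) + f'' t / 2 * (y - x)^2"
    by (auto simp: d_def eval_nat_numeral)
  then have "f y - f x - f' x * (y - x) = f'' t / 2 * (y - x)^2" by simp
  moreover have "\<bar>f'' t / 2 * (y - x)^2\<bar> \<le> C / 2 * (y - x)^2"
    unfolding abs_mult using C[of t] by (simp add: mult_right_mono)
  ultimately show ?thesis by (simp only:)
qed simp

lemma C2_fun_partials:
  fixes f :: "real \<Rightarrow> real \<Rightarrow> real"
  assumes "C2_fun (\<lambda>z. f (fst z) (snd z))"
  shows "((\<lambda>y. f y w) has_real_derivative deriv (\<lambda>y. f y w) x) (at x)"
    and "((\<lambda>y. deriv (\<lambda>u. f u w) y) has_real_derivative deriv (\<lambda>y. deriv (\<lambda>u. f u w) y) x) (at x)"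
    and "((\<lambda>v. f x v) has_real_derivative deriv (\<lambda>v. f x v) w) (at w)"
proof -
  obtain Df :: "real \<times> real \<Rightarrow> (real \<times> real) \<Rightarrow>\<^sub>L real" and D2f where
    D: "\<And>z. ((\<lambda>z. f (fst z) (snd z)) has_derivative blinfun_apply (Df z)) (at z)"
       "\<And>z. (Df has_derivative blinfun_apply (D2f z)) (at z)"
    using assms unfolding C2_fun_def by blast
  have sc: "(h, 0) = h *\<^sub>R (1, 0)" "(0, h) = h *\<^sub>R (0, 1)" for h :: real
    by simp_all
  have e: "(\<lambda>h. blinfun_apply (Df z) (h, 0)) = (*) (blinfun_apply (Df z) (1, 0))"
    "(\<lambda>h. blinfun_apply (Df z) (0, h)) = (*) (blinfun_apply (Df z) (0, 1))" for z
    by (rule ext, subst sc, simp only: blinfun.scaleR_right real_scaleR_def mult.commute,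
        rule ext, subst sc, simp only: blinfun.scaleR_right real_scaleR_def mult.commute)
  have 1: "((\<lambda>y. f y w) has_real_derivative blinfun_apply (Df (x, w)) (1, 0)) (at x)" for x w
  proof -
    have "((\<lambda>y. (y, w)) has_derivative (\<lambda>h. (h, 0))) (at x)" by (auto intro!: derivative_eq_intros)
    from has_derivative_compose[OF this D(1)] show ?thesis
      by (simp only: has_field_derivative_def e fst_conv snd_conv)
  qed
  have 2: "((\<lambda>y. f x y) has_real_derivative blinfun_apply (Df (x, w)) (0, 1)) (at w)"
  proof -
    have "((\<lambda>y. (x, y)) has_derivative (\<lambda>h. (0, h))) (at w)" by (auto intro!: derivative_eq_intros)
    from has_derivative_compose[OF this D(1)] show ?thesis
      by (simp only: has_field_derivative_def e fst_conv snd_conv)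
  qed
  have d1: "deriv (\<lambda>y. f y w) x = blinfun_apply (Df (x, w)) (1, 0)" for x w
    by (rule DERIV_imp_deriv[OF 1])
  have 3: "((\<lambda>y. blinfun_apply (Df (y, w)) (1, 0)) has_real_derivative
      blinfun_apply (blinfun_apply (D2f (x, w)) (1, 0)) (1, 0)) (at x)"
  proof -
    have "((\<lambda>y. (y, w)) has_derivative (\<lambda>h. (h, 0))) (at x)" by (auto intro!: derivative_eq_intros)
    from has_derivative_compose[OF this D(2)]
    have "((\<lambda>y. Df (y, w)) has_derivative (\<lambda>h. blinfun_apply (D2f (x, w)) (h, 0))) (at x)" .
    then have "((\<lambda>y. blinfun_apply (Df (y, w)) (1, 0)) has_derivative
        (\<lambda>h. blinfun_apply (blinfun_apply (D2f (x, w)) (h, 0)) (1, 0))) (at x)"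
      by (auto intro!: derivative_eq_intros)
    moreover have "(\<lambda>h. blinfun_apply (blinfun_apply (D2f (x, w)) (h, 0)) (1, 0))
        = (*) (blinfun_apply (blinfun_apply (D2f (x, w)) (1, 0)) (1, 0))"
      by (rule ext, subst sc, simp only: blinfun.scaleR_right blinfun.scaleR_left real_scaleR_def mult.commute)
    ultimately show ?thesis by (simp only: has_field_derivative_def)
  qed
  show "((\<lambda>y. f y w) has_real_derivative deriv (\<lambda>y. f y w) x) (at x)" using 1 d1 by simp
  show "((\<lambda>v. f x v) has_real_derivative deriv (\<lambda>v. f x v) w) (at w)" using 2 DERIV_imp_deriv[OF 2] by simp
  show "((\<lambda>y. deriv (\<lambda>u. f u w) y) has_real_derivative deriv (\<lambda>y. deriv (\<lambda>u. f u w) y) x) (at x)"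
    unfolding d1 using 3 DERIV_imp_deriv[OF 3] by simp
qed

locale kinetic =
  fixes \<nu> :: "real measure" and F :: flux
    and A I M \<kappa> D \<gamma> \<omega>c :: real and \<Delta> :: "real \<Rightarrow> real"
  assumes nu_prob: "prob_space \<nu>" and nu_sets: "sets \<nu> = sets borel"
      and nu_moment: "integrable \<nu> (\<lambda>\<omega>. \<omega>^2)"
      and nu_bdd: "bounded (msupp \<nu>)"
      and gamma_eq: "\<gamma> = (SUP p \<in> msupp \<nu> \<times> msupp \<nu>. \<bar>fst p - snd p\<bar>)"
      and omega_c_eq: "\<omega>c = (\<integral> \<omega>. \<omega> \<partial>\<nu>)"
      and pos: "A > 0" "I > 0" "M > 0" "\<kappa> > 0"
      and A1: "\<And>\<mu> \<mu>' x \<omega>. \<mu> \<in> P2nu \<nu> \<Longrightarrow> \<mu>' \<in> P2nu \<nu> \<Longrightarrow> \<omega> \<in> msupp \<nu> \<Longrightarrow>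
                 \<bar>F \<mu> x \<omega> - F \<mu>' x \<omega>\<bar> \<le> \<kappa> * M * wasserstein 1 \<mu> \<mu>' \<and>
                 \<bar>dxF F \<mu> x \<omega> - dxF F \<mu>' x \<omega>\<bar> \<le> \<kappa> * M * wasserstein 1 \<mu> \<mu>'"
      and A2_C2: "\<And>\<mu>. \<mu> \<in> P2nu \<nu> \<Longrightarrow> C2_fun (\<lambda>z. F \<mu> (fst z) (snd z))"
      and A2_bounds: "\<And>\<mu> x \<omega>. \<mu> \<in> P2nu \<nu> \<Longrightarrow>
                 \<bar>dxF F \<mu> x \<omega>\<bar> \<le> \<kappa> * I \<and> \<bar>dxxF F \<mu> x \<omega>\<bar> \<le> \<kappa> * I \<and> \<bar>dwF F \<mu> x \<omega>\<bar> \<le> I"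
      and A3: "\<And>\<mu> x \<omega>. \<mu> \<in> P2nu \<nu> \<Longrightarrow> F (distr \<mu> borel tau2pi) (x + 2 * pi) \<omega> = F \<mu> x \<omega>"
      and A4: "\<And>x. F (return borel x \<Otimes>\<^sub>M \<nu>) x \<omega>c \<ge> A"
      and D_pos: "D > 0"
      and cond_i: "A - ((\<kappa> + 1) * I + \<kappa> * M) * D - I * \<gamma> > 0"
      and Delta_range: "\<And>s. 0 < \<Delta> s \<and> \<Delta> s < D"
      and Delta_periodic: "\<And>s. \<Delta> (s + 2 * pi) = \<Delta> s"
      and Delta_ode: "\<And>s. (\<Delta> has_real_derivative
                 (C2c A \<kappa> M I D \<gamma> +
                  dxF F (return borel s \<Otimes>\<^sub>M \<nu>) s \<omega>c / F (return borel s \<Otimes>\<^sub>M \<nu>) s \<omega>c * \<Delta> s)) (at s)"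
begin

abbreviation "\<Omega> \<equiv> msupp \<nu>"
abbreviation "C\<^sub>1 \<equiv> C1c \<kappa> M I D \<gamma>"
abbreviation "C\<^sub>2 \<equiv> C2c A \<kappa> M I D \<gamma>"
text \<open>The amount subtracted from \<open>A\<close> in condition (i). It bounds how far particle
  velocities and the centre velocity deviate from that of the concentrated state, so
  \<open>A - \<epsilon>\<close> is a lower bound on the drift.\<close>

definition "\<epsilon> = ((\<kappa> + 1) * I + \<kappa> * M) * D + I * \<gamma>"
definition point_measure_at :: "real \<Rightarrow> (real \<times> real) measure" where
  "point_measure_at s = return borel s \<Otimes>\<^sub>M \<nu>"
definition "slope s = dxF F (point_measure_at s) s \<omega>c"
definition "speed s = F (point_measure_at s) s \<omega>c"
definition "graph_measure X = distr \<nu> borel (\<lambda>\<omega>. (X \<omega>, \<omega>))"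

interpretation \<nu>: prob_space \<nu> by (rule nu_prob)

lemma kI: "0 \<le> \<kappa> * I" and kM: "0 \<le> \<kappa> * M" and I0: "0 \<le> I" and D0: "0 \<le> D"
  using pos D_pos by auto

lemma nu_space: "space \<nu> = UNIV"
  using sets_eq_imp_space_eq[OF nu_sets] by simp

lemma nu_borel: "borel_measurable \<nu> = borel_measurable borel"
  using nu_sets by (auto cong: measurable_cong_sets)

lemma AE_Omega: "AE \<omega> in \<nu>. \<omega> \<in> \<Omega>"
  by (rule AE_msupp[OF nu_sets])

lemma Omega_ne: "\<Omega> \<noteq> {}"
  using AE_Omega \<nu>.emeasure_space_1 by (auto simp: \<nu>.AE_False)

lemma Omega_compact: "compact \<Omega>"
  using nu_bdd closed_msupp by (simp add: compact_eq_bounded_closed)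

definition "Rad = (SOME R. 0 < R \<and> (\<forall>\<omega>\<in>\<Omega>. \<bar>\<omega>\<bar> \<le> R))"

lemma Rad: "0 < Rad" "\<omega> \<in> \<Omega> \<Longrightarrow> \<bar>\<omega>\<bar> \<le> Rad"
proof -
  have "\<exists>R. 0 < R \<and> (\<forall>\<omega>\<in>\<Omega>. \<bar>\<omega>\<bar> \<le> R)"
    using nu_bdd by (auto simp: bounded_pos)
  from someI_ex[OF this] show "0 < Rad" "\<omega> \<in> \<Omega> \<Longrightarrow> \<bar>\<omega>\<bar> \<le> Rad"
    by (auto simp: Rad_def)
qed

lemma Omega_diam: "\<omega> \<in> \<Omega> \<Longrightarrow> \<omega>' \<in> \<Omega> \<Longrightarrow> \<bar>\<omega> - \<omega>'\<bar> \<le> \<gamma>"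
proof -
  assume o: "\<omega> \<in> \<Omega>" "\<omega>' \<in> \<Omega>"
  have "bdd_above ((\<lambda>p. \<bar>fst p - snd p\<bar>) ` (\<Omega> \<times> \<Omega>))"
  proof (rule bdd_aboveI2[where M="2 * Rad"])
    fix p assume "p \<in> \<Omega> \<times> \<Omega>"
    then have "\<bar>fst p\<bar> \<le> Rad" "\<bar>snd p\<bar> \<le> Rad" using Rad(2) by auto
    then show "\<bar>fst p - snd p\<bar> \<le> 2 * Rad" by linarith
  qed
  from cSUP_upper[OF _ this, of "(\<omega>, \<omega>')"] o show ?thesis by (simp add: gamma_eq)
qed

lemma gamma_nonneg: "0 \<le> \<gamma>"
  using Omega_ne Omega_diam by fastforce

lemma nu_integrable_id: "integrable \<nu> (\<lambda>\<omega>. \<omega>)"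
  by (rule \<nu>.square_integrable_imp_integrable[OF _ nu_moment]) (simp add: nu_borel)

lemma Omega_mean: "\<omega> \<in> \<Omega> \<Longrightarrow> \<bar>\<omega> - \<omega>c\<bar> \<le> \<gamma>"
proof -
  assume o: "\<omega> \<in> \<Omega>"
  have "\<omega> - \<omega>c = (\<integral>v. \<omega> - v \<partial>\<nu>)"
    using nu_integrable_id by (simp add: omega_c_eq \<nu>.prob_space)
  also have "\<bar>\<dots>\<bar> \<le> (\<integral>v. \<bar>\<omega> - v\<bar> \<partial>\<nu>)" by (rule integral_abs_bound)
  also have "\<dots> \<le> (\<integral>v. \<gamma> \<partial>\<nu>)"
    using AE_Omega Omega_diam[OF o] nu_integrable_id
    by (intro integral_mono_AE) (auto elim: eventually_mono)
  finally show ?thesis by (simp add: \<nu>.prob_space)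
qed

lemma P2nu_AE_Omega: "\<mu> \<in> P2nu \<nu> \<Longrightarrow> AE z in \<mu>. snd z \<in> \<Omega>"
proof -
  assume m: "\<mu> \<in> P2nu \<nu>"
  have "AE z in distr \<mu> borel snd. z \<in> \<Omega>" using AE_Omega by (simp only: P2nu_distr_snd[OF m nu_sets])
  then show ?thesis
    by (subst (asm) AE_distr_iff)
       (use P2nu_sets[OF m] closed_msupp in \<open>auto cong: measurable_cong_sets intro!: borel_closed\<close>)
qed

lemma graph_measure_P2nu:
  assumes "X \<in> borel_measurable borel" "integrable \<nu> (\<lambda>\<omega>. (X \<omega>)\<^sup>2)"
  shows "graph_measure X \<in> P2nu \<nu>"
proof -
  have X[measurable]: "X \<in> borel_measurable \<nu>" using assms(1) by (simp only: nu_borel)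
  have [measurable]: "(\<lambda>\<omega>. \<omega>) \<in> borel_measurable \<nu>" by (simp add: nu_borel)
  have "integrable (graph_measure X) (\<lambda>z. (norm z)^2)"
    unfolding graph_measure_def
    using assms nu_moment by (subst integrable_distr_eq) (auto simp: norm_Pair)
  moreover have "emeasure (graph_measure X) (UNIV \<times> B) = emeasure \<nu> B" if B: "B \<in> sets borel" for B
    using B unfolding graph_measure_def
    by (subst emeasure_distr) (auto simp: nu_space vimage_def borel_Times)
  ultimately show ?thesis
    by (auto simp: P2nu_def P2_def graph_measure_def intro!: \<nu>.prob_space_distr)
qed

lemma graph_measure_const: "graph_measure (\<lambda>_. s) = point_measure_at s"
proof -
  have m: "graph_measure (\<lambda>_. s) \<in> P2nu \<nu>" by (rule graph_measure_P2nu) auto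
  have [measurable]: "(\<lambda>\<omega>. \<omega>) \<in> borel_measurable \<nu>" by (simp add: nu_borel)
  have "point_measure_at s = distr (graph_measure (\<lambda>_. s)) borel (\<lambda>z. (s, snd z))"
    unfolding point_measure_at_def by (rule return_pair_eq_distr[OF m nu_prob nu_sets])
  also have "\<dots> = graph_measure (\<lambda>_. s)"
    unfolding graph_measure_def by (subst distr_distr) (auto simp: o_def)
  finally show ?thesis by simp
qed

lemma point_measure_P2nu: "point_measure_at s \<in> P2nu \<nu>"
  unfolding graph_measure_const[symmetric] by (rule graph_measure_P2nu) auto

lemma W1_point_measure:
  assumes m: "\<mu> \<in> P2nu \<nu>" and c: "AE z in \<mu>. \<bar>fst z - s\<bar> \<le> d" and d: "0 \<le> d"
  shows "wasserstein 1 \<mu> (point_measure_at s) \<le> d"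
proof -
  have [measurable_cong]: "sets \<mu> = sets borel" by (rule P2nu_sets[OF m])
  have "wasserstein 1 (distr \<mu> borel (\<lambda>z. z)) (distr \<mu> borel (\<lambda>z. (s, snd z))) \<le> d"
    by (rule wasserstein_distr_le(2)[OF P2nu_prob[OF m] _ _ _ d])
       (use c in \<open>auto simp: dist_prod_def dist_real_def elim!: eventually_mono\<close>)
  moreover have "distr \<mu> borel (\<lambda>z. z) = \<mu>"
    using distr_id2[of borel \<mu>] P2nu_sets[OF m] by simp
  ultimately show ?thesis
    by (simp add: point_measure_at_def return_pair_eq_distr[OF m nu_prob nu_sets])
qed

context
  fixes \<mu> assumes m: "\<mu> \<in> P2nu \<nu>"
begin

lemma F_deriv_x: "((\<lambda>y. F \<mu> y \<omega>) has_real_derivative dxF F \<mu> x \<omega>) (at x)"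
  and dxF_deriv_x: "((\<lambda>y. dxF F \<mu> y \<omega>) has_real_derivative dxxF F \<mu> x \<omega>) (at x)"
  and F_deriv_w: "((\<lambda>v. F \<mu> x v) has_real_derivative dwF F \<mu> x \<omega>) (at \<omega>)"
  using C2_fun_partials[OF A2_C2[OF m]] unfolding dxF_def dxxF_def dwF_def by simp_all

lemma F_lip_x: "\<bar>F \<mu> x \<omega> - F \<mu> y \<omega>\<bar> \<le> \<kappa> * I * \<bar>x - y\<bar>"
  using field_differentiable_bound[of UNIV "\<lambda>y. F \<mu> y \<omega>" "\<lambda>x. dxF F \<mu> x \<omega>" "\<kappa> * I" x y]
    F_deriv_x A2_bounds[OF m] by simp

lemma dxF_lip_x: "\<bar>dxF F \<mu> x \<omega> - dxF F \<mu> y \<omega>\<bar> \<le> \<kappa> * I * \<bar>x - y\<bar>"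
  using field_differentiable_bound[of UNIV "\<lambda>y. dxF F \<mu> y \<omega>" "\<lambda>x. dxxF F \<mu> x \<omega>" "\<kappa> * I" x y]
    dxF_deriv_x A2_bounds[OF m] by simp

lemma F_lip_w: "\<bar>F \<mu> x \<omega> - F \<mu> x \<omega>'\<bar> \<le> I * \<bar>\<omega> - \<omega>'\<bar>"
  using field_differentiable_bound[of UNIV "\<lambda>w. F \<mu> x w" "\<lambda>w. dwF F \<mu> x w" "I" \<omega> \<omega>']
    F_deriv_w A2_bounds[OF m] by simp

lemma F_taylor: "\<bar>F \<mu> y \<omega> - F \<mu> x \<omega> - dxF F \<mu> x \<omega> * (y - x)\<bar> \<le> \<kappa> * I / 2 * (y - x)\<^sup>2"
  by (rule taylor_quadratic[OF F_deriv_x dxF_deriv_x]) (use A2_bounds[OF m] in blast)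

end

lemma speed_ge: "A \<le> speed s" unfolding speed_def point_measure_at_def by (rule A4)

lemma slope_bound: "\<bar>slope s\<bar> \<le> \<kappa> * I"
  unfolding slope_def using A2_bounds[OF point_measure_P2nu] by blast

lemma C1_pos: "C\<^sub>1 > 0"
  unfolding C1c_def using pos D_pos gamma_nonneg by (intro add_pos_nonneg) auto

lemma eps_less: "\<epsilon> < A" using cond_i by (simp add: \<epsilon>_def)

lemma eps_nonneg: "0 \<le> \<epsilon>"
  unfolding \<epsilon>_def using pos D_pos gamma_nonneg by simp

section \<open>Comparison of the flux with that of a concentrated state\<close>

context
  fixes \<mu> s
  assumes m: "\<mu> \<in> P2nu \<nu>" and W: "wasserstein 1 \<mu> (point_measure_at s) \<le> D"
begin

lemma A1_point:
  assumes "\<omega> \<in> \<Omega>"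
  shows "\<bar>F \<mu> x \<omega> - F (point_measure_at s) x \<omega>\<bar> \<le> \<kappa> * M * D"
    "\<bar>dxF F \<mu> x \<omega> - dxF F (point_measure_at s) x \<omega>\<bar> \<le> \<kappa> * M * D"
proof -
  have "\<kappa> * M * wasserstein 1 \<mu> (point_measure_at s) \<le> \<kappa> * M * D"
    using W pos by (intro mult_left_mono) auto
  with A1[OF m point_measure_P2nu[of s] assms, of x]
  show "\<bar>F \<mu> x \<omega> - F (point_measure_at s) x \<omega>\<bar> \<le> \<kappa> * M * D"
    "\<bar>dxF F \<mu> x \<omega> - dxF F (point_measure_at s) x \<omega>\<bar> \<le> \<kappa> * M * D" by linarith+
qed

text \<open>Three replacements: the measure by the concentrated one (cost
  \<open>\<kappa> * M * D\<close>), the position by \<open>s\<close>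
  (\<open>\<kappa> * I * D\<close>) and the frequency by its mean (\<open>I * \<gamma>\<close>). The
  remaining \<open>I * D\<close> in \<epsilon> is slack.\<close>

lemma F_near_speed:
  assumes o: "\<omega> \<in> \<Omega>" and x: "\<bar>x - s\<bar> \<le> D"
  shows "\<bar>F \<mu> x \<omega> - speed s\<bar> \<le> \<epsilon>"
proof -
  note P = point_measure_P2nu[of s]
  have "\<bar>F (point_measure_at s) x \<omega> - F (point_measure_at s) s \<omega>\<bar> \<le> \<kappa> * I * D"
    using F_lip_x[OF P, of x \<omega> s] mult_left_mono[OF x kI] by linarith
  moreover have "\<bar>F (point_measure_at s) s \<omega> - speed s\<bar> \<le> I * \<gamma>"
    using F_lip_w[OF P, of s \<omega> \<omega>c] mult_left_mono[OF Omega_mean[OF o] I0]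
    unfolding speed_def by linarith
  moreover have "\<epsilon> = \<kappa> * M * D + \<kappa> * I * D + I * \<gamma> + I * D" by (simp add: \<epsilon>_def algebra_simps)
  moreover have "I * D > 0" using pos D_pos by simp
  ultimately show ?thesis using A1_point(1)[OF o, of x] by linarith
qed

text \<open>The two measures are compared through the derivative of the difference of their fluxes,
  which gains a factor \<open>x - x'\<close>. Without a mixed derivative no such gain is available
  for the frequency, so it is exchanged for the mean separately at both points. The cost is kept as
  \<open>\<bar>\<omega> - \<omega>c\<bar>\<close>, because the next estimate chooses the cheaper of
  two frequencies.\<close>

lemma F_diff_same:
  assumes o: "\<omega> \<in> \<Omega>" and x: "\<bar>x - s\<bar> \<le> D" "\<bar>x' - s\<bar> \<le> D" "\<bar>x - x'\<bar> \<le> D"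
  shows "F \<mu> x \<omega> - F \<mu> x' \<omega> \<le> slope s * (x - x') + \<kappa> * (M + I) * D\<^sup>2 + 2 * I * \<bar>\<omega> - \<omega>c\<bar>"
proof -
  let ?P = "point_measure_at s"
  note P = point_measure_P2nu[of s]
  have DD: "\<kappa> * C * D * \<bar>x - x'\<bar> \<le> \<kappa> * C * D * D" if "C > 0" for C
    using x(3) pos D_pos that by (intro mult_left_mono) auto
  have 1: "\<bar>(F \<mu> x \<omega> - F ?P x \<omega>) - (F \<mu> x' \<omega> - F ?P x' \<omega>)\<bar> \<le> \<kappa> * M * D * \<bar>x - x'\<bar>"
    using field_differentiable_bound[of UNIV "\<lambda>y. F \<mu> y \<omega> - F ?P y \<omega>" "\<lambda>x. dxF F \<mu> x \<omega> - dxF F ?P x \<omega>" "\<kappa> * M * D" x x']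
      A1_point(2)[OF o] F_deriv_x[OF m] F_deriv_x[OF P] by (simp add: derivative_intros)
  have 2: "\<bar>F ?P y \<omega> - F ?P y \<omega>c\<bar> \<le> I * \<bar>\<omega> - \<omega>c\<bar>" for y
    by (rule F_lip_w[OF P])
  have "norm ((F ?P x \<omega>c - slope s * x) - (F ?P x' \<omega>c - slope s * x')) \<le> \<kappa> * I * D * norm (x - x')"
  proof (rule field_differentiable_bound[of "cball s D" _ "\<lambda>y. dxF F ?P y \<omega>c - slope s"])
    fix y assume "y \<in> cball s D"
    then have "\<bar>y - s\<bar> \<le> D" by (simp add: dist_real_def)
    from mult_left_mono[OF this kI] dxF_lip_x[OF P, of y \<omega>c s]
    show "norm (dxF F ?P y \<omega>c - slope s) \<le> \<kappa> * I * D" unfolding slope_def real_norm_def by linarith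
    show "((\<lambda>x. F ?P x \<omega>c - slope s * x) has_real_derivative dxF F ?P y \<omega>c - slope s) (at y within cball s D)"
      by (auto intro!: derivative_eq_intros DERIV_subset[OF F_deriv_x[OF P]])
  qed (use x in \<open>auto simp: dist_real_def\<close>)
  then have 3: "F ?P x \<omega>c - F ?P x' \<omega>c - slope s * (x - x') \<le> \<kappa> * I * D * \<bar>x - x'\<bar>"
    by (simp add: algebra_simps)
  have "\<kappa> * (M + I) * D\<^sup>2 = \<kappa> * M * D * D + \<kappa> * I * D * D" by (simp add: algebra_simps power2_eq_square)
  with abs_le_D1[OF 1] abs_le_D1[OF 2[of x]] abs_le_D2[OF 2[of x']] 3 DD[of M] DD[of I] pos show ?thesis
    by linarith
qed

lemma F_diff_pair:
  assumes o: "\<omega> \<in> \<Omega>" "\<omega>' \<in> \<Omega>" and x: "\<bar>x - s\<bar> \<le> D" "\<bar>x' - s\<bar> \<le> D" "\<bar>x - x'\<bar> \<le> D"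
  shows "F \<mu> x \<omega> - F \<mu> x' \<omega>' \<le> slope s * (x - x') + C\<^sub>1"
proof -
  \<comment> \<open>Going through the frequency closer to the mean gives \<open>2 * \<gamma>\<close>
    in place of \<open>3 * \<gamma>\<close>. If the mean lies between the two frequencies, twice the
    smaller distance is at most their separation; otherwise the left-hand sum equals the sum of the
    two distances to the mean.\<close>
  have g: "I * (\<bar>\<omega> - \<omega>'\<bar> + 2 * min \<bar>\<omega> - \<omega>c\<bar> \<bar>\<omega>' - \<omega>c\<bar>) \<le> I * (2 * \<gamma>)"
  proof (rule mult_left_mono[OF _ I0])
    show "\<bar>\<omega> - \<omega>'\<bar> + 2 * min \<bar>\<omega> - \<omega>c\<bar> \<bar>\<omega>' - \<omega>c\<bar> \<le> 2 * \<gamma>"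
      using Omega_mean[OF o(1)] Omega_mean[OF o(2)] Omega_diam[OF o] by (smt (verit))
  qed
  have C: "C\<^sub>1 = \<kappa> * (M + I) * D\<^sup>2 + I * (2 * \<gamma>)" by (simp add: C1c_def)
  show ?thesis
  proof (cases "\<bar>\<omega> - \<omega>c\<bar> \<le> \<bar>\<omega>' - \<omega>c\<bar>")
    case True
    have "F \<mu> x' \<omega> - F \<mu> x' \<omega>' \<le> I * \<bar>\<omega> - \<omega>'\<bar>" using F_lip_w[OF m, of x' \<omega> \<omega>'] by (simp add: abs_le_iff)
    with F_diff_same[OF o(1) x] g True C show ?thesis by (simp add: algebra_simps)
  next
    case False
    have "F \<mu> x \<omega> - F \<mu> x \<omega>' \<le> I * \<bar>\<omega> - \<omega>'\<bar>" using F_lip_w[OF m, of x \<omega> \<omega>'] by (simp add: abs_le_iff)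
    with F_diff_same[OF o(2) x] g False C show ?thesis by (simp add: algebra_simps)
  qed
qed

text \<open>No bound on the mixed derivative of the flux is available; the first derivative at
  frequency \<open>\<omega>\<close> is instead compared with a difference quotient over a step of length \<open>D\<close>
  directed towards \<open>s\<close>.\<close>

lemma dxF_le:
  assumes o: "\<omega> \<in> \<Omega>" and x: "\<bar>x - s\<bar> \<le> D"
  shows "dxF F \<mu> x \<omega> \<le> slope s + C\<^sub>1 / D"
proof -
  let ?P = "point_measure_at s"
  note P = point_measure_P2nu[of s]
  have w: "\<bar>F ?P y \<omega> - F ?P y \<omega>c\<bar> \<le> I * \<gamma>" for y
    using F_lip_w[OF P, of y \<omega> \<omega>c] mult_left_mono[OF Omega_mean[OF o] I0] by linarith
  have step: "dxF F ?P x \<omega> * h * h \<le> slope s * h * h + 2 * I * \<gamma> * \<bar>h\<bar> + \<kappa> * I * D\<^sup>2 * \<bar>h\<bar>"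
    if h: "\<bar>h\<bar> = D" "(x - s) * (x - h - s) \<le> 0" for h
  proof -
    define \<sigma> where "\<sigma> = sgn h"
    have h0: "h = \<sigma> * D" "\<bar>\<sigma>\<bar> = 1" "\<sigma> * \<sigma> = 1"
      using h(1) D_pos by (auto simp: \<sigma>_def sgn_if abs_if split: if_splits)
    have b: "\<bar>\<sigma> * u\<bar> = \<bar>u\<bar>" for u using h0 by (simp add: abs_mult)
    \<comment> \<open>A step of length \<open>D\<close> across \<open>s\<close> puts
      \<open>x\<close> and \<open>x - h\<close> on opposite sides of \<open>s\<close>, so the two
      Taylor errors around \<open>s\<close> together cost no more than a single one over length
      \<open>D\<close>. With the error at \<open>x\<close> this gives exactly the
      \<open>\<kappa> * I * D\<close> contained in \<open>C\<^sub>1 / D\<close>.\<close>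
    have q: "(x - s)\<^sup>2 + (x - h - s)\<^sup>2 \<le> D\<^sup>2"
    proof -
      have "(x - s)\<^sup>2 + (x - h - s)\<^sup>2 = h\<^sup>2 + 2 * ((x - s) * (x - h - s))"
        by (simp add: power2_eq_square algebra_simps)
      then show ?thesis using h by (metis add_decreasing2 le_numeral_extra(3) mult_nonneg_nonpos2 order_refl power2_abs mult.commute zero_le_numeral)
    qed
    have t1: "\<bar>F ?P (x - h) \<omega> - F ?P x \<omega> + dxF F ?P x \<omega> * h\<bar> \<le> \<kappa> * I / 2 * D\<^sup>2"
      using F_taylor[OF P, of "x - h" \<omega> x] h(1) by (simp flip: power2_abs[of h])
    have t2: "\<bar>F ?P x \<omega>c - F ?P s \<omega>c - slope s * (x - s)\<bar> \<le> \<kappa> * I / 2 * (x - s)\<^sup>2"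
      using F_taylor[OF P, of x \<omega>c s] by (simp add: slope_def)
    have t3: "\<bar>F ?P (x - h) \<omega>c - F ?P s \<omega>c - slope s * (x - h - s)\<bar> \<le> \<kappa> * I / 2 * (x - h - s)\<^sup>2"
      using F_taylor[OF P, of "x - h" \<omega>c s] by (simp add: slope_def)
    have t4: "\<kappa> * I / 2 * (x - s)\<^sup>2 + \<kappa> * I / 2 * (x - h - s)\<^sup>2 \<le> \<kappa> * I / 2 * D\<^sup>2"
      unfolding distrib_left[symmetric] by (rule mult_left_mono[OF q]) (use pos in auto)
    have t5: "slope s * (x - s) - slope s * (x - h - s) = slope s * h" by (simp add: algebra_simps)
    have combine: "\<bar>p - (a - c)\<bar> \<le> 2 * e + 2 * q"
      if "\<bar>G1 - G0 + p\<bar> \<le> q" "\<bar>K1 - K0 - a\<bar> \<le> b" "\<bar>K2 - K0 - c\<bar> \<le> d" "b + d \<le> q"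
        "\<bar>G0 - K1\<bar> \<le> e" "\<bar>G1 - K2\<bar> \<le> e" for G0 G1 p q K0 K1 K2 a b c d e :: real
      using that by linarith
    have "\<bar>dxF F ?P x \<omega> * h - slope s * h\<bar> \<le> 2 * (I * \<gamma>) + \<kappa> * I * D\<^sup>2"
      using combine[OF t1 t2 t3 t4 w[of x] w[of "x - h"]] unfolding t5 by simp
    then have "\<bar>h\<bar> * \<bar>dxF F ?P x \<omega> * h - slope s * h\<bar> \<le> \<bar>h\<bar> * (2 * (I * \<gamma>) + \<kappa> * I * D\<^sup>2)"
      by (rule mult_left_mono) simp
    then have "(dxF F ?P x \<omega> * h - slope s * h) * h \<le> \<bar>h\<bar> * (2 * (I * \<gamma>) + \<kappa> * I * D\<^sup>2)"
      by (simp add: abs_mult[symmetric] mult.commute abs_le_iff)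
    then show ?thesis by (simp add: algebra_simps)
  qed
  obtain h where h: "\<bar>h\<bar> = D" "(x - s) * (x - h - s) \<le> 0"
  proof (cases "s \<le> x")
    case True
    then have "(x - s) * (x - D - s) \<le> 0" using x by (intro mult_nonneg_nonpos) auto
    then show ?thesis using that[of D] D_pos by simp
  next
    case False
    then have "(x - s) * (x - - D - s) \<le> 0" using x by (intro mult_nonpos_nonneg) auto
    then show ?thesis using that[of "- D"] D_pos by simp
  qed
  have hh: "h * h = D * D" using h(1) by (metis abs_mult_self_eq)
  have "dxF F ?P x \<omega> * (D * D) \<le> slope s * (D * D) + 2 * I * \<gamma> * D + \<kappa> * I * D\<^sup>2 * D"
    using step[OF h] h(1) by (simp add: mult.assoc hh)
  also have "\<dots> = (slope s + \<kappa> * I * D + 2 * I * \<gamma> / D) * (D * D)"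
    using D_pos by (simp add: field_simps power2_eq_square)
  finally have "dxF F ?P x \<omega> \<le> slope s + \<kappa> * I * D + 2 * I * \<gamma> / D"
    using D_pos by (metis mult_pos_pos mult_right_le_imp_le)
  moreover have "C\<^sub>1 / D = \<kappa> * M * D + \<kappa> * I * D + 2 * I * \<gamma> / D"
    using D_pos by (simp add: C1c_def field_simps power2_eq_square)
  ultimately show ?thesis using A1_point(2)[OF o, of x] by (simp add: abs_le_iff)
qed

text \<open>In contrast to the pair estimate, the constant \<open>C\<^sub>1\<close> is traded for
  the linear term \<open>C\<^sub>1 / D\<close> times the distance; only the difference of the
  frequencies remains inhomogeneous. This is the form needed for Lipschitz dependence on the
  frequency. The order of the two points lets the upper bound on the derivative be multiplied by
  their distance.\<close>

lemma F_diff_linear: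
  assumes o: "\<omega> \<in> \<Omega>" and x: "\<bar>x - s\<bar> \<le> D" "\<bar>x' - s\<bar> \<le> D" "x' \<le> x"
  shows "F \<mu> x \<omega> - F \<mu> x' \<omega>' \<le> (slope s + C\<^sub>1 / D) * (x - x') + I * \<bar>\<omega> - \<omega>'\<bar>"
proof -
  have "\<exists>y\<in>{x'..x}. F \<mu> x \<omega> - F \<mu> x' \<omega> = dxF F \<mu> y \<omega> * (x - x')"
    by (rule mvt_very_simple[OF x(3)])
       (use has_derivative_at_withinI[OF F_deriv_x[OF m, unfolded has_field_derivative_def]] in simp)
  then obtain y where y: "y \<in> {x'..x}" "F \<mu> x \<omega> - F \<mu> x' \<omega> = dxF F \<mu> y \<omega> * (x - x')" by blast
  have "dxF F \<mu> y \<omega> * (x - x') \<le> (slope s + C\<^sub>1 / D) * (x - x')"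
    using y x by (intro mult_right_mono dxF_le[OF o]) auto
  moreover have "F \<mu> x' \<omega> - F \<mu> x' \<omega>' \<le> I * \<bar>\<omega> - \<omega>'\<bar>" using F_lip_w[OF m, of x' \<omega> \<omega>'] by (simp add: abs_le_iff)
  ultimately show ?thesis using y(2) by linarith
qed

end

text \<open>This is the origin of \<open>C\<^sub>2\<close>. Differentiating \<Delta> along the
  centre produces the right-hand side, with \<open>V\<close> the centre velocity; turning
  \<open>V / speed s\<close> into 1 costs at most
  \<open>\<epsilon> * (\<kappa> * I * D) / A\<close>.\<close>

lemma Delta_growth:
  assumes V: "\<bar>V - speed s\<bar> \<le> \<epsilon>" and r: "0 \<le> r" "r \<le> D"
  shows "C\<^sub>1 + slope s * r \<le> V * (C\<^sub>2 + slope s / speed s * r)"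
proof -
  have Vp: "V \<ge> A - \<epsilon>" using V speed_ge[of s] by linarith
  have sp: "speed s > 0" using speed_ge[of s] pos by linarith
  have Ae: "A - \<epsilon> > 0" using eps_less by simp
  \<comment> \<open>The defining formula of \<open>C\<^sub>2\<close>, solved for what it has to pay
    for: at the smallest admissible velocity it covers \<open>C\<^sub>1\<close> and the cost of
    replacing the velocity.\<close>
  have C2eq: "(A - \<epsilon>) * C\<^sub>2 = C\<^sub>1 + \<epsilon> * (\<kappa> * I * D) / A"
  proof -
    have ae: "A - ((\<kappa> + 1) * I + \<kappa> * M) * D - I * \<gamma> = A - \<epsilon>" by (simp add: \<epsilon>_def)
    have "C\<^sub>2 = C\<^sub>1 / A + \<epsilon> * (\<kappa> * I * D + C\<^sub>1) / (A * (A - \<epsilon>))"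
      unfolding C2c_def ae by (simp add: \<epsilon>_def)
    also have "(A - \<epsilon>) * \<dots> = C\<^sub>1 + \<epsilon> * (\<kappa> * I * D) / A"
      using Ae pos by (simp add: field_simps)
    finally show ?thesis .
  qed
  have "C\<^sub>2 > 0"
  proof -
    have "(A - \<epsilon>) * C\<^sub>2 > 0" unfolding C2eq using C1_pos eps_nonneg pos D_pos by (intro add_pos_nonneg) auto
    then show ?thesis using Ae by (simp add: zero_less_mult_iff)
  qed
  then have 1: "C\<^sub>1 + \<epsilon> * (\<kappa> * I * D) / A \<le> V * C\<^sub>2"
    using C2eq mult_right_mono[OF Vp, of C\<^sub>2] by simp
  have "\<bar>slope s * r * ((speed s - V) / speed s)\<bar> = \<bar>slope s\<bar> * r * (\<bar>speed s - V\<bar> / speed s)"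
    using r sp by (simp add: abs_mult)
  also have "\<dots> \<le> (\<kappa> * I) * D * (\<epsilon> / A)"
    using slope_bound[of s] r V speed_ge[of s] pos eps_nonneg sp
    by (intro mult_mono frac_le) (auto simp: abs_minus_commute)
  finally have 2: "\<bar>slope s * r * ((speed s - V) / speed s)\<bar> \<le> \<epsilon> * (\<kappa> * I * D) / A"
    by (simp add: mult_ac)
  have "V * (slope s / speed s * r) = slope s * r - slope s * r * ((speed s - V) / speed s)"
    using sp by (simp add: field_simps)
  with 1 2 show ?thesis unfolding distrib_left by linarith
qed

section \<open>A globally Lipschitz extension of the flux\<close>

text \<open>Assumption A1 compares fluxes only at frequencies in \<Omega>. The extension agrees with
  \<open>F\<close> there and depends continuously on the measure at every frequency, so
  characteristics exist for all frequencies.\<close>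

definition vel :: "(real \<times> real) measure \<Rightarrow> real \<Rightarrow> real \<Rightarrow> real" where
  "vel \<mu> x u = mcshane \<Omega> Rad I (\<lambda>\<omega>. F \<mu> x \<omega>) u"

lemma F_lower: "\<mu> \<in> P2nu \<nu> \<Longrightarrow> \<exists>m. \<forall>\<omega>\<in>\<Omega>. m \<le> F \<mu> x \<omega>"
proof -
  assume m: "\<mu> \<in> P2nu \<nu>"
  obtain \<omega>0 where o: "\<omega>0 \<in> \<Omega>" using Omega_ne by blast
  have "F \<mu> x \<omega>0 - I * \<gamma> \<le> F \<mu> x \<omega>" if "\<omega> \<in> \<Omega>" for \<omega>
    using F_lip_w[OF m, of x \<omega>0 \<omega>] mult_left_mono[OF Omega_diam[OF o that] I0] by linarith
  then show ?thesis by blast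
qed

lemma vel_eq: "\<mu> \<in> P2nu \<nu> \<Longrightarrow> \<omega> \<in> \<Omega> \<Longrightarrow> vel \<mu> x \<omega> = F \<mu> x \<omega>"
  unfolding vel_def using pos
  by (intro mcshane_eq[OF Omega_ne Rad(2)] F_lip_w) auto

lemma vel_lip_w: "\<mu> \<in> P2nu \<nu> \<Longrightarrow> \<bar>vel \<mu> x u - vel \<mu> x v\<bar> \<le> I * \<bar>u - v\<bar>"
  unfolding vel_def using F_lower[of \<mu> x] pos mcshane_lipschitz[OF Omega_ne Rad(2), of I _ "\<lambda>\<omega>. F \<mu> x \<omega>" u v]
  by force

lemma vel_lip_x: "\<mu> \<in> P2nu \<nu> \<Longrightarrow> \<bar>vel \<mu> x u - vel \<mu> y u\<bar> \<le> \<kappa> * I * \<bar>x - y\<bar>"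
proof -
  assume m: "\<mu> \<in> P2nu \<nu>"
  obtain a b where "\<And>\<omega>. \<omega> \<in> \<Omega> \<Longrightarrow> a \<le> F \<mu> x \<omega>" "\<And>\<omega>. \<omega> \<in> \<Omega> \<Longrightarrow> b \<le> F \<mu> y \<omega>"
    using F_lower[OF m] by metis
  then show ?thesis
    unfolding vel_def using pos
    by (intro mcshane_nonexpansive[OF Omega_ne Rad(2)] F_lip_x[OF m]) auto
qed

lemma vel_lip_measure:
  assumes m: "\<mu> \<in> P2nu \<nu>" "\<mu>' \<in> P2nu \<nu>"
  shows "\<bar>vel \<mu> x u - vel \<mu>' x u\<bar> \<le> \<kappa> * M * wasserstein 1 \<mu> \<mu>'"
proof -
  obtain a b where "\<And>\<omega>. \<omega> \<in> \<Omega> \<Longrightarrow> a \<le> F \<mu> x \<omega>" "\<And>\<omega>. \<omega> \<in> \<Omega> \<Longrightarrow> b \<le> F \<mu>' x \<omega>"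
    using F_lower[OF m(1)] F_lower[OF m(2)] by metis
  then show ?thesis
    unfolding vel_def using pos A1[OF m]
    by (intro mcshane_nonexpansive[OF Omega_ne Rad(2)]) auto
qed

lemma vel_clamp: "vel \<mu> x (clamp_sym Rad u) = vel \<mu> x u"
  unfolding vel_def by (rule mcshane_clamp[OF Omega_ne Rad(2)]) (use pos in auto)

end

section \<open>Invariance along flows\<close>

context kinetic
begin

lemma Delta_continuous: "continuous_on UNIV \<Delta>"
  using Delta_ode by (meson DERIV_isCont continuous_at_imp_continuous_on)

lemma Delta_extrema: "\<exists>a b. \<forall>s. \<Delta> a \<le> \<Delta> s \<and> \<Delta> s \<le> \<Delta> b"
proof -
  interpret periodic_fun_simple \<Delta> "2 * pi" by standard (rule Delta_periodic)
  have c: "continuous_on {0..2*pi} \<Delta>" using Delta_continuous continuous_on_subset by blast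
  obtain a where a: "\<And>s. s \<in> {0..2*pi} \<Longrightarrow> \<Delta> a \<le> \<Delta> s"
    using continuous_attains_inf[OF compact_Icc _ c] by (metis atLeastAtMost_iff empty_iff order_refl pi_ge_zero mult_nonneg_nonneg zero_le_numeral)
  obtain b where b: "\<And>s. s \<in> {0..2*pi} \<Longrightarrow> \<Delta> s \<le> \<Delta> b"
    using continuous_attains_sup[OF compact_Icc _ c] by (metis atLeastAtMost_iff empty_iff order_refl pi_ge_zero mult_nonneg_nonneg zero_le_numeral)
  have "\<exists>s'\<in>{0..2*pi}. \<Delta> s' = \<Delta> s" for s
  proof -
    define k where "k = \<lfloor>s / (2 * pi)\<rfloor>"
    have "of_int k \<le> s / (2 * pi)" "s / (2 * pi) < of_int k + 1" unfolding k_def by linarith+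
    then have "s - of_int k * (2 * pi) \<in> {0..2*pi}"
      by (auto simp: field_simps)
    moreover have "\<Delta> (s - of_int k * (2 * pi)) = \<Delta> s" by (rule minus_of_int)
    ultimately show ?thesis by blast
  qed
  with a b show ?thesis by metis
qed

definition "D\<^sub>m\<^sub>i\<^sub>n = (SOME d. 0 < d \<and> (\<forall>s. d \<le> \<Delta> s))"
definition "D\<^sub>m\<^sub>a\<^sub>x = (SOME d. d < D \<and> (\<forall>s. \<Delta> s \<le> d))"

lemma Dmin: "0 < D\<^sub>m\<^sub>i\<^sub>n" "D\<^sub>m\<^sub>i\<^sub>n \<le> \<Delta> s"
proof -
  have "\<exists>d. 0 < d \<and> (\<forall>s. d \<le> \<Delta> s)" using Delta_extrema Delta_range by metis
  from someI_ex[OF this] show "0 < D\<^sub>m\<^sub>i\<^sub>n" "D\<^sub>m\<^sub>i\<^sub>n \<le> \<Delta> s" by (auto simp: D\<^sub>m\<^sub>i\<^sub>n_def)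
qed

text \<open>The gap below \<open>D\<close> is uniform because a continuous periodic function attains
  its maximum.\<close>

lemma Dmax: "D\<^sub>m\<^sub>a\<^sub>x < D" "\<Delta> s \<le> D\<^sub>m\<^sub>a\<^sub>x"
proof -
  have "\<exists>d. d < D \<and> (\<forall>s. \<Delta> s \<le> d)" using Delta_extrema Delta_range by metis
  from someI_ex[OF this] show "D\<^sub>m\<^sub>a\<^sub>x < D" "\<Delta> s \<le> D\<^sub>m\<^sub>a\<^sub>x" by (auto simp: D\<^sub>m\<^sub>a\<^sub>x_def)
qed

lemma Dmax_pos: "0 < D\<^sub>m\<^sub>a\<^sub>x" using Dmax(2)[of 0] Delta_range[of 0] by linarith

text \<open>A lower bound for \<open>C\<^sub>1 / r - C\<^sub>1 / D\<close> over all values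
  \<open>r\<close> of \<Delta>: the excess of the relative growth rate of \<Delta> over that of
  particle distances.\<close>

definition "rate = C\<^sub>1 * (1 / D\<^sub>m\<^sub>a\<^sub>x - 1 / D)"
text \<open>The ratio of distance to \<Delta> decays at \<open>rate\<close> and is fed by
  \<open>I\<close> times the frequency difference, divided by \<Delta>. With \<Delta> replaced by
  its lower bound, this is the equilibrium ratio per unit of frequency.\<close>

definition "lip = I / (rate * D\<^sub>m\<^sub>i\<^sub>n)"

lemma rate_pos: "0 < rate"
  unfolding rate_def using C1_pos Dmax(1) Dmax_pos D_pos
  by (intro mult_pos_pos) (auto simp: field_simps)

lemma lip_pos: "0 < lip"
  unfolding lip_def using rate_pos Dmin(1) pos by simp

lemma F_continuous: "\<mu> \<in> P2nu \<nu> \<Longrightarrow> continuous_on UNIV (\<lambda>z. F \<mu> (fst z) (snd z))"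
  using A2_C2[of \<mu>] unfolding C2_fun_def
  by (meson continuous_at_imp_continuous_on has_derivative_continuous)

text \<open>Linear growth suffices for a uniform bound on the particle velocities over bounded
  times, which is what differentiating the centre under the integral requires.\<close>

lemma speed_growth: "\<exists>c. \<forall>s. \<bar>speed s\<bar> \<le> c + \<kappa> * (M + I) * \<bar>s\<bar>"
proof -
  obtain \<omega> where o: "\<omega> \<in> \<Omega>" using Omega_ne by blast
  have "\<bar>speed s\<bar> \<le> (\<bar>F (point_measure_at 0) 0 \<omega>\<bar> + I * \<gamma>) + \<kappa> * (M + I) * \<bar>s\<bar>" for s
  proof -
    have "wasserstein 1 (point_measure_at s) (point_measure_at 0) \<le> \<bar>s\<bar>"
    proof (rule W1_point_measure[OF point_measure_P2nu])
      have "AE z in graph_measure (\<lambda>_. s). \<bar>fst z - 0\<bar> \<le> \<bar>s\<bar>"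
        unfolding graph_measure_def
        by (subst AE_distr_iff) (auto simp: nu_borel intro!: borel_closed closed_Collect_le continuous_intros)
      then show "AE z in point_measure_at s. \<bar>fst z - 0\<bar> \<le> \<bar>s\<bar>" unfolding graph_measure_const .
    qed simp
    then have "\<kappa> * M * wasserstein 1 (point_measure_at s) (point_measure_at 0) \<le> \<kappa> * M * \<bar>s\<bar>"
      using kM by (rule mult_left_mono)
    then have "\<bar>F (point_measure_at s) s \<omega> - F (point_measure_at 0) s \<omega>\<bar> \<le> \<kappa> * M * \<bar>s\<bar>"
      using A1[OF point_measure_P2nu point_measure_P2nu o, of s s 0] by linarith
    moreover have "\<bar>F (point_measure_at 0) s \<omega> - F (point_measure_at 0) 0 \<omega>\<bar> \<le> \<kappa> * I * \<bar>s\<bar>"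
      using F_lip_x[OF point_measure_P2nu, of 0 s \<omega> 0] by simp
    moreover have "\<bar>F (point_measure_at s) s \<omega> - speed s\<bar> \<le> I * \<gamma>"
      using F_lip_w[OF point_measure_P2nu, of s s \<omega> \<omega>c] mult_left_mono[OF Omega_mean[OF o] I0]
      unfolding speed_def by linarith
    moreover have "\<kappa> * (M + I) * \<bar>s\<bar> = \<kappa> * M * \<bar>s\<bar> + \<kappa> * I * \<bar>s\<bar>" by (simp add: algebra_simps)
    ultimately show ?thesis by linarith
  qed
  then show ?thesis by blast
qed

end

text \<open>Common setting for two situations: an arbitrary solution with its characteristics, where
  \<open>P\<close> is the support of the datum, and a moving graph, where \<open>P\<close> is the
  initial graph over \<Omega>. The set \<open>P\<close> has full mass, and the pointwise particle
  estimates are made on it.\<close>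

locale kinetic_flow = kinetic +
  fixes \<mu>0 :: "(real \<times> real) measure" and \<mu> :: "real \<Rightarrow> (real \<times> real) measure"
    and P :: "(real \<times> real) set" and \<Phi> :: "real \<Rightarrow> real \<times> real \<Rightarrow> real"
  assumes mu0: "\<mu>0 \<in> P2nu \<nu>" and mu: "\<And>t. 0 \<le> t \<Longrightarrow> \<mu> t \<in> P2nu \<nu>"
    and P: "\<And>z. z \<in> P \<Longrightarrow> snd z \<in> \<Omega>" and AE_P: "AE z in \<mu>0. z \<in> P"
    and meas: "\<And>t. 0 \<le> t \<Longrightarrow> \<Phi> t \<in> borel_measurable borel"
    and rep: "\<And>t. 0 \<le> t \<Longrightarrow> \<mu> t = distr \<mu>0 borel (\<lambda>z. (\<Phi> t z, snd z))"
    and init: "\<And>z. z \<in> P \<Longrightarrow> \<Phi> 0 z = fst z"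
    and der: "\<And>z t. z \<in> P \<Longrightarrow> 0 \<le> t \<Longrightarrow>
        ((\<lambda>t. \<Phi> t z) has_real_derivative F (\<mu> t) (\<Phi> t z) (snd z)) (at t within {0..})"
    and mu_0: "\<mu> 0 = \<mu>0"
    and diam0: "\<And>z z'. z \<in> P \<Longrightarrow> z' \<in> P \<Longrightarrow> \<bar>fst z - fst z'\<bar> \<le> \<Delta> (xc \<mu>0)"
begin

sublocale mu0: prob_space \<mu>0 by (rule P2nu_prob[OF mu0])

lemma mu0_borel: "borel_measurable \<mu>0 = borel_measurable borel"
  using P2nu_sets[OF mu0] by (auto cong: measurable_cong_sets)

lemma meas_pair: "0 \<le> t \<Longrightarrow> (\<lambda>z. (\<Phi> t z, snd z)) \<in> borel_measurable \<mu>0"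
  using meas by (auto simp: mu0_borel intro!: borel_measurable_Pair)

lemma P_ne: "P \<noteq> {}"
  using AE_P mu0.AE_False by auto

lemma integrable_flow: "0 \<le> t \<Longrightarrow> integrable \<mu>0 (\<Phi> t)"
proof -
  assume t: "0 \<le> t"
  show "integrable \<mu>0 (\<Phi> t)"
    using P2nu_integrable_fst[OF mu[OF t]] unfolding rep[OF t]
    by (subst (asm) integrable_distr_eq[OF meas_pair[OF t]]) auto
qed

lemma xc_eq: "0 \<le> t \<Longrightarrow> xc (\<mu> t) = (\<integral>z. \<Phi> t z \<partial>\<mu>0)"
  unfolding xc_def rep[of t] by (subst integral_distr[OF meas_pair]) auto

lemma AE_mu:
  assumes "0 \<le> t" "\<And>z. z \<in> P \<Longrightarrow> Q (\<Phi> t z, snd z)" "closed {z. Q z}"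
  shows "AE z in \<mu> t. Q z"
  unfolding rep[OF assms(1)]
  by (subst AE_distr_iff[OF meas_pair[OF assms(1)]])
     (use AE_P assms in \<open>auto intro: borel_closed elim!: eventually_mono\<close>)

definition "diam t d \<longleftrightarrow> (\<forall>z\<in>P. \<forall>z'\<in>P. \<bar>\<Phi> t z - \<Phi> t z'\<bar> \<le> d)"

lemma near_center:
  assumes t: "0 \<le> t" and d: "diam t d" and z: "z \<in> P"
  shows "\<bar>\<Phi> t z - xc (\<mu> t)\<bar> \<le> d"
proof -
  have "\<Phi> t z - xc (\<mu> t) = (\<integral>z'. \<Phi> t z - \<Phi> t z' \<partial>\<mu>0)"
    using integrable_flow[OF t] by (simp add: xc_eq[OF t] mu0.prob_space)
  also have "\<bar>\<dots>\<bar> \<le> (\<integral>z'. \<bar>\<Phi> t z - \<Phi> t z'\<bar> \<partial>\<mu>0)" by (rule integral_abs_bound)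
  also have "\<dots> \<le> (\<integral>z'. d \<partial>\<mu>0)"
    using AE_P d z integrable_flow[OF t] unfolding diam_def
    by (intro integral_mono_AE) (auto elim!: eventually_mono)
  finally show ?thesis by (simp add: mu0.prob_space)
qed

lemma W1_center:
  assumes t: "0 \<le> t" and d: "diam t D"
  shows "wasserstein 1 (\<mu> t) (point_measure_at (xc (\<mu> t))) \<le> D"
  by (rule W1_point_measure[OF mu[OF t] _ D0])
     (auto intro!: AE_mu[OF t] closed_Collect_le continuous_intros simp: near_center[OF t d])

definition "V t = (\<integral>z. F (\<mu> t) (\<Phi> t z) (snd z) \<partial>\<mu>0)"

lemma meas_F: "0 \<le> t \<Longrightarrow> (\<lambda>z. F (\<mu> t) (\<Phi> t z) (snd z)) \<in> borel_measurable \<mu>0"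
  using measurable_compose[OF meas_pair[of t] borel_measurable_continuous_onI[OF F_continuous[OF mu[of t]]]] by simp

lemma F_center:
  assumes t: "0 \<le> t" and d: "diam t D" and z: "z \<in> P"
  shows "\<bar>F (\<mu> t) (\<Phi> t z) (snd z) - speed (xc (\<mu> t))\<bar> \<le> \<epsilon>"
  by (rule F_near_speed[OF mu[OF t] W1_center[OF t d] P[OF z] near_center[OF t d z]])

lemma V_center:
  assumes t: "0 \<le> t" and d: "diam t D"
  shows "\<bar>V t - speed (xc (\<mu> t))\<bar> \<le> \<epsilon>"
proof -
  let ?f = "\<lambda>z. F (\<mu> t) (\<Phi> t z) (snd z)"
  have b: "AE z in \<mu>0. \<bar>?f z - speed (xc (\<mu> t))\<bar> \<le> \<epsilon>"
    using AE_P by eventually_elim (rule F_center[OF t d])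
  have i: "integrable \<mu>0 ?f"
  proof (rule mu0.integrable_const_bound[where B="\<epsilon> + \<bar>speed (xc (\<mu> t))\<bar>"])
    show "AE z in \<mu>0. norm (?f z) \<le> \<epsilon> + \<bar>speed (xc (\<mu> t))\<bar>"
      using b
    proof eventually_elim
      case (elim z)
      then show ?case unfolding real_norm_def by linarith
    qed
  qed (rule meas_F[OF t])
  have "V t - speed (xc (\<mu> t)) = (\<integral>z. ?f z - speed (xc (\<mu> t)) \<partial>\<mu>0)"
    using i by (simp add: V_def mu0.prob_space)
  also have "\<bar>\<dots>\<bar> \<le> (\<integral>z. \<bar>?f z - speed (xc (\<mu> t))\<bar> \<partial>\<mu>0)" by (rule integral_abs_bound)
  also have "\<dots> \<le> (\<integral>z. \<epsilon> \<partial>\<mu>0)"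
    using b i by (intro integral_mono_AE) auto
  finally show ?thesis by (simp add: mu0.prob_space)
qed

lemma V_ge: "0 \<le> t \<Longrightarrow> diam t D \<Longrightarrow> A - \<epsilon> \<le> V t"
  using V_center[of t] speed_ge[of "xc (\<mu> t)"] by linarith

lemma flow_continuous: "z \<in> P \<Longrightarrow> continuous_on {0..} (\<lambda>t. \<Phi> t z)"
  using DERIV_continuous_on[of "{0..}" "\<lambda>t. \<Phi> t z" "\<lambda>t. F (\<mu> t) (\<Phi> t z) (snd z)"] der[of z] by simp

lemma xc_deriv:
  assumes ab: "0 \<le> a" and t: "t \<in> {a..b}" and d: "\<And>t. t \<in> {a..b} \<Longrightarrow> diam t D"
  shows "((\<lambda>t. xc (\<mu> t)) has_real_derivative V t) (at t within {a..b})"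
proof -
  obtain z0 where z0: "z0 \<in> P" using P_ne by blast
  have "compact ((\<lambda>t. \<Phi> t z0) ` {a..b})"
    using ab by (intro compact_continuous_image continuous_on_subset[OF flow_continuous[OF z0]]) auto
  \<comment> \<open>One reference particle is bounded on a compact time interval; the diameter bound
    then controls the centre, and through it the velocities of all particles.\<close>
  then obtain B where B: "\<And>t. t \<in> {a..b} \<Longrightarrow> \<bar>\<Phi> t z0\<bar> \<le> B"
    by (force dest!: compact_imp_bounded simp: bounded_iff)
  obtain c where c: "\<And>s. \<bar>speed s\<bar> \<le> c + \<kappa> * (M + I) * \<bar>s\<bar>" using speed_growth by blast
  have bd: "\<bar>F (\<mu> r) (\<Phi> r z) (snd z)\<bar> \<le> \<epsilon> + (c + \<kappa> * (M + I) * (B + D))" if r: "r \<in> {a..b}" and z: "z \<in> P" for r z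
  proof -
    have r0: "0 \<le> r" using r ab by simp
    have "\<bar>xc (\<mu> r)\<bar> \<le> B + D" using near_center[OF r0 d[OF r] z0] B[OF r] by linarith
    then have "\<kappa> * (M + I) * \<bar>xc (\<mu> r)\<bar> \<le> \<kappa> * (M + I) * (B + D)"
      using pos by (intro mult_left_mono) auto
    then show ?thesis using F_center[OF r0 d[OF r] z] c[of "xc (\<mu> r)"] by linarith
  qed
  have "((\<lambda>r. \<integral>z. \<Phi> r z \<partial>\<mu>0) has_real_derivative (\<integral>z. F (\<mu> t) (\<Phi> t z) (snd z) \<partial>\<mu>0)) (at t within {a..b})"
  proof (rule has_real_derivative_integral_dominated[OF mu0.finite_measure_axioms t,
      where f' = "\<lambda>t z. F (\<mu> t) (\<Phi> t z) (snd z)"])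
    show "AE z in \<mu>0. \<forall>r\<in>{a..b}. ((\<lambda>r. \<Phi> r z) has_real_derivative F (\<mu> r) (\<Phi> r z) (snd z)) (at r within {a..b}) \<and>
       \<bar>F (\<mu> r) (\<Phi> r z) (snd z)\<bar> \<le> \<epsilon> + (c + \<kappa> * (M + I) * (B + D))"
      using AE_P
    proof eventually_elim
      case (elim z)
      show ?case
      proof
        fix r assume r: "r \<in> {a..b}"
        have "((\<lambda>r. \<Phi> r z) has_real_derivative F (\<mu> r) (\<Phi> r z) (snd z)) (at r within {a..b})"
          by (rule DERIV_subset[OF der[OF elim]]) (use r ab in auto)
        with bd[OF r elim] show "((\<lambda>r. \<Phi> r z) has_real_derivative F (\<mu> r) (\<Phi> r z) (snd z)) (at r within {a..b}) \<and>
           \<bar>F (\<mu> r) (\<Phi> r z) (snd z)\<bar> \<le> \<epsilon> + (c + \<kappa> * (M + I) * (B + D))" by simp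
      qed
    qed
  qed (use ab t in \<open>auto intro!: integrable_flow meas_F\<close>)
  then have "((\<lambda>r. \<integral>z. \<Phi> r z \<partial>\<mu>0) has_real_derivative V t) (at t within {a..b})" by (simp only: V_def)
  then show ?thesis
    unfolding has_field_derivative_def
    by (rule has_derivative_transform[rotated 2]) (use t ab xc_eq in auto)
qed

definition "r t = \<Delta> (xc (\<mu> t))"

lemma r_bounds: "0 < r t" "r t < D" "r t \<le> D\<^sub>m\<^sub>a\<^sub>x" "D\<^sub>m\<^sub>i\<^sub>n \<le> r t"
  using Delta_range Dmax Dmin by (auto simp: r_def)

definition "r' t = V t * (C\<^sub>2 + slope (xc (\<mu> t)) / speed (xc (\<mu> t)) * r t)"

lemma r_deriv:
  assumes "0 \<le> a" "t \<in> {a..b}" "\<And>t. t \<in> {a..b} \<Longrightarrow> diam t D"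
  shows "(r has_real_derivative r' t) (at t within {a..b})"
proof -
  have "((\<lambda>t. \<Delta> (xc (\<mu> t))) has_real_derivative
      (C\<^sub>2 + slope (xc (\<mu> t)) / speed (xc (\<mu> t)) * \<Delta> (xc (\<mu> t))) * V t) (at t within {a..b})"
    by (rule DERIV_chain2[OF _ xc_deriv[OF assms]])
       (use Delta_ode[of "xc (\<mu> t)"] in \<open>simp add: slope_def speed_def point_measure_at_def\<close>)
  then show ?thesis by (simp add: r_def[abs_def] r'_def mult.commute)
qed

lemma r'_ge: "0 \<le> t \<Longrightarrow> diam t D \<Longrightarrow> C\<^sub>1 + slope (xc (\<mu> t)) * r t \<le> r' t"
  unfolding r'_def using r_bounds[of t] by (intro Delta_growth V_center) auto

lemma flow_deriv: "z \<in> P \<Longrightarrow> 0 \<le> a \<Longrightarrow> t \<in> {a..b} \<Longrightarrow>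
    ((\<lambda>t. \<Phi> t z) has_real_derivative F (\<mu> t) (\<Phi> t z) (snd z)) (at t within {a..b})"
  by (rule DERIV_subset[OF der]) auto

lemma diff_deriv: "z \<in> P \<Longrightarrow> z' \<in> P \<Longrightarrow> 0 \<le> a \<Longrightarrow> t \<in> {a..b} \<Longrightarrow>
    ((\<lambda>t. \<Phi> t z - \<Phi> t z') has_real_derivative
       F (\<mu> t) (\<Phi> t z) (snd z) - F (\<mu> t) (\<Phi> t z') (snd z')) (at t within {a..b})"
  by (intro DERIV_diff flow_deriv)

text \<open>Wherever a distance exceeds \<open>r\<close>, the pair estimate and the growth of
  \<open>r\<close> make their difference grow at most at the rate \<open>\<kappa> * I\<close>,
  because both contain the same \<open>C\<^sub>1\<close> and the same slope. Both need the diameter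
  to be at most \<open>D\<close> beforehand.\<close>

lemma diam_step:
  assumes a: "0 \<le> a" and d: "\<And>t. t \<in> {a..b} \<Longrightarrow> diam t D" and i: "diam a (r a)" and t: "t \<in> {a..b}"
  shows "diam t (r t)"
proof -
  have le: "\<Phi> t z - \<Phi> t z' \<le> r t" if z: "z \<in> P" "z' \<in> P" for z z'
  proof (rule diff_ineq_le[where a=a and L="\<kappa> * I" and z=r and z'=r' and p="\<lambda>t. \<Phi> t z - \<Phi> t z'"
        and p'="\<lambda>t. F (\<mu> t) (\<Phi> t z) (snd z) - F (\<mu> t) (\<Phi> t z') (snd z')"])
    show "a \<le> t" using t by simp
    fix u assume u: "u \<in> {a..t}"
    have u': "u \<in> {a..b}" "0 \<le> u" using u t a by auto
    show "((\<lambda>t. \<Phi> t z - \<Phi> t z') has_real_derivative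
        F (\<mu> u) (\<Phi> u z) (snd z) - F (\<mu> u) (\<Phi> u z') (snd z')) (at u within {a..t})"
      by (rule diff_deriv[OF z a u])
    show "(r has_real_derivative r' u) (at u within {a..t})"
      by (rule r_deriv[OF a u]) (use d t in auto)
    let ?p = "\<Phi> u z - \<Phi> u z'" and ?s = "slope (xc (\<mu> u))"
    assume g: "r u < ?p"
    have du: "diam u D" by (rule d[OF u'(1)])
    have "F (\<mu> u) (\<Phi> u z) (snd z) - F (\<mu> u) (\<Phi> u z') (snd z') \<le> ?s * ?p + C\<^sub>1"
      by (rule F_diff_pair[OF mu[OF u'(2)] W1_center[OF u'(2) du] P[OF z(1)] P[OF z(2)]])
         (use near_center[OF u'(2) du] z du in \<open>auto simp: diam_def\<close>)
    moreover have "?s * (?p - r u) \<le> \<kappa> * I * (?p - r u)"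
      using slope_bound[of "xc (\<mu> u)"] g by (intro mult_right_mono) auto
    ultimately show "F (\<mu> u) (\<Phi> u z) (snd z) - F (\<mu> u) (\<Phi> u z') (snd z') - r' u \<le> \<kappa> * I * (?p - r u)"
      using r'_ge[OF u'(2) du] unfolding right_diff_distrib by linarith
  next
    show "\<Phi> a z - \<Phi> a z' \<le> r a" using i z by (auto simp: diam_def abs_le_iff)
  qed
  then show ?thesis unfolding diam_def using le by (auto simp: abs_le_iff)
qed

text \<open>Time in which a diameter starting at \<open>D\<^sub>m\<^sub>a\<^sub>x\<close> can reach
  \<open>D\<close> at the crude rate \<open>\<kappa> * I * D + I * \<gamma>\<close>, valid as long
  as it is below \<open>D\<close>. It does not depend on the starting time.\<close>

definition "h = (D - D\<^sub>m\<^sub>a\<^sub>x) / (\<kappa> * I * D + I * \<gamma>)"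

lemma h_denom: "0 < \<kappa> * I * D + I * \<gamma>"
  using pos D_pos gamma_nonneg by (intro add_pos_nonneg mult_pos_pos mult_nonneg_nonneg) auto

lemma h_pos: "0 < h"
  unfolding h_def using h_denom Dmax(1) by simp

lemma diam_short_time:
  assumes a: "0 \<le> a" and i: "diam a D\<^sub>m\<^sub>a\<^sub>x" and t: "t \<in> {a..a + h}"
  shows "diam t D"
proof -
  let ?c = "\<kappa> * I * D + I * \<gamma>"
  have ch: "?c * h = D - D\<^sub>m\<^sub>a\<^sub>x" using h_denom by (simp add: h_def)
  have cle: "D\<^sub>m\<^sub>a\<^sub>x + ?c * (u - a) \<le> D" if "u \<in> {a..t}" for u
  proof -
    have "?c * (u - a) \<le> ?c * h" using that t h_denom by (intro mult_left_mono) auto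
    then show ?thesis using ch by linarith
  qed
  have le: "\<Phi> t z - \<Phi> t z' \<le> D\<^sub>m\<^sub>a\<^sub>x + ?c * (t - a)" if z: "z \<in> P" "z' \<in> P" for z z'
  proof (rule diff_ineq_le[where a=a and L="\<kappa> * I" and z="\<lambda>t. D\<^sub>m\<^sub>a\<^sub>x + ?c * (t - a)" and z'="\<lambda>_. ?c" and p="\<lambda>t. \<Phi> t z - \<Phi> t z'"
        and p'="\<lambda>t. F (\<mu> t) (\<Phi> t z) (snd z) - F (\<mu> t) (\<Phi> t z') (snd z')"])
    show "a \<le> t" using t by simp
    fix u assume u: "u \<in> {a..t}"
    have u0: "0 \<le> u" using u a by simp
    show "((\<lambda>t. \<Phi> t z - \<Phi> t z') has_real_derivative
        F (\<mu> u) (\<Phi> u z) (snd z) - F (\<mu> u) (\<Phi> u z') (snd z')) (at u within {a..t})"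
      by (rule diff_deriv[OF z a u])
    show "((\<lambda>t. D\<^sub>m\<^sub>a\<^sub>x + ?c * (t - a)) has_real_derivative ?c) (at u within {a..t})"
      by (auto intro!: derivative_eq_intros)
    let ?p = "\<Phi> u z - \<Phi> u z'"
    assume g: "D\<^sub>m\<^sub>a\<^sub>x + ?c * (u - a) < ?p"
    have "?c * (u - a) \<ge> 0" using u h_denom by simp
    then have p0: "?p > 0" using g Dmax_pos by linarith
    have "F (\<mu> u) (\<Phi> u z) (snd z) - F (\<mu> u) (\<Phi> u z') (snd z) \<le> \<kappa> * I * ?p"
      using F_lip_x[OF mu[OF u0], of "\<Phi> u z" "snd z" "\<Phi> u z'"] p0 by simp
    moreover have "F (\<mu> u) (\<Phi> u z') (snd z) - F (\<mu> u) (\<Phi> u z') (snd z') \<le> I * \<gamma>"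
      using F_lip_w[OF mu[OF u0], of "\<Phi> u z'" "snd z" "snd z'"]
        mult_left_mono[OF Omega_diam[OF P[OF z(1)] P[OF z(2)]] I0] by linarith
    moreover have "\<kappa> * I * (D\<^sub>m\<^sub>a\<^sub>x + ?c * (u - a)) \<le> \<kappa> * I * D"
      using cle[OF u] kI by (rule mult_left_mono)
    ultimately show "F (\<mu> u) (\<Phi> u z) (snd z) - F (\<mu> u) (\<Phi> u z') (snd z') - ?c \<le> \<kappa> * I * (?p - (D\<^sub>m\<^sub>a\<^sub>x + ?c * (u - a)))"
      unfolding right_diff_distrib by linarith
  next
    show "\<Phi> a z - \<Phi> a z' \<le> D\<^sub>m\<^sub>a\<^sub>x + ?c * (a - a)" using i z by (auto simp: diam_def abs_le_iff)
  qed
  have "D\<^sub>m\<^sub>a\<^sub>x + ?c * (t - a) \<le> D" using cle[of t] t by simp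
  then show ?thesis unfolding diam_def using le by (force simp: abs_le_iff)
qed

text \<open>Continuation with constant steps \<open>h\<close>: the crude bound keeps the diameter
  below \<open>D\<close> during a step, the sharp bound then returns it to at most \<open>r\<close>,
  hence to at most \<open>D\<^sub>m\<^sub>a\<^sub>x\<close>, and the next step can begin.\<close>

theorem diam_invariant: "0 \<le> t \<Longrightarrow> diam t (r t)"
proof -
  have "\<forall>t\<in>{0..real n * h}. diam t (r t)" for n
  proof (induction n)
    case 0
    show ?case using diam0 init by (simp add: diam_def r_def mu_0)
  next
    case (Suc n)
    have a: "0 \<le> real n * h" using h_pos by simp
    have i: "diam (real n * h) (r (real n * h))" using Suc a by auto
    then have im: "diam (real n * h) D\<^sub>m\<^sub>a\<^sub>x" using r_bounds(3)[of "real n * h"] by (force simp: diam_def)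
    have "diam t (r t)" if "t \<in> {real n * h..real n * h + h}" for t
      by (rule diam_step[OF a diam_short_time[OF a im] i that])
    then show ?case using Suc by (auto simp: algebra_simps)
  qed
  moreover obtain n :: nat where "t < real n * h" using reals_Archimedean3[OF h_pos] by blast
  moreover assume "0 \<le> t"
  ultimately show ?thesis by (meson atLeastAtMost_iff less_imp_le)
qed

lemma diam_D: "0 \<le> t \<Longrightarrow> diam t D"
  using diam_invariant[of t] r_bounds(2)[of t] by (force simp: diam_def)

text \<open>The bound is \<open>r t\<close> times a convex combination of the initial ratio and the
  equilibrium ratio. This form passes to squares by convexity, which later gives the quadratic
  Wasserstein estimate.\<close>

theorem lipschitz_invariant:
  assumes t: "0 \<le> t" and z: "z \<in> P" "z' \<in> P"
  shows "\<bar>\<Phi> t z - \<Phi> t z'\<bar> \<le> r t * (exp (- rate * t) * (\<bar>fst z - fst z'\<bar> / r 0) + (1 - exp (- rate * t)) * (lip * \<bar>snd z - snd z'\<bar>))"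
proof -
  define q where "q = \<bar>fst z - fst z'\<bar> / r 0"
  define w where "w = lip * \<bar>snd z - snd z'\<bar>"
  have q0: "0 \<le> q" using r_bounds[of 0] by (simp add: q_def)
  have w0: "0 \<le> w" using lip_pos by (simp add: w_def)
  \<comment> \<open>The solution of \<open>g' = rate * (w - g)\<close> with \<open>g 0 = q\<close>;
    the product of \<open>r\<close> and \<open>g\<close> is the supersolution compared with the
    distance.\<close>
  define g where "g u = exp (- rate * u) * q + (1 - exp (- rate * u)) * w" for u
  have g0: "0 \<le> g u" if "0 \<le> u" for u
    unfolding g_def using that rate_pos q0 w0 by (intro add_nonneg_nonneg mult_nonneg_nonneg) auto
  define g' where "g' u = rate * (w - g u)" for u
  have gd: "(g has_real_derivative g' u) (at u within S)" for u S
    unfolding g_def[abs_def] g'_def by (auto intro!: derivative_eq_intros simp: g_def algebra_simps)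
  \<comment> \<open>Treated for both orderings of the two particles, because the linear estimate
    needs the particle with the larger position first.\<close>
  have le: "\<Phi> t a - \<Phi> t b \<le> r t * g t" if ab: "{a, b} = {z, z'}" for a b
  proof (rule diff_ineq_le[where a=0 and L="\<kappa> * I + C\<^sub>1 / D" and z="\<lambda>t. r t * g t" and z'="\<lambda>u. r' u * g u + g' u * r u" and p="\<lambda>t. \<Phi> t a - \<Phi> t b"
        and p'="\<lambda>t. F (\<mu> t) (\<Phi> t a) (snd a) - F (\<mu> t) (\<Phi> t b) (snd b)"])
    have abP: "a \<in> P" "b \<in> P" using ab z by auto
    have dab: "\<bar>snd a - snd b\<bar> = \<bar>snd z - snd z'\<bar>" "\<bar>fst a - fst b\<bar> = \<bar>fst z - fst z'\<bar>"
      using ab by (auto simp: doubleton_eq_iff abs_minus_commute)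
    show "0 \<le> t" by fact
    fix u assume u: "u \<in> {0..t}"
    have u0: "0 \<le> u" using u by simp
    show "((\<lambda>t. \<Phi> t a - \<Phi> t b) has_real_derivative
        F (\<mu> u) (\<Phi> u a) (snd a) - F (\<mu> u) (\<Phi> u b) (snd b)) (at u within {0..t})"
      by (rule diff_deriv[OF abP _ u]) simp
    show "((\<lambda>t. r t * g t) has_real_derivative r' u * g u + g' u * r u) (at u within {0..t})"
      by (rule DERIV_mult[OF r_deriv[OF _ u] gd]) (auto intro: diam_D)
    let ?p = "\<Phi> u a - \<Phi> u b" and ?s = "slope (xc (\<mu> u))"
    assume gt: "r u * g u < ?p"
    have z0: "0 \<le> r u * g u" using r_bounds(1)[of u] g0[OF u0] by simp
    have du: "diam u D" by (rule diam_D[OF u0])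
    have 1: "F (\<mu> u) (\<Phi> u a) (snd a) - F (\<mu> u) (\<Phi> u b) (snd b) \<le> (?s + C\<^sub>1 / D) * ?p + I * \<bar>snd z - snd z'\<bar>"
      unfolding dab(1)[symmetric]
      by (rule F_diff_linear[OF mu[OF u0] W1_center[OF u0 du] P[OF abP(1)]])
         (use near_center[OF u0 du] abP gt z0 in auto)
    have 2: "(C\<^sub>1 + ?s * r u) * g u \<le> r' u * g u"
      by (rule mult_right_mono[OF r'_ge[OF u0 du] g0[OF u0]])
    have 3: "I * \<bar>snd z - snd z'\<bar> \<le> r u * rate * w"
    proof -
      have "I * \<bar>snd z - snd z'\<bar> = D\<^sub>m\<^sub>i\<^sub>n * (rate * w)"
        unfolding w_def lip_def using rate_pos Dmin(1) by simp
      also have "\<dots> \<le> r u * (rate * w)"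
        using r_bounds(4)[of u] rate_pos w0 by (intro mult_right_mono) auto
      finally show ?thesis by simp
    qed
    \<comment> \<open>The gain over the linear part: \<Delta> grows at least by
      \<open>C\<^sub>1\<close>, whereas the distance estimate uses only
      \<open>C\<^sub>1 / D * r u\<close>.\<close>
    have 4: "r u * rate * g u \<le> (C\<^sub>1 - C\<^sub>1 / D * r u) * g u"
    proof (rule mult_right_mono[OF _ g0[OF u0]])
      have "rate \<le> C\<^sub>1 * (1 / r u - 1 / D)"
        unfolding rate_def using r_bounds[of u] Dmax_pos C1_pos
        by (intro mult_left_mono diff_right_mono divide_left_mono) auto
      then have "r u * rate \<le> r u * (C\<^sub>1 * (1 / r u - 1 / D))"
        using r_bounds(1)[of u] by (intro mult_left_mono) auto
      also have "\<dots> = C\<^sub>1 - C\<^sub>1 / D * r u" using r_bounds(1)[of u] D_pos by (simp add: field_simps)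
      finally show "r u * rate \<le> C\<^sub>1 - C\<^sub>1 / D * r u" .
    qed
    have 5: "(?s + C\<^sub>1 / D) * (?p - r u * g u) \<le> (\<kappa> * I + C\<^sub>1 / D) * (?p - r u * g u)"
      using slope_bound[of "xc (\<mu> u)"] gt by (intro mult_right_mono) auto
    have "g' u * r u = r u * rate * w - r u * rate * g u" by (simp add: g'_def algebra_simps)
    moreover have "(?s + C\<^sub>1 / D) * ?p - (?s + C\<^sub>1 / D) * (?p - r u * g u) = (C\<^sub>1 + ?s * r u) * g u - (C\<^sub>1 - C\<^sub>1 / D * r u) * g u"
    proof -
      have "(x + c) * p - (x + c) * (p - R * G) = (C + x * R) * G - (C - c * R) * G" for x c p R G C :: real
        by (simp add: algebra_simps)
      then show ?thesis .
    qed
    ultimately show "F (\<mu> u) (\<Phi> u a) (snd a) - F (\<mu> u) (\<Phi> u b) (snd b) - (r' u * g u + g' u * r u)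
        \<le> (\<kappa> * I + C\<^sub>1 / D) * (?p - r u * g u)"
      using 1 2 3 4 5 by linarith
  next
    have "a \<in> P" "b \<in> P" "\<bar>fst a - fst b\<bar> = \<bar>fst z - fst z'\<bar>"
      using ab z by (auto simp: doubleton_eq_iff abs_minus_commute)
    then show "\<Phi> 0 a - \<Phi> 0 b \<le> r 0 * g 0"
      using init r_bounds(1)[of 0] by (simp add: g_def q_def)
  qed
  have "\<bar>\<Phi> t z - \<Phi> t z'\<bar> \<le> r t * g t" using le[of z z'] le[of z' z] by (simp add: abs_le_iff insert_commute)
  then show ?thesis by (simp only: g_def q_def w_def)
qed

text \<open>The diameter bound is now available at all times, so the centre drifts at least at the
  speed \<open>A - \<epsilon>\<close>. This makes the passage time finite, unique and
  stable.\<close>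

lemma xc_increase:
  assumes "0 \<le> s" "s \<le> t"
  shows "xc (\<mu> s) + (A - \<epsilon>) * (t - s) \<le> xc (\<mu> t)"
proof -
  show ?thesis
  proof (rule diff_ineq_le[where a=s and L=0 and p'="\<lambda>_. A - \<epsilon>" and z'=V
        and p="\<lambda>t. xc (\<mu> s) + (A - \<epsilon>) * (t - s)" and z="\<lambda>t. xc (\<mu> t)"])
    fix u assume u: "u \<in> {s..t}"
    show "((\<lambda>t. xc (\<mu> s) + (A - \<epsilon>) * (t - s)) has_real_derivative A - \<epsilon>) (at u within {s..t})"
      by (auto intro!: derivative_eq_intros)
    show "((\<lambda>t. xc (\<mu> t)) has_real_derivative V u) (at u within {s..t})"
      by (rule xc_deriv[OF assms(1) u]) (use assms in \<open>auto intro: diam_D\<close>)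
    show "A - \<epsilon> - V u \<le> 0 * (xc (\<mu> s) + (A - \<epsilon>) * (u - s) - xc (\<mu> u))"
      using V_ge[OF _ diam_D, of u] u assms by auto
  qed (use assms in auto)
qed

lemma xc_continuous: "continuous_on {0..b} (\<lambda>t. xc (\<mu> t))"
  by (rule DERIV_continuous_on[where D=V]) (auto intro!: xc_deriv diam_D)

end

section \<open>Solutions are transported by characteristics\<close>

locale kinetic_solution = kinetic +
  fixes \<mu>0 :: "(real \<times> real) measure" and \<mu> :: "real \<Rightarrow> (real \<times> real) measure"
  assumes sol: "mv_solution F \<nu> \<mu>0 \<mu>"
begin

lemma mu: "0 \<le> t \<Longrightarrow> \<mu> t \<in> P2nu \<nu>" and mu_0: "\<mu> 0 = \<mu>0"
  using sol by (auto simp: mv_solution_def)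

lemma mu0: "\<mu>0 \<in> P2nu \<nu>" using mu[of 0] mu_0 by simp

lemma W1_continuous:
  assumes t: "0 \<le> t"
  shows "((\<lambda>s. wasserstein 1 (\<mu> s) (\<mu> t)) \<longlongrightarrow> 0) (at t within {0..})"
proof (rule Lim_null_comparison)
  show "((\<lambda>s. wasserstein 2 (\<mu> s) (\<mu> t)) \<longlongrightarrow> 0) (at t within {0..})"
    using sol t by (auto simp: mv_solution_def)
  have "wasserstein 1 (\<mu> s) (\<mu> t) \<le> wasserstein 2 (\<mu> s) (\<mu> t)" if "0 \<le> s" for s
    by (rule wasserstein_1_le_2[OF wcost_2_finite[OF P2nu_P2[OF mu[OF that]] P2nu_P2[OF mu[OF t]]]])
  then show "\<forall>\<^sub>F s in at t within {0..}. norm (wasserstein 1 (\<mu> s) (\<mu> t)) \<le> wasserstein 2 (\<mu> s) (\<mu> t)"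
    by (auto simp: eventually_at_filter wasserstein_def[of 1])
qed

lemma vel_time_continuous: "continuous_on {0..} (\<lambda>t. vel (\<mu> t) x u)"
  unfolding continuous_on_def
proof
  fix t :: real assume "t \<in> {0..}"
  then have t: "0 \<le> t" by simp
  have "((\<lambda>s. \<kappa> * M * wasserstein 1 (\<mu> s) (\<mu> t)) \<longlongrightarrow> \<kappa> * M * 0) (at t within {0..})"
    by (intro tendsto_intros W1_continuous t)
  then have z: "((\<lambda>s. \<kappa> * M * wasserstein 1 (\<mu> s) (\<mu> t)) \<longlongrightarrow> 0) (at t within {0..})" by simp
  have "((\<lambda>s. vel (\<mu> s) x u - vel (\<mu> t) x u) \<longlongrightarrow> 0) (at t within {0..})"
    by (rule Lim_null_comparison[OF _ z])
       (use vel_lip_measure[OF mu mu[OF t]] in \<open>auto simp: eventually_at_filter\<close>)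
  then show "((\<lambda>s. vel (\<mu> s) x u) \<longlongrightarrow> vel (\<mu> t) x u) (at t within {0..})"
    by (simp add: LIM_zero_iff)
qed

lemma charac_ex: "\<exists>y. y 0 = x \<and> (\<forall>t\<ge>0. (y has_real_derivative vel (\<mu> t) (y t) u) (at t within {0..}))"
  using picard_lindelof_global[of "\<kappa> * I" "\<lambda>t x. vel (\<mu> t) x u" x, OF kI _ vel_time_continuous]
    vel_lip_x[OF mu] by (simp add: has_real_derivative_iff_has_vector_derivative)

text \<open>Driven by the extended velocity, the characteristic exists from every point of the
  plane, and the flow map is continuous on the whole plane; its images of measures are then Borel
  without further argument.\<close>

definition charac :: "real \<Rightarrow> real \<Rightarrow> real \<Rightarrow> real" where
  "charac x u = (SOME y. y 0 = x \<and> (\<forall>t\<ge>0. (y has_real_derivative vel (\<mu> t) (y t) u) (at t within {0..})))"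

lemma charac_0: "charac x u 0 = x"
  and charac_deriv: "0 \<le> t \<Longrightarrow> (charac x u has_real_derivative vel (\<mu> t) (charac x u t) u) (at t within {0..})"
  using someI_ex[OF charac_ex[of x u]] by (simp_all add: charac_def)

lemma charac_continuous: "continuous_on {0..} (charac x u)"
  by (rule DERIV_continuous_on[OF charac_deriv]) simp

lemma vel_charac_continuous: "continuous_on {0..} (\<lambda>t. vel (\<mu> t) (charac x u t) u)"
  unfolding continuous_on_def
proof
  fix t :: real assume t: "t \<in> {0..}"
  have 1: "((\<lambda>s. vel (\<mu> s) (charac x u t) u) \<longlongrightarrow> vel (\<mu> t) (charac x u t) u) (at t within {0..})"
    using vel_time_continuous t by (auto simp: continuous_on_def)
  have "((\<lambda>s. \<kappa> * I * \<bar>charac x u s - charac x u t\<bar>) \<longlongrightarrow> \<kappa> * I * \<bar>charac x u t - charac x u t\<bar>) (at t within {0..})"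
    using charac_continuous[of x u] t by (intro tendsto_intros) (auto simp: continuous_on_def)
  then have z: "((\<lambda>s. \<kappa> * I * \<bar>charac x u s - charac x u t\<bar>) \<longlongrightarrow> 0) (at t within {0..})" by simp
  have "((\<lambda>s. vel (\<mu> s) (charac x u s) u - vel (\<mu> s) (charac x u t) u) \<longlongrightarrow> 0) (at t within {0..})"
    by (rule Lim_null_comparison[OF _ z]) (use vel_lip_x[OF mu] in \<open>auto simp: eventually_at_filter\<close>)
  from tendsto_add[OF this 1] show "((\<lambda>s. vel (\<mu> s) (charac x u s) u) \<longlongrightarrow> vel (\<mu> t) (charac x u t) u) (at t within {0..})"
    by simp
qed

text \<open>The frequency difference contributes \<open>I * \<bar>u - w\<bar>\<close> to the
  velocity difference. It is dominated by \<open>I\<close> times the supersolution itself, which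
  explains the extra \<open>I\<close> in the exponent.\<close>

lemma charac_lipschitz:
  assumes t: "0 \<le> t"
  shows "\<bar>charac x u t - charac y w t\<bar> \<le> exp ((\<kappa> * I + I) * t) * (\<bar>x - y\<bar> + \<bar>u - w\<bar>)"
proof -
  let ?l = "\<kappa> * I + I"
  have le: "charac x u t - charac y w t \<le> exp (?l * t) * (\<bar>x - y\<bar> + \<bar>u - w\<bar>)" for x u y w
  proof (rule diff_ineq_le[where a=0 and L="\<kappa> * I" and p="\<lambda>t. charac x u t - charac y w t"
        and p'="\<lambda>t. vel (\<mu> t) (charac x u t) u - vel (\<mu> t) (charac y w t) w"
        and z="\<lambda>t. exp (?l * t) * (\<bar>x - y\<bar> + \<bar>u - w\<bar>)" and z'="\<lambda>t. ?l * (exp (?l * t) * (\<bar>x - y\<bar> + \<bar>u - w\<bar>))"])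
    fix s assume s: "s \<in> {0..t}"
    show "((\<lambda>t. charac x u t - charac y w t) has_real_derivative vel (\<mu> s) (charac x u s) u - vel (\<mu> s) (charac y w s) w) (at s within {0..t})"
      using s by (intro DERIV_diff DERIV_subset[OF charac_deriv]) auto
    show "((\<lambda>t. exp (?l * t) * (\<bar>x - y\<bar> + \<bar>u - w\<bar>)) has_real_derivative ?l * (exp (?l * s) * (\<bar>x - y\<bar> + \<bar>u - w\<bar>))) (at s within {0..t})"
      by (auto intro!: derivative_eq_intros)
    let ?z = "exp (?l * s) * (\<bar>x - y\<bar> + \<bar>u - w\<bar>)"
    assume g: "?z < charac x u s - charac y w s"
    have "1 * \<bar>u - w\<bar> \<le> ?z"
      using s kI I0 by (intro mult_mono) auto
    then have "I * \<bar>u - w\<bar> \<le> I * ?z" using I0 by (simp add: mult_left_mono)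
    moreover have "0 \<le> charac x u s - charac y w s"
      by (rule order_trans[OF _ less_imp_le[OF g]]) simp
    then have "vel (\<mu> s) (charac x u s) u - vel (\<mu> s) (charac y w s) u \<le> \<kappa> * I * (charac x u s - charac y w s)"
      using vel_lip_x[OF mu, of s "charac x u s" u "charac y w s"] s by simp
    moreover have "vel (\<mu> s) (charac y w s) u - vel (\<mu> s) (charac y w s) w \<le> I * \<bar>u - w\<bar>"
      using vel_lip_w[OF mu, of s "charac y w s" u w] s by (simp add: abs_le_iff)
    moreover have "\<kappa> * I * (charac x u s - charac y w s - ?z) = \<kappa> * I * (charac x u s - charac y w s) - \<kappa> * I * ?z"
      by (rule right_diff_distrib)
    moreover have "?l * ?z = \<kappa> * I * ?z + I * ?z" by (rule distrib_right)
    ultimately show "vel (\<mu> s) (charac x u s) u - vel (\<mu> s) (charac y w s) w - ?l * ?z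
        \<le> \<kappa> * I * (charac x u s - charac y w s - ?z)" by linarith
  qed (use t charac_0 in auto)
  show ?thesis using le[of x u y w] le[of y w x u] by (simp add: abs_le_iff abs_minus_commute)
qed

lemma charac_continuous_space:
  assumes t: "0 \<le> t"
  shows "continuous_on UNIV (\<lambda>z. charac (fst z) (snd z) t)"
proof (rule continuous_at_imp_continuous_on, rule ballI)
  fix z :: "real \<times> real"
  have "((\<lambda>z'. exp ((\<kappa> * I + I) * t) * (\<bar>fst z' - fst z\<bar> + \<bar>snd z' - snd z\<bar>)) \<longlongrightarrow>
     exp ((\<kappa> * I + I) * t) * (\<bar>fst z - fst z\<bar> + \<bar>snd z - snd z\<bar>)) (at z)"
    by (intro tendsto_intros)
  then have "((\<lambda>z'. exp ((\<kappa> * I + I) * t) * (\<bar>fst z' - fst z\<bar> + \<bar>snd z' - snd z\<bar>)) \<longlongrightarrow> 0) (at z)" by simp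
  then have "((\<lambda>z'. charac (fst z') (snd z') t - charac (fst z) (snd z) t) \<longlongrightarrow> 0) (at z)"
    by (rule Lim_null_comparison[rotated]) (use charac_lipschitz[OF t] in auto)
  then show "isCont (\<lambda>z. charac (fst z) (snd z) t) z" by (simp add: isCont_def LIM_zero_iff)
qed

text \<open>A bump moving slightly faster than the characteristics through its edges absorbs mass, so
  the mass it carries can only increase.\<close>

lemma barrier:
  assumes T: "0 \<le> T" and e: "0 < e"
    and \<psi>: "C1_fun (\<lambda>z::real \<times> real \<times> real. \<psi> (snd (snd z)))" "\<And>w. 0 \<le> \<psi> w" "\<And>w. \<psi> w \<le> 1"
      "\<And>w. e < \<bar>w - u0\<bar> \<Longrightarrow> \<psi> w = 0"
  defines "E \<equiv> e * exp ((2 * (\<kappa> * I) + I) * T)"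
  shows "(\<integral>z. \<psi> (snd z) * indicat_real {z. z0 \<le> fst z \<and> fst z \<le> y0} z \<partial>\<mu>0)
    \<le> (\<integral>z. \<psi> (snd z) * indicat_real {z. charac z0 u0 T - E - e \<le> fst z \<and> fst z \<le> charac y0 u0 T + E + e} z \<partial>\<mu> T)"
proof -
  \<comment> \<open>The exponent makes the edges outrun the particles. A particle in an edge layer
    is at most \<open>e * (1 + exp (l * s))\<close> from the central characteristic and at most
    \<open>e\<close> from its frequency, so its velocity differs by at most
    \<open>e * l * exp (l * s)\<close>, which is the additional speed of the edge.\<close>
  let ?l = "2 * (\<kappa> * I) + I"
  define Y where "Y s = charac y0 u0 s + e * exp (?l * s)" for s
  define Z where "Z s = charac z0 u0 s - e * exp (?l * s)" for s
  define dY where "dY s = vel (\<mu> s) (charac y0 u0 s) u0 + e * (?l * exp (?l * s))" for s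
  define dZ where "dZ s = vel (\<mu> s) (charac z0 u0 s) u0 - e * (?l * exp (?l * s))" for s
  define Yx where "Yx s = (if s \<in> {0..} then Y s else Y 0 + s * dY 0)" for s
  define Zx where "Zx s = (if s \<in> {0..} then Z s else Z 0 + s * dZ 0)" for s
  have Yd: "(Yx has_real_derivative dY (max 0 s)) (at s)" for s
    unfolding Yx_def
    by (rule extend_derivative_below_0) (auto simp: Y_def dY_def intro!: derivative_eq_intros charac_deriv)
  have Zd: "(Zx has_real_derivative dZ (max 0 s)) (at s)" for s
    unfolding Zx_def
    by (rule extend_derivative_below_0) (auto simp: Z_def dZ_def intro!: derivative_eq_intros charac_deriv)
  have cdY: "continuous_on UNIV (\<lambda>s. dY (max 0 s))"
    unfolding dY_def
    by (intro continuous_intros continuous_on_compose2[OF vel_charac_continuous]) auto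
  have cdZ: "continuous_on UNIV (\<lambda>s. dZ (max 0 s))"
    unfolding dZ_def
    by (intro continuous_intros continuous_on_compose2[OF vel_charac_continuous]) auto
  \<comment> \<open>The factor in time equals 1 up to \<open>T\<close> and vanishes after
    \<open>T + 1\<close>; it gives the test function bounded support without affecting the equation
    on \<open>[0, T]\<close>.\<close>
  define \<phi> where "\<phi> = (\<lambda>z::real \<times> real \<times> real. ramp (fst z - T) * (\<psi> (snd (snd z)) *
     (ramp ((fst (snd z) - Yx (fst z)) * (1/e)) * ramp ((Zx (fst z) - fst (snd z)) * (1/e)))))"
  have lin: "C1_fun (\<lambda>z::real \<times> real \<times> real. fst z)" "C1_fun (\<lambda>z::real \<times> real \<times> real. fst (snd z))"
    by (auto intro!: C1_fun_bounded_linear bounded_linear_fst bounded_linear_compose[OF bounded_linear_fst bounded_linear_snd])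
  have C1\<phi>: "C1_fun \<phi>"
    unfolding \<phi>_def
    by (intro C1_fun_mult C1_fun_ramp C1_fun_diff C1_fun_const \<psi>(1) lin
        C1_fun_compose[OF lin(1) Yd cdY] C1_fun_compose[OF lin(1) Zd cdZ])
  have Ybd: "\<exists>B. \<forall>s\<in>{0..T+1}. \<bar>Yx s\<bar> \<le> B \<and> \<bar>Zx s\<bar> \<le> B"
  proof -
    have "continuous_on {0..T+1} Yx" "continuous_on {0..T+1} Zx"
      using Yd Zd by (meson DERIV_isCont continuous_at_imp_continuous_on)+
    then have "bounded (Yx ` {0..T+1})" "bounded (Zx ` {0..T+1})"
      by (auto intro!: compact_imp_bounded compact_continuous_image)
    then obtain B1 B2 where "\<forall>s\<in>{0..T+1}. \<bar>Yx s\<bar> \<le> B1" "\<forall>s\<in>{0..T+1}. \<bar>Zx s\<bar> \<le> B2"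
      by (auto simp: bounded_iff)
    then show ?thesis by (intro exI[of _ "max B1 B2"]) fastforce
  qed
  then obtain B where B: "\<And>s. s \<in> {0..T+1} \<Longrightarrow> \<bar>Yx s\<bar> \<le> B \<and> \<bar>Zx s\<bar> \<le> B" by blast
  have "{z. \<phi> z \<noteq> 0 \<and> fst z \<ge> 0} \<subseteq> {0..T+1} \<times> {- B - e..B + e} \<times> {u0 - e..u0 + e}"
  proof
    fix z assume "z \<in> {z. \<phi> z \<noteq> 0 \<and> fst z \<ge> 0}"
    then have nz: "\<phi> z \<noteq> 0" "0 \<le> fst z" by auto
    have a: "fst z - T < 1" using nz ramp_eq_0[of "fst z - T"] by (auto simp: \<phi>_def not_le[symmetric])
    have b: "\<bar>snd (snd z) - u0\<bar> \<le> e" using nz \<psi>(4)[of "snd (snd z)"] by (auto simp: \<phi>_def not_le[symmetric])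
    have "(fst (snd z) - Yx (fst z)) * (1/e) < 1" "(Zx (fst z) - fst (snd z)) * (1/e) < 1"
      using nz ramp_eq_0[of "(fst (snd z) - Yx (fst z)) * (1/e)"] ramp_eq_0[of "(Zx (fst z) - fst (snd z)) * (1/e)"]
      by (auto simp: \<phi>_def not_le[symmetric])
    then have "fst (snd z) < Yx (fst z) + e" "Zx (fst z) - e < fst (snd z)" using e by (auto simp: field_simps)
    with a b nz(2) B[of "fst z"] have "fst z \<in> {0..T+1}" "fst (snd z) \<in> {- B - e..B + e}" "snd (snd z) \<in> {u0 - e..u0 + e}"
      by auto
    then show "z \<in> {0..T+1} \<times> {- B - e..B + e} \<times> {u0 - e..u0 + e}"
      by (metis mem_Times_iff)
  qed
  then have "bounded {z. \<phi> z \<noteq> 0 \<and> fst z \<ge> 0}"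
    by (rule bounded_subset[rotated]) (intro bounded_Times; simp)
  with C1\<phi> have test: "test_fun \<phi>" by (simp add: test_fun_def)
  define G where "G s = (\<integral> z. (deriv (\<lambda>r. \<phi> (r, z)) s + F (\<mu> s) (fst z) (snd z) * deriv (\<lambda>y. \<phi> (s, (y, snd z))) (fst z)) \<partial>(\<mu> s))" for s
  have eqn: "(\<integral> z. \<phi> (T, z) \<partial>(\<mu> T)) = (\<integral> z. \<phi> (0, z) \<partial>\<mu>0) + integral {0..T} G"
    using sol test T unfolding mv_solution_def G_def by blast
  have G0: "0 \<le> G s" if s: "s \<in> {0..T}" for s
    unfolding G_def
  proof (rule integral_nonneg_AE)
    have s0: "0 \<le> s" using s by simp
    show "AE z in \<mu> s. 0 \<le> deriv (\<lambda>r. \<phi> (r, z)) s + F (\<mu> s) (fst z) (snd z) * deriv (\<lambda>y. \<phi> (s, (y, snd z))) (fst z)"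
      using P2nu_AE_Omega[OF mu[OF s0]]
    proof eventually_elim
      case (elim z)
      obtain x w where z: "z = (x, w)" by (cases z)
      have w: "w \<in> \<Omega>" using elim z by simp
      define a where "a = (x - Y s) * (1/e)"
      define b where "b = (Z s - x) * (1/e)"
      have YZ: "Yx s = Y s" "Zx s = Z s" "max 0 s = s" using s by (auto simp: Yx_def Zx_def)
      have sT: "ramp (s - T) = 1" "ramp' (s - T) = 0" using s by (auto simp: ramp_eq_1 ramp'_eq_0)
      have d1: "((\<lambda>r. \<phi> (r, z)) has_real_derivative
          \<psi> w * (ramp' a * (- dY s * (1/e)) * ramp b + ramp a * (ramp' b * (dZ s * (1/e))))) (at s)"
      proof -
        have "((\<lambda>r. ramp ((x - Yx r) * (1/e))) has_real_derivative ramp' a * (- dY s * (1/e))) (at s)"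
          unfolding a_def YZ(1)[symmetric]
          by (rule DERIV_chain2[OF ramp_deriv]) (use e Yd[of s] YZ(3) in \<open>auto intro!: derivative_eq_intros\<close>)
        moreover have "((\<lambda>r. ramp ((Zx r - x) * (1/e))) has_real_derivative ramp' b * (dZ s * (1/e))) (at s)"
          unfolding b_def YZ(2)[symmetric]
          by (rule DERIV_chain2[OF ramp_deriv]) (use e Zd[of s] YZ(3) in \<open>auto intro!: derivative_eq_intros\<close>)
        moreover have "((\<lambda>r. ramp (r - T)) has_real_derivative ramp' (s - T) * 1) (at s)"
          by (rule DERIV_chain2[OF ramp_deriv]) (use e in \<open>auto intro!: derivative_eq_intros\<close>)
        ultimately have "((\<lambda>r. ramp (r - T) * (\<psi> w * (ramp ((x - Yx r) * (1/e)) * ramp ((Zx r - x) * (1/e))))) has_real_derivative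
          (ramp' (s - T) * 1) * (\<psi> w * (ramp ((x - Yx s) * (1/e)) * ramp ((Zx s - x) * (1/e)))) +
          (\<psi> w * (ramp' a * (- dY s * (1/e)) * ramp ((Zx s - x) * (1/e)) + ramp' b * (dZ s * (1/e)) * ramp ((x - Yx s) * (1/e)))) * ramp (s - T)) (at s)"
          by (intro DERIV_mult DERIV_cmult)
        then show ?thesis
          unfolding \<phi>_def z YZ sT a_def[symmetric] b_def[symmetric] fst_conv snd_conv
          by (simp add: mult.commute)
      qed
      have d2: "((\<lambda>y. \<phi> (s, (y, w))) has_real_derivative
          \<psi> w * (ramp' a * (1/e) * ramp b + ramp a * (ramp' b * (- (1/e))))) (at x)"
      proof -
        have "((\<lambda>y. ramp ((y - Y s) * (1/e))) has_real_derivative ramp' a * (1/e)) (at x)"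
          unfolding a_def
          by (rule DERIV_chain2[OF ramp_deriv]) (use e in \<open>auto intro!: derivative_eq_intros\<close>)
        moreover have "((\<lambda>y. ramp ((Z s - y) * (1/e))) has_real_derivative ramp' b * (- (1/e))) (at x)"
          unfolding b_def
          by (rule DERIV_chain2[OF ramp_deriv]) (use e in \<open>auto intro!: derivative_eq_intros\<close>)
        ultimately have "((\<lambda>y. \<psi> w * (ramp ((y - Y s) * (1/e)) * ramp ((Z s - y) * (1/e)))) has_real_derivative
          \<psi> w * (ramp' a * (1/e) * ramp ((Z s - x) * (1/e)) + ramp' b * (- (1/e)) * ramp ((x - Y s) * (1/e)))) (at x)"
          by (intro DERIV_mult DERIV_cmult)
        then show ?thesis
          unfolding \<phi>_def YZ sT a_def[symmetric] b_def[symmetric] fst_conv snd_conv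
          by (simp add: mult.commute)
      qed
      define f where "f = F (\<mu> s) x w"
      have fv: "f = vel (\<mu> s) x w" unfolding f_def by (rule vel_eq[OF mu[OF s0] w, symmetric])
      have E1: "1 \<le> exp (?l * s)" using s0 pos by (auto intro!: mult_nonneg_nonneg add_nonneg_nonneg)
      have ep: "0 < e * exp (?l * s)" using e by simp
      have near: "\<bar>f - vel (\<mu> s) y u0\<bar> \<le> e * (?l * exp (?l * s))"
        if "\<bar>x - y\<bar> \<le> e * (1 + exp (?l * s))" "\<bar>w - u0\<bar> \<le> e" for y
      proof -
        have "\<bar>f - vel (\<mu> s) y w\<bar> \<le> \<kappa> * I * (e * (1 + exp (?l * s)))"
          using vel_lip_x[OF mu[OF s0], of x w y] mult_left_mono[OF that(1) kI] unfolding fv by linarith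
        moreover have "\<bar>vel (\<mu> s) y w - vel (\<mu> s) y u0\<bar> \<le> I * e"
          using vel_lip_w[OF mu[OF s0], of y w u0] mult_left_mono[OF that(2) I0] by linarith
        moreover have "\<kappa> * I * (e * (1 + exp (?l * s))) + I * e \<le> e * (?l * exp (?l * s))"
        proof -
          have "e * (\<kappa> * I) * (1 + exp (?l * s)) + e * I * 1 \<le> e * (\<kappa> * I) * (2 * exp (?l * s)) + e * I * exp (?l * s)"
            using e E1 pos by (intro add_mono mult_left_mono mult_nonneg_nonneg) auto
          then show ?thesis by (simp add: algebra_simps)
        qed
        ultimately show ?thesis by linarith
      qed
      have t1: "0 \<le> \<psi> w * (ramp' a * ramp b * ((f - dY s) * (1/e)))"
      proof (cases "\<psi> w = 0 \<or> ramp' a = 0")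
        case False
        then have wn: "\<bar>w - u0\<bar> \<le> e" and a01: "0 < a" "a < 1"
          using \<psi>(4)[of w] ramp'_eq_0[of a] by (auto simp: not_le[symmetric])
        then have "0 < x - Y s" "x - Y s < e" using e by (auto simp: a_def field_simps)
        then have "\<bar>x - charac y0 u0 s\<bar> \<le> e * (1 + exp (?l * s))"
          using e ep unfolding Y_def distrib_left by linarith
        then have "f \<le> dY s" using near[OF _ wn, of "charac y0 u0 s"] by (simp add: dY_def abs_le_iff)
        then have "(f - dY s) * (1/e) \<le> 0" using e by (simp add: divide_nonpos_pos)
        then have "0 \<le> ramp' a * ramp b * ((f - dY s) * (1/e))"
          using ramp'_nonpos[of a] ramp_nonneg[of b] by (intro mult_nonpos_nonpos) (auto simp: mult_nonpos_nonneg)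
        then show ?thesis by (rule mult_nonneg_nonneg[OF \<psi>(2)])
      qed auto
      have t2: "0 \<le> \<psi> w * (ramp a * ramp' b * ((dZ s - f) * (1/e)))"
      proof (cases "\<psi> w = 0 \<or> ramp' b = 0")
        case False
        then have wn: "\<bar>w - u0\<bar> \<le> e" and b01: "0 < b" "b < 1"
          using \<psi>(4)[of w] ramp'_eq_0[of b] by (auto simp: not_le[symmetric])
        then have "0 < Z s - x" "Z s - x < e" using e by (auto simp: b_def field_simps)
        then have "\<bar>x - charac z0 u0 s\<bar> \<le> e * (1 + exp (?l * s))"
          using e ep unfolding Z_def distrib_left by linarith
        then have "dZ s \<le> f" using near[OF _ wn, of "charac z0 u0 s"] by (simp add: dZ_def abs_le_iff)
        then have "(dZ s - f) * (1/e) \<le> 0" using e by (simp add: divide_nonpos_pos)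
        then have "0 \<le> ramp a * ramp' b * ((dZ s - f) * (1/e))"
          using ramp'_nonpos[of b] ramp_nonneg[of a] by (intro mult_nonpos_nonpos) (auto simp: mult_nonneg_nonpos)
        then show ?thesis by (rule mult_nonneg_nonneg[OF \<psi>(2)])
      qed auto
      have "\<psi> w * (ramp' a * (- dY s * (1/e)) * ramp b + ramp a * (ramp' b * (dZ s * (1/e))))
          + f * (\<psi> w * (ramp' a * (1/e) * ramp b + ramp a * (ramp' b * (- (1/e)))))
        = \<psi> w * (ramp' a * ramp b * ((f - dY s) * (1/e))) + \<psi> w * (ramp a * ramp' b * ((dZ s - f) * (1/e)))"
        by (simp add: algebra_simps)
      with t1 t2 show ?case
        using DERIV_imp_deriv[OF d1] DERIV_imp_deriv[OF d2] by (simp add: z f_def)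
    qed
  qed
  \<comment> \<open>Integrability of \<open>G\<close> in time is not established. If it fails, the
    integral has the default value 0, so the sign is right in both cases.\<close>
  have "0 \<le> integral {0..T} G"
    by (cases "G integrable_on {0..T}")
       (auto intro!: Henstock_Kurzweil_Integration.integral_nonneg G0 simp: not_integrable_integral)
  then have main: "(\<integral> z. \<phi> (0, z) \<partial>\<mu>0) \<le> (\<integral> z. \<phi> (T, z) \<partial>(\<mu> T))" using eqn by simp
  have \<phi>m: "(\<lambda>z. \<phi> (s, z)) \<in> borel_measurable borel" for s
    by (intro borel_measurable_continuous_onI continuous_on_compose2[OF C1_fun_continuous[OF C1\<phi>]] continuous_intros) auto
  have \<psi>m: "(\<lambda>z :: real \<times> real. \<psi> (snd z)) \<in> borel_measurable borel"
  proof -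
    have "continuous_on UNIV (\<lambda>z :: real \<times> real. (0::real, z))" by (intro continuous_intros)
    from continuous_on_compose2[OF C1_fun_continuous[OF \<psi>(1)] this] show ?thesis
      by (intro borel_measurable_continuous_onI) simp
  qed
  have \<phi>b: "0 \<le> \<phi> z" "\<phi> z \<le> 1" for z
    unfolding \<phi>_def using ramp_nonneg ramp_le_1 \<psi>(2,3)
    by (auto intro!: mult_nonneg_nonneg mult_le_one)
  have int1: "integrable m (\<lambda>z. \<phi> (s, z))" if "m \<in> P2nu \<nu>" for m s
  proof -
    interpret prob_space m by (rule P2nu_prob[OF that])
    show ?thesis
      by (rule integrable_const_bound[where B=1])
         (use \<phi>m \<phi>b P2nu_sets[OF that] in \<open>auto cong: measurable_cong_sets\<close>)
  qed
  have int2: "integrable m (\<lambda>z. \<psi> (snd z) * indicat_real {z. p \<le> fst z \<and> fst z \<le> q} z)" if "m \<in> P2nu \<nu>" for m p q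
  proof -
    interpret prob_space m by (rule P2nu_prob[OF that])
    have "closed {z :: real \<times> real. p \<le> fst z \<and> fst z \<le> q}"
      by (intro closed_Collect_conj closed_Collect_le continuous_intros)
    then show ?thesis
      by (intro integrable_const_bound[where B=1])
         (use \<psi>m \<psi>(2,3) P2nu_sets[OF that] in \<open>auto simp: indicator_def mult_le_one cong: measurable_cong_sets intro!: borel_measurable_times borel_measurable_indicator\<close>)
  qed
  have "(\<integral>z. \<psi> (snd z) * indicat_real {z. z0 \<le> fst z \<and> fst z \<le> y0} z \<partial>\<mu>0) \<le> (\<integral> z. \<phi> (0, z) \<partial>\<mu>0)"
  proof (rule integral_mono[OF int2[OF mu0] int1[OF mu0]])
    fix z :: "real \<times> real"
    show "\<psi> (snd z) * indicat_real {z. z0 \<le> fst z \<and> fst z \<le> y0} z \<le> \<phi> (0, z)"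
    proof (cases "z0 \<le> fst z \<and> fst z \<le> y0")
      case True
      then have "fst z - Yx 0 \<le> 0" "Zx 0 - fst z \<le> 0"
        using e by (auto simp: Yx_def Y_def Zx_def Z_def charac_0)
      then have "ramp ((fst z - Yx 0) * (1/e)) = 1" "ramp ((Zx 0 - fst z) * (1/e)) = 1"
        using e by (auto intro!: ramp_eq_1 simp: mult_le_0_iff divide_le_0_iff)
      then show ?thesis using T True by (simp add: \<phi>_def ramp_eq_1)
    qed (simp add: \<phi>b)
  qed
  also note main
  also have "(\<integral> z. \<phi> (T, z) \<partial>(\<mu> T)) \<le> (\<integral>z. \<psi> (snd z) * indicat_real {z. charac z0 u0 T - E - e \<le> fst z \<and> fst z \<le> charac y0 u0 T + E + e} z \<partial>\<mu> T)"
  proof (rule integral_mono[OF int1[OF mu[OF T]] int2[OF mu[OF T]]])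
    fix z :: "real \<times> real"
    show "\<phi> (T, z) \<le> \<psi> (snd z) * indicat_real {z. charac z0 u0 T - E - e \<le> fst z \<and> fst z \<le> charac y0 u0 T + E + e} z"
    proof (cases "\<phi> (T, z) = 0")
      case False
      then have "(fst z - Yx T) * (1/e) < 1" "(Zx T - fst z) * (1/e) < 1"
        using ramp_eq_0[of "(fst z - Yx T) * (1/e)"] ramp_eq_0[of "(Zx T - fst z) * (1/e)"]
        by (auto simp: \<phi>_def not_le[symmetric])
      then have "fst z < Yx T + e" "Zx T - e < fst z" using e by (auto simp: field_simps)
      then have 1: "charac z0 u0 T - E - e \<le> fst z \<and> fst z \<le> charac y0 u0 T + E + e"
        using T by (auto simp: Yx_def Zx_def Y_def Z_def E_def)
      have "ramp ((fst z - Yx T) * (1/e)) * ramp ((Zx T - fst z) * (1/e)) \<le> 1"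
        using ramp_nonneg ramp_le_1 by (intro mult_le_one)
      then have "\<phi> (T, z) \<le> \<psi> (snd z)" using \<psi>(2)[of "snd z"] by (simp add: \<phi>_def ramp_eq_1 mult_left_le)
      then show ?thesis using 1 by simp
    qed (simp add: \<psi>(2))
  qed
  finally show ?thesis .
qed

end

text \<open>Differences of ramps shifted by one grid step: a C^1 partition in the frequency whose
  \<open>k\<close>-th bump lives within \<open>e\<close> of \<open>k * e - R\<close> and whose
  partial sums telescope.\<close>

definition bin :: "real \<Rightarrow> real \<Rightarrow> nat \<Rightarrow> real \<Rightarrow> real" where
  "bin R e k w = ramp ((w + R) * (1/e) - real k) - ramp ((w + R) * (1/e) - (real k - 1))"

lemma bin_C1: "C1_fun (\<lambda>z::real \<times> real \<times> real. bin R e k (snd (snd z)))"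
proof -
  have l: "C1_fun (\<lambda>z::real \<times> real \<times> real. snd (snd z))"
    by (intro C1_fun_bounded_linear bounded_linear_compose[OF bounded_linear_snd bounded_linear_snd])
  have l2: "C1_fun (\<lambda>z::real \<times> real \<times> real. (snd (snd z) + R) * E - c)" for c E
    by (rule C1_fun_compose[OF l, where h'="\<lambda>_. E"]) (auto intro!: derivative_eq_intros)
  show ?thesis unfolding bin_def by (rule C1_fun_diff[OF C1_fun_ramp[OF l2] C1_fun_ramp[OF l2]])
qed

lemma bin_nonneg: "0 \<le> bin R e k w"
  unfolding bin_def using ramp_antimono[of "(w + R) * (1/e) - real k" "(w + R) * (1/e) - (real k - 1)"] by simp

lemma bin_le_1: "bin R e k w \<le> 1"
  unfolding bin_def using ramp_le_1[of "(w + R) * (1/e) - real k"] ramp_nonneg[of "(w + R) * (1/e) - (real k - 1)"] by linarith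

lemma bin_support:
  assumes "0 < e" "e < \<bar>w - (real k * e - R)\<bar>"
  shows "bin R e k w = 0"
proof -
  define u where "u = (w + R) * (1/e) - real k"
  have "w - (real k * e - R) = u * e" using assms(1) by (simp add: u_def field_simps)
  then have "1 < \<bar>u\<bar>" using assms by (simp add: abs_mult)
  then consider "u \<le> -1" | "1 \<le> u" by linarith
  then have "ramp u - ramp (u + 1) = 0" by cases (auto simp: ramp_eq_1 ramp_eq_0)
  then show ?thesis by (simp add: bin_def u_def algebra_simps)
qed

lemma bin_sum: "(\<Sum>k<n. bin R e k w) = ramp ((w + R) * (1/e) - (real n - 1)) - ramp ((w + R) * (1/e) + 1)"
  by (induction n) (simp_all add: bin_def)

section \<open>Identification of a solution with the image of its datum under the
  characteristics\<close>

context kinetic_solution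
begin

definition "pushed T = distr \<mu>0 borel (\<lambda>z. (charac (fst z) (snd z) T, snd z))"

lemma meas_charac:
  assumes "0 \<le> T"
  shows "(\<lambda>z. (charac (fst z) (snd z) T, snd z)) \<in> borel_measurable \<mu>0"
proof -
  have "(\<lambda>z. (charac (fst z) (snd z) T, snd z)) \<in> borel_measurable borel"
    by (intro borel_measurable_continuous_onI continuous_on_Pair charac_continuous_space assms continuous_intros)
  then show ?thesis using P2nu_sets[OF mu0] by (simp cong: measurable_cong_sets)
qed

lemma box_closed: "closed {z :: real \<times> real. p \<le> fst z \<and> fst z \<le> q \<and> snd z \<le> a}"
  by (intro closed_Collect_conj closed_Collect_le continuous_intros)

context
  fixes T R\<^sub>0 :: real
  assumes T: "0 \<le> T" and R0: "AE z in \<mu>0. \<bar>fst z\<bar> \<le> R\<^sub>0"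
begin

text \<open>Boundary loss per unit of \<open>e\<close>: replacing a frequency by the centre of its
  bin, the widened edge of the moving barrier, and the width of the final ramp.\<close>

definition "spread = exp ((\<kappa> * I + I) * T) + exp ((2 * (\<kappa> * I) + I) * T) + 1"

lemma bin_integrable:
  assumes m: "m \<in> P2nu \<nu>" and S: "S \<in> sets borel"
  shows "integrable m (\<lambda>z. bin R e k (snd z) * indicat_real S z)"
proof -
  interpret prob_space m by (rule P2nu_prob[OF m])
  have "continuous_on UNIV (\<lambda>z::real \<times> real. bin R e k (snd z))"
    unfolding bin_def by (intro continuous_intros continuous_on_compose2[OF ramp_continuous]) auto
  then have "(\<lambda>z::real \<times> real. bin R e k (snd z)) \<in> borel_measurable borel"
    by (rule borel_measurable_continuous_onI)
  then show ?thesis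
    using S P2nu_sets[OF m]
    by (intro integrable_const_bound[where B=1])
       (auto simp: indicator_def bin_nonneg bin_le_1 cong: measurable_cong_sets intro!: borel_measurable_times borel_measurable_indicator)
qed

text \<open>Particles of one bin that arrive in \<open>[p, q]\<close> start in the compact set
  \<open>C\<close>, described with the single frequency \<open>u0\<close>. Its smallest and largest
  points span an interval; the barrier moves this interval as a whole, and its ends arrive within
  \<open>d\<close> of \<open>[p, q]\<close>. Boundedness of the datum provides the
  compactness.\<close>

lemma bin_transport:
  assumes e: "0 < e"
  shows "(\<integral>z. bin R e k (snd z) * indicat_real {z. p \<le> charac (fst z) (snd z) T \<and> charac (fst z) (snd z) T \<le> q} z \<partial>\<mu>0)
    \<le> (\<integral>z. bin R e k (snd z) * indicat_real {z. p - spread * e \<le> fst z \<and> fst z \<le> q + spread * e} z \<partial>\<mu> T)"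
proof -
  define u0 where "u0 = real k * e - R"
  define d where "d = exp ((\<kappa> * I + I) * T) * e"
  define C where "C = {x \<in> {- R\<^sub>0..R\<^sub>0}. p - d \<le> charac x u0 T \<and> charac x u0 T \<le> q + d}"
  have cc: "continuous_on UNIV (\<lambda>x. charac x u0 T)"
    using continuous_on_compose2[OF charac_continuous_space[OF T], of UNIV "\<lambda>x. (x, u0)"]
    by (simp add: continuous_on_Pair continuous_on_const continuous_on_id)
  have Cc: "compact C"
  proof -
    have "closed {x. p - d \<le> charac x u0 T \<and> charac x u0 T \<le> q + d}"
      by (intro closed_Collect_conj closed_Collect_le cc continuous_intros)
    then have "compact ({- R\<^sub>0..R\<^sub>0} \<inter> {x. p - d \<le> charac x u0 T \<and> charac x u0 T \<le> q + d})"
      by (intro compact_Int_closed) auto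
    then show ?thesis by (simp add: C_def Int_def)
  qed
  let ?S = "{z. p \<le> charac (fst z) (snd z) T \<and> charac (fst z) (snd z) T \<le> q}"
  have Sm: "?S \<in> sets borel"
    by (intro borel_closed closed_Collect_conj closed_Collect_le charac_continuous_space T continuous_intros)
  have inC: "AE z in \<mu>0. bin R e k (snd z) * indicat_real ?S z \<noteq> 0 \<longrightarrow> fst z \<in> C"
    using R0
  proof eventually_elim
    case (elim z)
    show ?case
    proof
      assume nz: "bin R e k (snd z) * indicat_real ?S z \<noteq> 0"
      then have "\<bar>snd z - u0\<bar> \<le> e" using bin_support[OF e, of "snd z" k R] by (force simp: u0_def)
      then have "exp ((\<kappa> * I + I) * T) * \<bar>snd z - u0\<bar> \<le> d" by (simp add: d_def)
      then have "\<bar>charac (fst z) (snd z) T - charac (fst z) u0 T\<bar> \<le> d"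
        using charac_lipschitz[OF T, of "fst z" "snd z" "fst z" u0] by simp
      moreover have "z \<in> ?S" using nz by (auto simp: indicator_def split: if_splits)
      ultimately show "fst z \<in> C" using elim by (auto simp: C_def abs_le_iff)
    qed
  qed
  show ?thesis
  proof (cases "C = {}")
    case True
    have "(\<integral>z. bin R e k (snd z) * indicat_real ?S z \<partial>\<mu>0) = (\<integral>z. 0 \<partial>\<mu>0)"
      by (rule integral_cong_AE) (use inC True bin_integrable[OF mu0 Sm] in auto)
    also have "\<dots> \<le> (\<integral>z. bin R e k (snd z) * indicat_real {z. p - spread * e \<le> fst z \<and> fst z \<le> q + spread * e} z \<partial>\<mu> T)"
      by (simp add: bin_nonneg integral_nonneg)
    finally show ?thesis .
  next
    case False
    obtain y0 where y0: "y0 \<in> C" "\<And>x. x \<in> C \<Longrightarrow> x \<le> y0" using compact_attains_sup[OF Cc False] by blast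
    obtain z0 where z0: "z0 \<in> C" "\<And>x. x \<in> C \<Longrightarrow> z0 \<le> x" using compact_attains_inf[OF Cc False] by blast
    have b1: "{z :: real \<times> real. z0 \<le> fst z \<and> fst z \<le> y0} \<in> sets borel" for z0 y0
      by (intro borel_closed closed_Collect_conj closed_Collect_le continuous_intros)
    have "(\<integral>z. bin R e k (snd z) * indicat_real ?S z \<partial>\<mu>0) \<le> (\<integral>z. bin R e k (snd z) * indicat_real {z. z0 \<le> fst z \<and> fst z \<le> y0} z \<partial>\<mu>0)"
    proof (rule integral_mono_AE[OF bin_integrable[OF mu0 Sm] bin_integrable[OF mu0 b1]])
      show "AE z in \<mu>0. bin R e k (snd z) * indicat_real ?S z \<le> bin R e k (snd z) * indicat_real {z. z0 \<le> fst z \<and> fst z \<le> y0} z"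
        using inC
      proof eventually_elim
        case (elim z)
        show ?case
        proof (cases "bin R e k (snd z) * indicat_real ?S z = 0")
          case True
          show ?thesis unfolding True by (simp add: bin_nonneg)
        next
          case False
          then have "fst z \<in> C" using elim by blast
          then show ?thesis using y0(2) z0(2) bin_nonneg[of R e k "snd z"] by (simp add: indicator_def)
        qed
      qed
    qed
    also have "\<dots> \<le> (\<integral>z. bin R e k (snd z) * indicat_real {z. charac z0 u0 T - e * exp ((2 * (\<kappa> * I) + I) * T) - e \<le> fst z \<and> fst z \<le> charac y0 u0 T + e * exp ((2 * (\<kappa> * I) + I) * T) + e} z \<partial>\<mu> T)"
      by (rule barrier[OF T e bin_C1 bin_nonneg bin_le_1])
         (use bin_support[OF e, of _ k R] in \<open>auto simp: u0_def\<close>)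
    also have "\<dots> \<le> (\<integral>z. bin R e k (snd z) * indicat_real {z. p - spread * e \<le> fst z \<and> fst z \<le> q + spread * e} z \<partial>\<mu> T)"
    proof (rule integral_mono[OF bin_integrable[OF mu[OF T] b1] bin_integrable[OF mu[OF T] b1]])
      fix z :: "real \<times> real"
      have "spread * e = d + e * exp ((2 * (\<kappa> * I) + I) * T) + e" by (simp add: spread_def d_def algebra_simps)
      then show "bin R e k (snd z) * indicat_real {z. charac z0 u0 T - e * exp ((2 * (\<kappa> * I) + I) * T) - e \<le> fst z \<and> fst z \<le> charac y0 u0 T + e * exp ((2 * (\<kappa> * I) + I) * T) + e} z
         \<le> bin R e k (snd z) * indicat_real {z. p - spread * e \<le> fst z \<and> fst z \<le> q + spread * e} z"
        using y0(1) z0(1) bin_nonneg[of R e k "snd z"] by (auto simp: C_def indicator_def)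
    qed
    finally show ?thesis .
  qed
qed

text \<open>Summation over the bins removes the restriction to narrow frequency bands: the error in
  position is proportional to \<open>e\<close> and does not accumulate with the number of
  bins.\<close>

lemma box_transport_approx:
  assumes e: "0 < e"
  shows "measure (pushed T) {z. p \<le> fst z \<and> fst z \<le> q \<and> snd z \<le> a}
    \<le> measure (\<mu> T) {z. p - spread * e \<le> fst z \<and> fst z \<le> q + spread * e \<and> snd z \<le> a + 2 * e}"
proof -
  interpret m0: prob_space \<mu>0 by (rule P2nu_prob[OF mu0])
  interpret mT: prob_space "\<mu> T" by (rule P2nu_prob[OF mu[OF T]])
  define R where "R = max Rad \<bar>a\<bar>"
  \<comment> \<open>So many bins that their sum is 1 at every frequency in \<Omega> up to
    \<open>a\<close> and 0 beyond \<open>a + 2 * e\<close>: one \<open>e\<close> is lost by rounding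
    to the grid, one by the width of the ramp.\<close>
  define n where "n = Suc (nat \<lceil>(a + R) / e\<rceil>)"
  have aR: "0 \<le> (a + R) / e" using e by (auto simp: R_def)
  have n: "(a + R) / e \<le> real n - 1" "real n - 1 < (a + R) / e + 1"
    using aR by (simp_all add: n_def) linarith+
  define Bn where "Bn w = (\<Sum>k<n. bin R e k w)" for w
  have Bn_eq: "Bn w = ramp ((w + R) * (1/e) - (real n - 1))" if "w \<in> \<Omega>" for w
  proof -
    have "0 \<le> (w + R) * (1/e)" using Rad(2)[OF that] e by (auto simp: R_def)
    then show ?thesis unfolding Bn_def bin_sum by (simp add: ramp_eq_0)
  qed
  have Bn1: "Bn w = 1" if "w \<in> \<Omega>" "w \<le> a" for w
  proof -
    have "(w + R) * (1/e) \<le> (a + R) / e" using that(2) e by (simp add: divide_right_mono)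
    then show ?thesis using n by (simp add: Bn_eq[OF that(1)] ramp_eq_1)
  qed
  have Bn0: "Bn w = 0" if "w \<in> \<Omega>" "a + 2 * e < w" for w
  proof -
    have "(a + R) / e + 2 = (a + R + 2 * e) / e" using e by (simp add: add_divide_distrib)
    also have "\<dots> \<le> (w + R) / e" using that(2) e by (intro divide_right_mono) auto
    finally have "(a + R) / e + 2 \<le> (w + R) * (1/e)" by simp
    then show ?thesis using n by (simp add: Bn_eq[OF that(1)] ramp_eq_0)
  qed
  have Bn01: "0 \<le> Bn w" "Bn w \<le> 1" if "w \<in> \<Omega>" for w
    using Bn_eq[OF that] ramp_nonneg ramp_le_1 by auto
  let ?S = "{z. p \<le> charac (fst z) (snd z) T \<and> charac (fst z) (snd z) T \<le> q}"
  let ?U = "{z :: real \<times> real. p - spread * e \<le> fst z \<and> fst z \<le> q + spread * e}"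
  have Sm: "?S \<in> sets borel" "?U \<in> sets borel"
    by (intro borel_closed closed_Collect_conj closed_Collect_le charac_continuous_space T continuous_intros)+
  let ?Sa = "{z. p \<le> charac (fst z) (snd z) T \<and> charac (fst z) (snd z) T \<le> q \<and> snd z \<le> a}"
  let ?Ua = "{z :: real \<times> real. p - spread * e \<le> fst z \<and> fst z \<le> q + spread * e \<and> snd z \<le> a + 2 * e}"
  have Sam: "?Sa \<in> sets \<mu>0" "?Ua \<in> sets (\<mu> T)"
    unfolding P2nu_sets[OF mu0] P2nu_sets[OF mu[OF T]]
    by (intro borel_closed closed_Collect_conj closed_Collect_le charac_continuous_space T continuous_intros)+
  have ibn: "integrable m (\<lambda>z. Bn (snd z) * indicat_real S z)" if "m \<in> P2nu \<nu>" "S \<in> sets borel" for m S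
    unfolding Bn_def sum_distrib_right by (intro Bochner_Integration.integrable_sum bin_integrable that)
  have "measure (pushed T) {z. p \<le> fst z \<and> fst z \<le> q \<and> snd z \<le> a} = measure \<mu>0 ?Sa"
    unfolding pushed_def using box_closed[of p q a]
    by (subst measure_distr[OF meas_charac[OF T]]) (auto simp: P2nu_space[OF mu0] vimage_def intro: borel_closed)
  also have "\<dots> = (\<integral>z. indicat_real ?Sa z \<partial>\<mu>0)" using Sam by (simp add: P2nu_space[OF mu0])
  also have "\<dots> \<le> (\<integral>z. Bn (snd z) * indicat_real ?S z \<partial>\<mu>0)"
  proof (rule integral_mono_AE[OF _ ibn[OF mu0 Sm(1)]])
    show "integrable \<mu>0 (indicat_real ?Sa)"
      by (rule integrable_real_indicator[OF Sam(1)]) (simp add: m0.emeasure_eq_measure)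
    show "AE z in \<mu>0. indicat_real ?Sa z \<le> Bn (snd z) * indicat_real ?S z"
      using P2nu_AE_Omega[OF mu0] by eventually_elim (auto simp: indicator_def Bn1 Bn01)
  qed
  also have "\<dots> = (\<Sum>k<n. \<integral>z. bin R e k (snd z) * indicat_real ?S z \<partial>\<mu>0)"
    unfolding Bn_def sum_distrib_right
    by (intro Bochner_Integration.integral_sum bin_integrable mu0 Sm)
  also have "\<dots> \<le> (\<Sum>k<n. \<integral>z. bin R e k (snd z) * indicat_real ?U z \<partial>\<mu> T)"
    by (intro sum_mono bin_transport e)
  also have "\<dots> = (\<integral>z. Bn (snd z) * indicat_real ?U z \<partial>\<mu> T)"
    unfolding Bn_def sum_distrib_right
    by (intro Bochner_Integration.integral_sum[symmetric] bin_integrable mu T Sm)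
  also have "\<dots> \<le> (\<integral>z. indicat_real ?Ua z \<partial>\<mu> T)"
  proof (rule integral_mono_AE[OF ibn[OF mu[OF T] Sm(2)]])
    show "integrable (\<mu> T) (indicat_real ?Ua)"
      by (rule integrable_real_indicator[OF Sam(2)]) (simp add: mT.emeasure_eq_measure)
    show "AE z in \<mu> T. Bn (snd z) * indicat_real ?U z \<le> indicat_real ?Ua z"
      using P2nu_AE_Omega[OF mu[OF T]]
    proof eventually_elim
      case (elim z)
      then show ?case using Bn0[of "snd z"] Bn01[of "snd z"] by (cases "snd z \<le> a + 2 * e") (auto simp: indicator_def)
    qed
  qed
  also have "\<dots> = measure (\<mu> T) ?Ua" using Sam by (simp add: P2nu_space[OF mu[OF T]])
  finally show ?thesis .
qed

lemma prob_pushed: "prob_space (pushed T)"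
  unfolding pushed_def by (rule prob_space.prob_space_distr[OF P2nu_prob[OF mu0] meas_charac[OF T]])

lemma box_transport:
  "measure (pushed T) {z. p \<le> fst z \<and> fst z \<le> q \<and> snd z \<le> a}
    \<le> measure (\<mu> T) {z. p \<le> fst z \<and> fst z \<le> q \<and> snd z \<le> a}"
proof -
  interpret mT: prob_space "\<mu> T" by (rule P2nu_prob[OF mu[OF T]])
  have sp: "0 < spread" unfolding spread_def by (simp add: add_pos_pos)
  define U where "U i = {z :: real \<times> real. p - spread * (1 / real (Suc i)) \<le> fst z \<and> fst z \<le> q + spread * (1 / real (Suc i)) \<and> snd z \<le> a + 2 * (1 / real (Suc i))}" for i
  have inv: "(\<lambda>i. 1 / real (Suc i)) \<longlonglongrightarrow> 0" using LIMSEQ_inverse_real_of_nat by (simp add: inverse_eq_divide)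
  have "(\<Inter>i. U i) = {z. p \<le> fst z \<and> fst z \<le> q \<and> snd z \<le> a}"
  proof (intro equalityI subsetI)
    fix z assume z: "z \<in> (\<Inter>i. U i)"
    have l1: "(\<lambda>i. p - spread * (1 / real (Suc i))) \<longlonglongrightarrow> p - spread * 0"
      and l2: "(\<lambda>i. q + spread * (1 / real (Suc i))) \<longlonglongrightarrow> q + spread * 0"
      and l3: "(\<lambda>i. a + 2 * (1 / real (Suc i))) \<longlonglongrightarrow> a + 2 * 0"
      by (intro tendsto_intros inv)+
    have "p - spread * 0 \<le> fst z" by (rule LIMSEQ_le_const2[OF l1]) (use z in \<open>auto simp: U_def\<close>)
    moreover have "fst z \<le> q + spread * 0" by (rule LIMSEQ_le_const[OF l2]) (use z in \<open>auto simp: U_def\<close>)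
    moreover have "snd z \<le> a + 2 * 0" by (rule LIMSEQ_le_const[OF l3]) (use z in \<open>auto simp: U_def\<close>)
    ultimately show "z \<in> {z. p \<le> fst z \<and> fst z \<le> q \<and> snd z \<le> a}" by simp
  next
    fix z assume z: "z \<in> {z. p \<le> fst z \<and> fst z \<le> q \<and> snd z \<le> a}"
    have "0 \<le> spread * (1 / real (Suc i))" "0 \<le> 2 * (1 / real (Suc i))" for i using sp by auto
    then show "z \<in> (\<Inter>i. U i)" using z unfolding U_def INT_iff mem_Collect_eq by (smt (verit))
  qed
  moreover have "(\<lambda>i. measure (\<mu> T) (U i)) \<longlonglongrightarrow> measure (\<mu> T) (\<Inter>i. U i)"
  proof (rule mT.finite_Lim_measure_decseq)
    show "range U \<subseteq> mT.events" unfolding P2nu_sets[OF mu[OF T]] U_def using box_closed by (auto intro: borel_closed)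
    show "decseq U"
    proof (rule decseq_SucI, rule subsetI)
      fix i z assume z: "z \<in> U (Suc i)"
      have "1 / real (Suc (Suc i)) \<le> 1 / real (Suc i)" by (simp add: frac_le)
      then have "spread * (1 / real (Suc (Suc i))) \<le> spread * (1 / real (Suc i))" "2 * (1 / real (Suc (Suc i))) \<le> 2 * (1 / real (Suc i))"
        using sp by (intro mult_left_mono; simp)+
      with z show "z \<in> U i" unfolding U_def mem_Collect_eq by linarith
    qed
  qed
  moreover have "measure (pushed T) {z. p \<le> fst z \<and> fst z \<le> q \<and> snd z \<le> a} \<le> measure (\<mu> T) (U i)" for i
    unfolding U_def by (rule box_transport_approx) simp
  ultimately show ?thesis using LIMSEQ_le_const[of "\<lambda>i. measure (\<mu> T) (U i)"] by metis
qed

text \<open>Lower bounds on boxes give lower bounds on \<open>fst z \<le> q\<close> and on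
  \<open>q \<le> fst z\<close> within each frequency half-plane. The mass of the half-plane is
  prescribed by the marginal, so a lower bound on one side is an upper bound on the
  complement.\<close>

lemma quadrant_eq:
  "measure (\<mu> T) {z. fst z \<le> q \<and> snd z \<le> a} = measure (pushed T) {z. fst z \<le> q \<and> snd z \<le> a}"
proof -
  interpret mT: prob_space "\<mu> T" by (rule P2nu_prob[OF mu[OF T]])
  interpret pT: prob_space "pushed T" by (rule prob_pushed)
  have st: "sets (\<mu> T) = sets borel" "sets (pushed T) = sets borel"
    using P2nu_sets[OF mu[OF T]] by (auto simp: pushed_def)
  have cl: "{z :: real \<times> real. p \<le> fst z \<and> fst z \<le> q \<and> snd z \<le> a} \<in> sets borel"
     "{z :: real \<times> real. fst z \<le> q \<and> snd z \<le> a} \<in> sets borel" "{z :: real \<times> real. q \<le> fst z \<and> snd z \<le> a} \<in> sets borel"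
     "{z :: real \<times> real. snd z \<le> a} \<in> sets borel" for p q a
    by (intro borel_closed closed_Collect_conj closed_Collect_le continuous_intros)+
  have op: "{z :: real \<times> real. fst z < q \<and> snd z \<le> a} = {z. snd z \<le> a} - {z. q \<le> fst z \<and> snd z \<le> a}" for q by auto
  have le: "measure (pushed T) {z. fst z \<le> q \<and> snd z \<le> a} \<le> measure (\<mu> T) {z. fst z \<le> q \<and> snd z \<le> a}" for q
  proof -
    define U where "U i = {z :: real \<times> real. - real i \<le> fst z \<and> fst z \<le> q \<and> snd z \<le> a}" for i
    have U: "(\<Union>i. U i) = {z. fst z \<le> q \<and> snd z \<le> a}"
    proof (intro equalityI subsetI)
      fix z :: "real \<times> real" assume z: "z \<in> {z. fst z \<le> q \<and> snd z \<le> a}"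
      obtain n where "- fst z \<le> real n" using real_arch_simple by blast
      then have "z \<in> U n" using z by (simp add: U_def)
      then show "z \<in> (\<Union>i. U i)" by blast
    qed (auto simp: U_def)
    have Us: "range U \<subseteq> sets borel" unfolding U_def using cl(1) by blast
    have i: "incseq U" by (rule incseq_SucI) (auto simp: U_def)
    have "(\<lambda>i. measure (pushed T) (U i)) \<longlonglongrightarrow> measure (pushed T) (\<Union>i. U i)"
      by (rule pT.finite_Lim_measure_incseq[OF _ i]) (simp only: st Us)
    moreover have "(\<lambda>i. measure (\<mu> T) (U i)) \<longlonglongrightarrow> measure (\<mu> T) (\<Union>i. U i)"
      by (rule mT.finite_Lim_measure_incseq[OF _ i]) (simp only: st Us)
    ultimately show ?thesis unfolding U
      by (rule LIMSEQ_le) (auto simp: U_def box_transport)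
  qed
  have ge: "measure (pushed T) {z. q \<le> fst z \<and> snd z \<le> a} \<le> measure (\<mu> T) {z. q \<le> fst z \<and> snd z \<le> a}" for q
  proof -
    define U where "U i = {z :: real \<times> real. q \<le> fst z \<and> fst z \<le> real i \<and> snd z \<le> a}" for i
    have U: "(\<Union>i. U i) = {z. q \<le> fst z \<and> snd z \<le> a}"
    proof (intro equalityI subsetI)
      fix z :: "real \<times> real" assume z: "z \<in> {z. q \<le> fst z \<and> snd z \<le> a}"
      obtain n where "fst z \<le> real n" using real_arch_simple by blast
      then have "z \<in> U n" using z by (simp add: U_def)
      then show "z \<in> (\<Union>i. U i)" by blast
    qed (auto simp: U_def)
    have Us: "range U \<subseteq> sets borel" unfolding U_def using cl(1) by blast
    have i: "incseq U" by (rule incseq_SucI) (auto simp: U_def)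
    have "(\<lambda>i. measure (pushed T) (U i)) \<longlonglongrightarrow> measure (pushed T) (\<Union>i. U i)"
      by (rule pT.finite_Lim_measure_incseq[OF _ i]) (simp only: st Us)
    moreover have "(\<lambda>i. measure (\<mu> T) (U i)) \<longlonglongrightarrow> measure (\<mu> T) (\<Union>i. U i)"
      by (rule mT.finite_Lim_measure_incseq[OF _ i]) (simp only: st Us)
    ultimately show ?thesis unfolding U
      by (rule LIMSEQ_le) (auto simp: U_def box_transport)
  qed
  have tot: "measure (pushed T) {z. snd z \<le> a} = measure (\<mu> T) {z. snd z \<le> a}"
  proof -
    have "measure (pushed T) {z. snd z \<le> a} = measure \<mu>0 {z. snd z \<in> {..a}}"
      unfolding pushed_def using cl(4)[of a]
      by (subst measure_distr[OF meas_charac[OF T]]) (auto simp: P2nu_space[OF mu0] vimage_def)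
    also have "\<dots> = measure (\<mu> T) {z. snd z \<in> {..a}}"
      using P2nu_emeasure_snd[OF mu0, of "{..a}"] P2nu_emeasure_snd[OF mu[OF T], of "{..a}"] by (simp add: measure_def)
    finally show ?thesis by simp
  qed
  have lt: "measure (\<mu> T) {z. fst z < q \<and> snd z \<le> a} \<le> measure (pushed T) {z. fst z < q \<and> snd z \<le> a}" for q
  proof -
    have "measure (\<mu> T) {z. fst z < q \<and> snd z \<le> a} = measure (\<mu> T) {z. snd z \<le> a} - measure (\<mu> T) {z. q \<le> fst z \<and> snd z \<le> a}"
      unfolding op by (rule mT.finite_measure_Diff) (use cl st in auto)
    moreover have "measure (pushed T) {z. fst z < q \<and> snd z \<le> a} = measure (pushed T) {z. snd z \<le> a} - measure (pushed T) {z. q \<le> fst z \<and> snd z \<le> a}"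
      unfolding op by (rule pT.finite_measure_Diff) (use cl st in auto)
    ultimately show ?thesis using tot ge[of q] by simp
  qed
  \<comment> \<open>The complement argument yields the strict inequality \<open>fst z < q\<close>;
    continuity from above for \<open>q + 1 / Suc i\<close> recovers the closed quadrant.\<close>
  have "measure (\<mu> T) {z. fst z \<le> q \<and> snd z \<le> a} \<le> measure (pushed T) {z. fst z \<le> q \<and> snd z \<le> a}"
  proof -
    define U where "U i = {z :: real \<times> real. fst z \<le> q + 1 / real (Suc i) \<and> snd z \<le> a}" for i
    have inv: "(\<lambda>i. q + 1 / real (Suc i)) \<longlonglongrightarrow> q + 0"
      using LIMSEQ_inverse_real_of_nat by (intro tendsto_intros) (simp add: inverse_eq_divide)
    have U: "(\<Inter>i. U i) = {z. fst z \<le> q \<and> snd z \<le> a}"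
    proof (intro equalityI subsetI)
      fix z assume z: "z \<in> (\<Inter>i. U i)"
      have "fst z \<le> q + 0" by (rule LIMSEQ_le_const[OF inv]) (use z in \<open>auto simp: U_def\<close>)
      then show "z \<in> {z. fst z \<le> q \<and> snd z \<le> a}" using z by (auto simp: U_def)
    next
      fix z :: "real \<times> real" assume z: "z \<in> {z. fst z \<le> q \<and> snd z \<le> a}"
      have "0 \<le> 1 / real (Suc i)" for i by simp
      then have "fst z \<le> q + 1 / real (Suc i)" for i using z by (metis (mono_tags, lifting) add_increasing2 mem_Collect_eq)
      then show "z \<in> (\<Inter>i. U i)" using z by (simp add: U_def)
    qed
    have Us: "range U \<subseteq> sets borel" unfolding U_def using cl(2) by blast
    have d: "decseq U"
    proof (rule decseq_SucI, rule subsetI)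
      fix i z assume z: "z \<in> U (Suc i)"
      have "1 / real (Suc (Suc i)) \<le> 1 / real (Suc i)" by (simp add: frac_le)
      with z show "z \<in> U i" unfolding U_def mem_Collect_eq by linarith
    qed
    have "(\<lambda>i. measure (pushed T) (U i)) \<longlonglongrightarrow> measure (pushed T) (\<Inter>i. U i)"
      by (rule pT.finite_Lim_measure_decseq[OF _ d]) (simp only: st Us)
    moreover have "measure (\<mu> T) {z. fst z \<le> q \<and> snd z \<le> a} \<le> measure (pushed T) (U i)" for i
    proof -
      let ?q = "q + 1 / real (Suc i)"
      have o: "{z :: real \<times> real. fst z < ?q \<and> snd z \<le> a} \<in> sets borel" unfolding op using cl by auto
      have "measure (\<mu> T) {z. fst z \<le> q \<and> snd z \<le> a} \<le> measure (\<mu> T) {z. fst z < ?q \<and> snd z \<le> a}"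
      proof (rule mT.finite_measure_mono)
        have "0 < 1 / real (Suc i)" by simp
        then show "{z :: real \<times> real. fst z \<le> q \<and> snd z \<le> a} \<subseteq> {z. fst z < ?q \<and> snd z \<le> a}"
          unfolding subset_iff mem_Collect_eq by (smt (verit))
      qed (use o st in auto)
      also have "\<dots> \<le> measure (pushed T) {z. fst z < ?q \<and> snd z \<le> a}" by (rule lt)
      also have "\<dots> \<le> measure (pushed T) (U i)"
        by (rule pT.finite_measure_mono) (use cl st in \<open>auto simp: U_def\<close>)
      finally show ?thesis .
    qed
    ultimately show ?thesis unfolding U using LIMSEQ_le_const by blast
  qed
  with le[of q] show ?thesis by simp
qed

text \<open>Lower-left quadrants are stable under intersection and generate the Borel sets of the
  plane.\<close>

theorem transported: "\<mu> T = pushed T"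
proof -
  interpret mT: prob_space "\<mu> T" by (rule P2nu_prob[OF mu[OF T]])
  interpret pT: prob_space "pushed T" by (rule prob_pushed)
  have st: "sets (\<mu> T) = sets borel" "sets (pushed T) = sets borel"
    using P2nu_sets[OF mu[OF T]] by (auto simp: pushed_def)
  have at: "{..x :: real \<times> real} = {z. fst z \<le> fst x \<and> snd z \<le> snd x}" for x
    by (auto simp: less_eq_prod_def)
  have bs: "sets (borel :: (real \<times> real) measure) = sigma_sets UNIV (range atMost)"
    by (subst borel_eq_atMost) simp
  show ?thesis
  proof (rule measure_eqI_generator_eq[where E="range atMost" and \<Omega>=UNIV and A="\<lambda>i. {..(real i, real i)}"])
    show "Int_stable (range (atMost :: real \<times> real \<Rightarrow> _))"
    proof (rule Int_stableI_image)
      fix x y :: "real \<times> real"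
      have "{..x} \<inter> {..y} = {..(min (fst x) (fst y), min (snd x) (snd y))}"
        unfolding at by auto
      then show "\<exists>k\<in>UNIV. {..x} \<inter> {..y} = {..k}" by blast
    qed
    show "emeasure (\<mu> T) X = emeasure (pushed T) X" if "X \<in> range atMost" for X
      using that quadrant_eq by (auto simp: at mT.emeasure_eq_measure pT.emeasure_eq_measure)
    show "(\<Union>i. {..(real i, real i)}) = UNIV"
    proof (intro equalityI subsetI)
      fix z :: "real \<times> real"
      obtain n where "max (fst z) (snd z) \<le> real n" using real_arch_simple by blast
      then show "z \<in> (\<Union>i. {..(real i, real i)})" by (auto simp: at)
    qed simp
  qed (use st bs in auto)
qed

end

end

section \<open>Positive invariance\<close>

text \<open>A disintegration is only determined almost everywhere, but Wasserstein continuity forces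
  every conditional measure over the support to live on the support of the joint measure.\<close>

lemma disintegration_support:
  fixes \<mu> :: "(real \<times> real) measure"
  assumes \<mu>: "prob_space \<mu>" "sets \<mu> = sets borel" and \<nu>: "sets \<nu> = sets borel"
    and K: "disintegration \<nu> \<mu> K"
    and lip: "\<And>\<omega> \<omega>'. \<omega> \<in> msupp \<nu> \<Longrightarrow> \<omega>' \<in> msupp \<nu> \<Longrightarrow>
        wcost 2 (K \<omega>) (K \<omega>') < \<top> \<and> wasserstein 2 (K \<omega>) (K \<omega>') \<le> L * \<bar>\<omega> - \<omega>'\<bar>"
    and \<omega>: "\<omega> \<in> msupp \<nu>"
  shows "AE x in K \<omega>. (x, \<omega>) \<in> msupp \<mu>"
proof -
  define P where "P = msupp \<mu>"
  interpret \<mu>: prob_space \<mu> by fact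
  have Pc: "closed P" by (simp add: P_def closed_msupp)
  have PAE: "AE z in \<mu>. z \<in> P" unfolding P_def by (rule AE_msupp[OF \<mu>(2)])
  have Pne: "P \<noteq> {}" using PAE \<mu>.AE_False by auto
  have Kp: "prob_space (K w)" and Ks: "sets (K w) = sets borel" for w
    using K by (auto simp: disintegration_def)
  have good: "AE w in \<nu>. emeasure (K w) {x. (x, w) \<in> - P} = 0"
  proof -
    have o: "- P \<in> sets borel" using Pc by auto
    have "emeasure \<mu> (- P) = 0"
      using PAE AE_iff_measurable[of "- P" \<mu> "\<lambda>z. z \<in> P"] o \<mu>(2) sets_eq_imp_space_eq[OF \<mu>(2)] by auto
    moreover have "(\<lambda>w. emeasure (K w) {x. (x, w) \<in> - P}) \<in> borel_measurable \<nu>"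
      "emeasure \<mu> (- P) = (\<integral>\<^sup>+ w. emeasure (K w) {x. (x, w) \<in> - P} \<partial>\<nu>)"
      using K o unfolding disintegration_def by blast+
    ultimately show ?thesis by (simp add: nn_integral_0_iff_AE)
  qed
  \<comment> \<open>Almost every conditional measure lives on its section of the support, and
    neighbourhoods of points of the frequency support have positive mass, so good frequencies lie
    arbitrarily close to any given one.\<close>
  have Sin: "w \<in> msupp \<nu> \<Longrightarrow> \<exists>w'\<in>msupp \<nu>. \<bar>w - w'\<bar> < \<eta> \<and> emeasure (K w') {x. (x, w') \<in> - P} = 0" if \<eta>: "0 < \<eta>" for w \<eta>
  proof (rule ccontr)
    assume w: "w \<in> msupp \<nu>"
      and neg: "\<not> (\<exists>w'\<in>msupp \<nu>. \<bar>w - w'\<bar> < \<eta> \<and> emeasure (K w') {x. (x, w') \<in> - P} = 0)"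
    have "AE w' in \<nu>. w' \<notin> ball w \<eta>"
      using good AE_msupp[OF \<nu>]
    proof eventually_elim
      case (elim w')
      then show ?case using neg by (auto simp: dist_real_def)
    qed
    then have "emeasure \<nu> (ball w \<eta>) = 0"
      by (subst (asm) AE_iff_measurable[of "ball w \<eta>"])
         (use \<nu> sets_eq_imp_space_eq[OF \<nu>] in \<open>auto simp: set_eq_iff\<close>)
    then show False using w \<eta> unfolding msupp_def by (metis (mono_tags, lifting) centre_in_ball mem_Collect_eq open_ball)
  qed
  \<comment> \<open>Points at planar distance at least \<open>2 / Suc n\<close> from the support. Of
    the factor 2, one half will be used up by the horizontal move of a coupling and one half by the
    change of frequency.\<close>
  define U where "U n = {x. 2 / real (Suc n) \<le> infdist (x, \<omega>) P}" for n
  have Uc: "closed (U n)" for n unfolding U_def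
    by (intro closed_Collect_le continuous_intros)
  interpret K: prob_space "K \<omega>" by (rule Kp)
  have U0: "measure (K \<omega>) (U n) = 0" for n
  proof (rule ccontr)
    define m where "m = measure (K \<omega>) (U n)"
    assume "measure (K \<omega>) (U n) \<noteq> 0"
    then have m: "0 < m" by (simp add: m_def less_le)
    define \<rho> where "\<rho> = 1 / real (Suc n)"
    have \<rho>: "0 < \<rho>" by (simp add: \<rho>_def)
    \<comment> \<open>At this frequency distance the squared Wasserstein distance is below
      \<open>\<rho>\<^sup>2 * m\<close>. By Markov's inequality a near-optimal coupling moves less
      than \<open>m\<close> of the mass over a length \<open>\<rho>\<close>, whereas all the mass
      \<open>m\<close> of \<open>U n\<close> would have to move that far to reach the
      support.\<close>
    define \<eta> where "\<eta> = min \<rho> (sqrt (\<rho>\<^sup>2 * m / 2) / (\<bar>L\<bar> + 1))"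
    have \<eta>: "0 < \<eta>" "\<eta> \<le> \<rho>" using \<rho> m by (auto simp: \<eta>_def intro!: divide_pos_pos)
    obtain w where w: "w \<in> msupp \<nu>" "\<bar>\<omega> - w\<bar> < \<eta>" "emeasure (K w) {x. (x, w) \<in> - P} = 0"
      using Sin[OF \<eta>(1) \<omega>] by blast
    have "\<bar>L\<bar> * \<bar>\<omega> - w\<bar> \<le> \<bar>L\<bar> * (sqrt (\<rho>\<^sup>2 * m / 2) / (\<bar>L\<bar> + 1))"
      using w(2) by (intro mult_left_mono) (auto simp: \<eta>_def)
    also have "\<dots> = (\<bar>L\<bar> / (\<bar>L\<bar> + 1)) * sqrt (\<rho>\<^sup>2 * m / 2)" by simp
    also have "\<dots> \<le> 1 * sqrt (\<rho>\<^sup>2 * m / 2)" using m by (intro mult_right_mono) (auto simp: divide_le_eq)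
    finally have "L * \<bar>\<omega> - w\<bar> \<le> sqrt (\<rho>\<^sup>2 * m / 2)"
      using mult_right_mono[OF abs_ge_self[of L], of "\<bar>\<omega> - w\<bar>"] by simp
    then have "wasserstein 2 (K \<omega>) (K w) \<le> sqrt (\<rho>\<^sup>2 * m / 2)" using lip[OF \<omega> w(1)] by simp
    then have "sqrt (enn2real (wcost 2 (K \<omega>) (K w))) \<le> sqrt (\<rho>\<^sup>2 * m / 2)"
      by (simp add: wasserstein_def powr_half_sqrt)
    then have "enn2real (wcost 2 (K \<omega>) (K w)) \<le> \<rho>\<^sup>2 * m / 2" by (simp only: real_sqrt_le_iff)
    also have "\<dots> < \<rho>\<^sup>2 * m" using m \<rho> by simp
    finally have "wcost 2 (K \<omega>) (K w) < ennreal (\<rho>\<^sup>2 * m)"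
      using lip[OF \<omega> w(1)] by (metis ennreal_enn2real ennreal_lessI enn2real_nonneg order.strict_trans1 less_eq_real_def m \<rho> mult_pos_pos zero_less_power)
    then obtain \<pi> where \<pi>: "\<pi> \<in> couplings (K \<omega>) (K w)"
      "(\<integral>\<^sup>+ z. ennreal (dist (fst z) (snd z) powr 2) \<partial>\<pi>) < ennreal (\<rho>\<^sup>2 * m)"
      unfolding wcost_def INF_less_iff by blast
    interpret \<pi>: prob_space \<pi> using \<pi> by (simp add: couplings_def)
    have s\<pi>: "sets \<pi> = sets borel" and d1: "distr \<pi> borel fst = K \<omega>" and d2: "distr \<pi> borel snd = K w"
      using \<pi> by (auto simp: couplings_def)
    have sp: "space \<pi> = UNIV" using sets_eq_imp_space_eq[OF s\<pi>] by simp
    have [measurable_cong]: "sets \<pi> = sets borel" by (rule s\<pi>)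
    define far where "far = {z :: real \<times> real. \<rho> \<le> dist (fst z) (snd z)}"
    define bad where "bad = {z :: real \<times> real. (snd z, w) \<in> - P}"
    have farm: "far \<in> sets \<pi>" unfolding s\<pi> far_def
      by (intro borel_closed closed_Collect_le continuous_intros)
    have badm: "{x. (x, w) \<in> - P} \<in> sets borel"
    proof -
      have "closed {x. (x, w) \<in> P}"
      proof -
        have "continuous_on UNIV (\<lambda>x :: real. (x, w))" by (intro continuous_intros)
        from continuous_closed_preimage[OF this closed_UNIV Pc] show ?thesis by (simp add: vimage_def)
      qed
      then have "- {x. (x, w) \<in> P} \<in> sets borel" by (intro borel_comp borel_closed)
      then show ?thesis by (simp add: Compl_eq)
    qed
    have badm': "bad \<in> sets \<pi>"
      using measurable_sets[OF borel_measurable_fst_snd(2) badm] unfolding s\<pi> by (simp add: bad_def vimage_def)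
    have "emeasure \<pi> far \<le> (\<integral>\<^sup>+ z. ennreal (1 / \<rho>\<^sup>2) * ennreal (dist (fst z) (snd z) powr 2) \<partial>\<pi>)"
    proof -
      have "emeasure \<pi> far = (\<integral>\<^sup>+ z. indicator far z \<partial>\<pi>)" using farm by simp
      also have "\<dots> \<le> (\<integral>\<^sup>+ z. ennreal (1 / \<rho>\<^sup>2) * ennreal (dist (fst z) (snd z) powr 2) \<partial>\<pi>)"
      proof (rule nn_integral_mono)
        fix z
        show "indicator far z \<le> ennreal (1 / \<rho>\<^sup>2) * ennreal (dist (fst z) (snd z) powr 2)"
        proof (cases "z \<in> far")
          case True
          then have "\<rho>\<^sup>2 \<le> (dist (fst z) (snd z))\<^sup>2" using \<rho> by (intro power_mono) (auto simp: far_def)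
          then have "1 \<le> 1 / \<rho>\<^sup>2 * (dist (fst z) (snd z) powr 2)" using \<rho> by (simp add: powr_numeral divide_simps)
          then show ?thesis using True by (simp add: ennreal_mult[symmetric] ennreal_ge_1)
        qed simp
      qed
      finally show ?thesis .
    qed
    also have "\<dots> = ennreal (1 / \<rho>\<^sup>2) * (\<integral>\<^sup>+ z. ennreal (dist (fst z) (snd z) powr 2) \<partial>\<pi>)"
      by (rule nn_integral_cmult) measurable
    also have "\<dots> < ennreal (1 / \<rho>\<^sup>2) * ennreal (\<rho>\<^sup>2 * m)"
      using \<pi>(2) \<rho> by (intro ennreal_mult_strict_left_mono) (auto simp: less_top)
    also have "\<dots> = ennreal m" using \<rho> m by (simp add: ennreal_mult[symmetric])
    finally have far: "measure \<pi> far < m" by (simp add: \<pi>.emeasure_eq_measure ennreal_less_iff)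
    have "emeasure \<pi> bad = emeasure (distr \<pi> borel snd) {x. (x, w) \<in> - P}"
      using badm by (subst emeasure_distr) (auto simp: bad_def sp vimage_def)
    then have bad: "measure \<pi> bad = 0" unfolding d2 w(3) by (simp add: measure_def)
    have "m = measure (distr \<pi> borel fst) (U n)" by (simp add: m_def d1)
    also have "\<dots> = measure \<pi> {z. fst z \<in> U n}"
      using Uc by (subst measure_distr) (auto simp: sp vimage_def)
    also have "\<dots> \<le> measure \<pi> (far \<union> bad)"
    proof (rule \<pi>.finite_measure_mono)
      show "{z :: real \<times> real. fst z \<in> U n} \<subseteq> far \<union> bad"
      proof
        fix z :: "real \<times> real" assume "z \<in> {z. fst z \<in> U n}"
        then have u: "2 * \<rho> \<le> infdist (fst z, \<omega>) P" by (simp add: U_def \<rho>_def)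
        show "z \<in> far \<union> bad"
        proof (rule ccontr)
          assume "z \<notin> far \<union> bad"
          then have "dist (fst z) (snd z) < \<rho>" "(snd z, w) \<in> P" by (auto simp: far_def bad_def)
          moreover then have "infdist (fst z, \<omega>) P \<le> dist (fst z, \<omega>) (snd z, w)" by (intro infdist_le)
          moreover have "dist (fst z, \<omega>) (snd z, w) \<le> dist (fst z) (snd z) + dist \<omega> w"
            unfolding dist_Pair_Pair by (rule sqrt_sum_squares_le_sum) auto
          ultimately show False using u w(2) \<eta>(2) by (simp add: dist_real_def)
        qed
      qed
    qed (use farm badm' in auto)
    also have "\<dots> \<le> measure \<pi> far + measure \<pi> bad"
      by (rule measure_Un_le[OF farm badm'])
    finally show False using far bad by simp
  qed
  have "AE x in K \<omega>. x \<notin> U n" for n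
  proof (rule AE_I'[of "U n"])
    show "U n \<in> null_sets (K \<omega>)" using U0[of n] Uc[of n] Ks by (auto simp: null_sets_def K.emeasure_eq_measure)
  qed auto
  then have "AE x in K \<omega>. \<forall>n. x \<notin> U n" by (simp add: AE_all_countable)
  then show ?thesis
  proof eventually_elim
    case (elim x)
    show ?case
    proof (rule ccontr)
      assume "(x, \<omega>) \<notin> msupp \<mu>"
      then have "0 < infdist (x, \<omega>) P" using Pc Pne by (simp add: P_def infdist_pos_not_in_closed)
      then obtain n where "1 / real (Suc n) < infdist (x, \<omega>) P / 2"
        using nat_approx_posE[of "infdist (x, \<omega>) P / 2"] by auto
      then have "x \<in> U n" by (simp add: U_def)
      then show False using elim by blast
    qed
  qed
qed

context kinetic
begin

definition "\<Delta>\<^sub>t s = lip * \<Delta> s"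

lemma msupp_snd: "m \<in> P2nu \<nu> \<Longrightarrow> z \<in> msupp m \<Longrightarrow> snd z \<in> \<Omega>"
proof -
  assume m: "m \<in> P2nu \<nu>" and z: "z \<in> msupp m"
  have "closed {z :: real \<times> real. snd z \<in> \<Omega>}"
    using closed_vimage_snd[OF closed_msupp[of \<nu>]] by (simp add: vimage_def)
  from msupp_subset_closed[OF P2nu_sets[OF m] this] P2nu_AE_Omega[OF m] z show ?thesis by auto
qed

end

locale kinetic_invariant = kinetic_solution +
  assumes start: "\<mu>0 \<in> C_nu \<nu> \<Delta> \<Delta>\<^sub>t"
begin

lemma bounded_support: "\<exists>R. AE z in \<mu>0. \<bar>fst z\<bar> \<le> R"
proof -
  interpret prob_space \<mu>0 by (rule P2nu_prob[OF mu0])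
  have ae: "AE z in \<mu>0. z \<in> msupp \<mu>0" by (rule AE_msupp[OF P2nu_sets[OF mu0]])
  then obtain z0 where z0: "z0 \<in> msupp \<mu>0" using AE_False by fastforce
  have "AE z in \<mu>0. \<bar>fst z\<bar> \<le> \<bar>fst z0\<bar> + \<Delta> (xc \<mu>0)"
    using ae
  proof eventually_elim
    case (elim z)
    then have "\<bar>fst z - fst z0\<bar> \<le> \<Delta> (xc \<mu>0)" using start z0 by (auto simp: C_nu_def)
    then show ?case by linarith
  qed
  then show ?thesis by blast
qed

lemma solution_transported:
  "0 \<le> T \<Longrightarrow> \<mu> T = distr \<mu>0 borel (\<lambda>z. (charac (fst z) (snd z) T, snd z))"
  using bounded_support transported[of T] by (auto simp: pushed_def)

text \<open>On the support of the datum all frequencies lie in \<Omega>, where the extended velocity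
  equals the flux, so the characteristics satisfy the original equation.\<close>

sublocale solution_flow: kinetic_flow \<nu> F A I M \<kappa> D \<gamma> \<omega>c \<Delta> \<mu>0 \<mu> "msupp \<mu>0" "\<lambda>t z. charac (fst z) (snd z) t"
proof
  show "\<mu>0 \<in> P2nu \<nu>" by (rule mu0)
  show "AE z in \<mu>0. z \<in> msupp \<mu>0" by (rule AE_msupp[OF P2nu_sets[OF mu0]])
  show "(\<lambda>z. charac (fst z) (snd z) t) \<in> borel_measurable borel" if "0 \<le> t" for t
    by (rule borel_measurable_continuous_onI[OF charac_continuous_space[OF that]])
  show "\<mu> t = distr \<mu>0 borel (\<lambda>z. (charac (fst z) (snd z) t, snd z))" if "0 \<le> t" for t
    by (rule solution_transported[OF that])
  show "((\<lambda>t. charac (fst z) (snd z) t) has_real_derivative F (\<mu> t) (charac (fst z) (snd z) t) (snd z)) (at t within {0..})"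
    if "z \<in> msupp \<mu>0" "0 \<le> t" for z t
    using charac_deriv[OF that(2), of "fst z" "snd z"] vel_eq[OF mu[OF that(2)] msupp_snd[OF mu0 that(1)]] by simp
  show "\<bar>fst z - fst z'\<bar> \<le> \<Delta> (xc \<mu>0)" if "z \<in> msupp \<mu>0" "z' \<in> msupp \<mu>0" for z z'
    using start that by (auto simp: C_nu_def)
qed (use mu mu_0 msupp_snd[OF mu0] charac_0 in auto)

theorem C_nu_invariant:
  assumes t: "0 \<le> t"
  shows "\<mu> t \<in> C_nu \<nu> \<Delta> \<Delta>\<^sub>t"
proof -
  let ?r = "solution_flow.r"
  let ?s = "xc (\<mu> t)"
  have r0: "?r 0 = \<Delta> (xc \<mu>0)" and rt: "?r t = \<Delta> ?s" by (simp_all add: solution_flow.r_def mu_0)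
  have rp: "0 < ?r 0" "0 < ?r t" using solution_flow.r_bounds by auto
  have dia: "\<bar>fst z - fst z'\<bar> \<le> \<Delta> ?s" if z: "z \<in> msupp (\<mu> t)" "z' \<in> msupp (\<mu> t)" for z z'
  proof -
    \<comment> \<open>The bound is known for images of support points. It is a closed condition of
      full measure in each variable separately, hence it passes to the support of
      \<open>\<mu> t\<close> one variable at a time.\<close>
    have d: "\<bar>charac (fst a) (snd a) t - charac (fst b) (snd b) t\<bar> \<le> \<Delta> ?s" if "a \<in> msupp \<mu>0" "b \<in> msupp \<mu>0" for a b
      using solution_flow.diam_invariant[OF t] that by (auto simp: solution_flow.diam_def rt)
    have cl: "closed {z :: real \<times> real. \<bar>fst z - c\<bar> \<le> \<Delta> ?s}" for c
      by (intro closed_Collect_le continuous_intros)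
    have 1: "\<bar>fst z - charac (fst b) (snd b) t\<bar> \<le> \<Delta> ?s" if b: "b \<in> msupp \<mu>0" for b
    proof -
      have "AE z in \<mu> t. \<bar>fst z - charac (fst b) (snd b) t\<bar> \<le> \<Delta> ?s"
        by (rule solution_flow.AE_mu[OF t]) (use d b cl in auto)
      with msupp_subset_closed[OF P2nu_sets[OF mu[OF t]] cl] z(1) show ?thesis by auto
    qed
    have "AE z' in \<mu> t. \<bar>fst z' - fst z\<bar> \<le> \<Delta> ?s"
      by (rule solution_flow.AE_mu[OF t _ cl]) (use 1 in \<open>auto simp: abs_minus_commute\<close>)
    then have "z' \<in> {z'. \<bar>fst z' - fst z\<bar> \<le> \<Delta> ?s}"
      using msupp_subset_closed[OF P2nu_sets[OF mu[OF t]] cl[of "fst z"]] z(2) by auto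
    then show ?thesis by (simp add: abs_minus_commute)
  qed
  obtain K where K: "disintegration \<nu> \<mu>0 K"
    and Kl: "\<And>\<omega> \<omega>'. \<omega> \<in> \<Omega> \<Longrightarrow> \<omega>' \<in> \<Omega> \<Longrightarrow> wcost 2 (K \<omega>) (K \<omega>') < \<top> \<and>
        wasserstein 2 (K \<omega>) (K \<omega>') \<le> \<Delta>\<^sub>t (xc \<mu>0) * \<bar>\<omega> - \<omega>'\<bar>"
    using start unfolding C_nu_def by blast
  have Kp: "prob_space (K w)" and Ks: "sets (K w) = sets borel" for w
    using K by (auto simp: disintegration_def)
  \<comment> \<open>The pointwise contraction estimate concerns particles in the support of the
    datum. It can be integrated against a coupling only because both conditional measures live on
    their sections of that support.\<close>
  have KP: "AE x in K \<omega>. (x, \<omega>) \<in> msupp \<mu>0" if "\<omega> \<in> \<Omega>" for \<omega>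
    by (rule disintegration_support[OF P2nu_prob[OF mu0] P2nu_sets[OF mu0] nu_sets K Kl that])
  have chm: "(\<lambda>x. charac x w t) \<in> borel_measurable borel" for w
    by (rule borel_measurable_continuous_onI)
       (use continuous_on_compose2[OF charac_continuous_space[OF t], of UNIV "\<lambda>x. (x, w)"] in
         \<open>simp add: continuous_on_Pair continuous_on_const continuous_on_id\<close>)
  \<comment> \<open>Each conditional measure is pushed forward along the characteristics of its own
    frequency, which the evolution leaves unchanged.\<close>
  define K' where "K' w = distr (K w) borel (\<lambda>x. charac x w t)" for w
  have chK: "(\<lambda>x. charac x w t) \<in> borel_measurable (K w)" for w
    using chm Ks by (simp cong: measurable_cong_sets)
  have spK: "space (K w) = UNIV" for w using sets_eq_imp_space_eq[OF Ks[of w]] by simp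
  have "disintegration \<nu> (\<mu> t) K'"
    unfolding disintegration_def
  proof (intro conjI allI ballI)
    fix w show "prob_space (K' w)" unfolding K'_def by (rule prob_space.prob_space_distr[OF Kp chK])
    show "sets (K' w) = sets borel" by (simp add: K'_def)
  next
    fix B :: "(real \<times> real) set" assume B: "B \<in> sets borel"
    define B' where "B' = {z. (charac (fst z) (snd z) t, snd z) \<in> B}"
    have "(\<lambda>z. (charac (fst z) (snd z) t, snd z)) \<in> borel_measurable borel"
      by (intro borel_measurable_continuous_onI continuous_on_Pair charac_continuous_space t continuous_intros)
    from measurable_sets[OF this B] have B': "B' \<in> sets borel" by (simp add: B'_def vimage_def)
    have sec: "{x. (x, w) \<in> B} \<in> sets borel" for w
      using measurable_sets[of "\<lambda>x. (x, w)" borel borel B] B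
      by (auto simp: vimage_def intro!: borel_measurable_continuous_onI continuous_intros)
    have e: "emeasure (K' w) {x. (x, w) \<in> B} = emeasure (K w) {x. (x, w) \<in> B'}" for w
      unfolding K'_def using sec by (subst emeasure_distr[OF chK]) (auto simp: B'_def vimage_def spK)
    show "(\<lambda>w. emeasure (K' w) {x. (x, w) \<in> B}) \<in> borel_measurable \<nu>"
      unfolding e using K B' by (auto simp: disintegration_def)
    have "emeasure (\<mu> t) B = emeasure \<mu>0 B'"
      unfolding solution_transported[OF t] using B
      by (subst emeasure_distr[OF meas_charac[OF t]]) (auto simp: B'_def vimage_def P2nu_space[OF mu0])
    then show "emeasure (\<mu> t) B = (\<integral>\<^sup>+ w. emeasure (K' w) {x. (x, w) \<in> B} \<partial>\<nu>)"
      unfolding e using K B' by (auto simp: disintegration_def)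
  qed
  moreover have "wcost 2 (K' \<omega>) (K' \<omega>') < \<top> \<and> wasserstein 2 (K' \<omega>) (K' \<omega>') \<le> \<Delta>\<^sub>t ?s * \<bar>\<omega> - \<omega>'\<bar>"
    if o: "\<omega> \<in> \<Omega>" "\<omega>' \<in> \<Omega>" for \<omega> \<omega>'
  proof -
    define \<theta> where "\<theta> = exp (- rate * t)"
    have \<theta>: "0 \<le> \<theta>" "\<theta> \<le> 1" using t rate_pos by (auto simp: \<theta>_def)
    define w where "w = lip * \<bar>\<omega> - \<omega>'\<bar>"
    have w: "0 \<le> w" using lip_pos by (simp add: w_def)
    define k where "k = enn2real (wcost 2 (K \<omega>) (K \<omega>'))"
    have k: "wcost 2 (K \<omega>) (K \<omega>') = ennreal k" "0 \<le> k" using Kl[OF o] by (auto simp: k_def)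
    have "sqrt k \<le> ?r 0 * w"
      using Kl[OF o] by (simp add: k_def wasserstein_def powr_half_sqrt w_def r0 \<Delta>\<^sub>t_def mult_ac)
    then have kle: "k \<le> (?r 0 * w)\<^sup>2" by (rule sqrt_le_D)
    \<comment> \<open>The squared contraction estimate reads \<open>a\<close> times the squared
      initial distance plus \<open>b\<close>. Inserting the largest initial cost
      \<open>(r 0 * w)\<^sup>2\<close> gives exactly \<open>(r t * w)\<^sup>2\<close>.\<close>
    define a where "a = (?r t)\<^sup>2 * \<theta> / (?r 0)\<^sup>2"
    define b where "b = (?r t)\<^sup>2 * (1 - \<theta>) * w\<^sup>2"
    have ab: "0 \<le> a" "0 \<le> b" using \<theta> by (auto simp: a_def b_def)
    have cost: "wcost 2 (K' \<omega>) (K' \<omega>') \<le> ennreal ((?r t * w)\<^sup>2) + ennreal e" if e: "0 < e" for e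
    proof -
      \<comment> \<open>The coupling is optimal only up to \<open>e'\<close>; the scaling turns the
        resulting error into at most \<open>e\<close>, and the summand 1 keeps the divisor
        positive.\<close>
      define e' where "e' = e / (a + 1)"
      have e': "0 < e'" "a * e' \<le> e" using e ab by (auto simp: e'_def field_simps)
      have "wcost 2 (K \<omega>) (K \<omega>') < ennreal (k + e')" unfolding k(1) using e' k by (simp add: ennreal_less_iff)
      then obtain \<pi> where \<pi>: "\<pi> \<in> couplings (K \<omega>) (K \<omega>')"
        "(\<integral>\<^sup>+ z. ennreal (dist (fst z) (snd z) powr 2) \<partial>\<pi>) < ennreal (k + e')"
        unfolding wcost_def INF_less_iff by blast
      interpret \<pi>: prob_space \<pi> using \<pi> by (simp add: couplings_def)
      have s\<pi>: "sets \<pi> = sets borel" and d1: "distr \<pi> borel fst = K \<omega>" and d2: "distr \<pi> borel snd = K \<omega>'"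
        using \<pi> by (auto simp: couplings_def)
      have [measurable_cong]: "sets \<pi> = sets borel" by (rule s\<pi>)
      note chm[measurable]
      have Kd: "K' \<omega> = distr \<pi> borel (\<lambda>z. charac (fst z) \<omega> t)" "K' \<omega>' = distr \<pi> borel (\<lambda>z. charac (snd z) \<omega>' t)"
        unfolding K'_def d1[symmetric] d2[symmetric] by (simp_all add: distr_distr o_def)
      have "AE z in distr \<pi> borel fst. (z, \<omega>) \<in> msupp \<mu>0" "AE z in distr \<pi> borel snd. (z, \<omega>') \<in> msupp \<mu>0"
        using KP[OF o(1)] KP[OF o(2)] by (simp_all only: d1 d2)
      then have "AE z in \<pi>. (fst z, \<omega>) \<in> msupp \<mu>0" "AE z in \<pi>. (snd z, \<omega>') \<in> msupp \<mu>0"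
        by (auto dest!: AE_distrD[rotated])
      then have pt: "AE z in \<pi>. ennreal (dist (charac (fst z) \<omega> t) (charac (snd z) \<omega>' t) powr 2) \<le>
          ennreal a * ennreal (dist (fst z) (snd z) powr 2) + ennreal b"
      proof eventually_elim
        case (elim z)
        define q where "q = \<bar>fst z - snd z\<bar> / ?r 0"
        have q: "0 \<le> q" using rp by (simp add: q_def)
        have "\<bar>charac (fst z) \<omega> t - charac (snd z) \<omega>' t\<bar> \<le> ?r t * (\<theta> * q + (1 - \<theta>) * w)"
          using solution_flow.lipschitz_invariant[OF t elim] by (simp add: \<theta>_def q_def w_def)
        then have "\<bar>charac (fst z) \<omega> t - charac (snd z) \<omega>' t\<bar>\<^sup>2 \<le> (?r t * (\<theta> * q + (1 - \<theta>) * w))\<^sup>2"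
          by (intro power_mono) auto
        also have "\<dots> = (?r t)\<^sup>2 * (\<theta> * q + (1 - \<theta>) * w)\<^sup>2" by (rule power_mult_distrib)
        \<comment> \<open>Convexity of the square; it turns the pointwise convex combination into
          one that can be integrated against the coupling.\<close>
        also have "\<dots> \<le> (?r t)\<^sup>2 * (\<theta> * q\<^sup>2 + (1 - \<theta>) * w\<^sup>2)"
        proof (rule mult_left_mono)
          have "\<theta> * q\<^sup>2 + (1 - \<theta>) * w\<^sup>2 - (\<theta> * q + (1 - \<theta>) * w)\<^sup>2 = \<theta> * (1 - \<theta>) * (q - w)\<^sup>2"
            by (simp add: power2_eq_square algebra_simps)
          also have "\<dots> \<ge> 0" using \<theta> by simp
          finally show "(\<theta> * q + (1 - \<theta>) * w)\<^sup>2 \<le> \<theta> * q\<^sup>2 + (1 - \<theta>) * w\<^sup>2" by simp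
        qed simp
        also have "\<dots> = a * \<bar>fst z - snd z\<bar>\<^sup>2 + b"
          by (simp add: a_def b_def q_def power_divide algebra_simps)
        finally have "dist (charac (fst z) \<omega> t) (charac (snd z) \<omega>' t) powr 2 \<le> a * dist (fst z) (snd z) powr 2 + b"
          by (simp add: dist_real_def powr_numeral)
        then have "ennreal (dist (charac (fst z) \<omega> t) (charac (snd z) \<omega>' t) powr 2) \<le> ennreal (a * dist (fst z) (snd z) powr 2 + b)"
          by (rule ennreal_leI)
        then show ?case using ab by (simp add: ennreal_plus ennreal_mult)
      qed
      have "wcost 2 (K' \<omega>) (K' \<omega>') \<le> (\<integral>\<^sup>+ z. ennreal (dist (charac (fst z) \<omega> t) (charac (snd z) \<omega>' t) powr 2) \<partial>\<pi>)"
        unfolding Kd by (rule wcost_distr_le[OF \<pi>.prob_space_axioms]) measurable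
      also have "\<dots> \<le> (\<integral>\<^sup>+ z. ennreal a * ennreal (dist (fst z) (snd z) powr 2) + ennreal b \<partial>\<pi>)"
        by (rule nn_integral_mono_AE[OF pt])
      also have "\<dots> = ennreal a * (\<integral>\<^sup>+ z. ennreal (dist (fst z) (snd z) powr 2) \<partial>\<pi>) + ennreal b"
        by (subst nn_integral_add) (auto simp: nn_integral_cmult \<pi>.emeasure_space_1)
      also have "\<dots> \<le> ennreal a * ennreal (k + e') + ennreal b"
        using \<pi>(2) by (intro add_right_mono mult_left_mono) (auto simp: less_imp_le)
      also have "\<dots> = ennreal (a * (k + e') + b)"
        using ab k e' by (simp add: ennreal_plus ennreal_mult)
      also have "\<dots> \<le> ennreal ((?r t * w)\<^sup>2 + e)"
      proof (rule ennreal_leI)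
        have "a * k \<le> a * (?r 0 * w)\<^sup>2" using kle ab(1) by (rule mult_left_mono)
        also have "\<dots> = (?r t)\<^sup>2 * \<theta> * w\<^sup>2" using rp by (simp add: a_def power_mult_distrib)
        finally have "a * k + b \<le> (?r t * w)\<^sup>2" by (simp add: b_def power_mult_distrib algebra_simps)
        then show "a * (k + e') + b \<le> (?r t * w)\<^sup>2 + e" using e'(2) by (simp add: distrib_left)
      qed
      also have "\<dots> = ennreal ((?r t * w)\<^sup>2) + ennreal e" using e by (simp add: ennreal_plus)
      finally show ?thesis .
    qed
    have c: "wcost 2 (K' \<omega>) (K' \<omega>') \<le> ennreal ((?r t * w)\<^sup>2)"
      by (rule ennreal_le_epsilon[OF cost])
    then have "enn2real (wcost 2 (K' \<omega>) (K' \<omega>')) \<le> (?r t * w)\<^sup>2"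
      using enn2real_mono[OF c] by simp
    then have "wasserstein 2 (K' \<omega>) (K' \<omega>') \<le> sqrt ((?r t * w)\<^sup>2)"
      by (simp add: wasserstein_def powr_half_sqrt del: real_sqrt_abs)
    also have "\<dots> = \<Delta>\<^sub>t ?s * \<bar>\<omega> - \<omega>'\<bar>" using rp w lip_pos Delta_range[of ?s]
      by (simp add: w_def \<Delta>\<^sub>t_def rt mult_ac abs_mult)
    finally show ?thesis using le_less_trans[OF c ennreal_less_top] by blast
  qed
  ultimately show ?thesis
    using mu[OF t] dia unfolding C_nu_def by blast
qed

end

section \<open>Solutions carried by graphs\<close>

lemma bounded_linear_apply_bcontfun: "bounded_linear (\<lambda>X :: 'a::topological_space \<Rightarrow>\<^sub>C 'b::real_normed_vector. apply_bcontfun X u)"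
proof (rule bounded_linear_intro[where K=1])
  fix X Y :: "'a \<Rightarrow>\<^sub>C 'b" and c :: real
  show "apply_bcontfun (X + Y) u = apply_bcontfun X u + apply_bcontfun Y u"
    by (simp add: plus_bcontfun.rep_eq)
  show "apply_bcontfun (c *\<^sub>R X) u = c *\<^sub>R apply_bcontfun X u"
    by (simp add: scaleR_bcontfun.rep_eq)
  show "norm (apply_bcontfun X u) \<le> norm X * 1"
    using norm_bounded[of X u] by simp
qed

lemma bcontfun_diff_bound: "\<bar>apply_bcontfun X u - apply_bcontfun Y u\<bar> \<le> norm (X - Y)" for X Y :: "real \<Rightarrow>\<^sub>C real"
  using norm_bounded[of "X - Y" u] by (simp add: minus_bcontfun.rep_eq)

text \<open>Makes the Picard iteration available for paths of bounded continuous functions.\<close>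

instance bcontfun :: (metric_space, banach) banach ..

context kinetic
begin

interpretation \<nu>: prob_space \<nu> by (rule nu_prob)

lemma meas_graph: "X \<in> borel_measurable borel \<Longrightarrow> (\<lambda>\<omega>. (X \<omega>, \<omega>)) \<in> borel_measurable \<nu>"
  for X :: "real \<Rightarrow> real"
  unfolding nu_borel by (rule borel_measurable_Pair) simp_all

lemma graph_cong:
  fixes X Y :: "real \<Rightarrow> real"
  assumes "\<And>\<omega>. \<omega> \<in> \<Omega> \<Longrightarrow> X \<omega> = Y \<omega>" "X \<in> borel_measurable borel" "Y \<in> borel_measurable borel"
  shows "graph_measure X = graph_measure Y"
  unfolding graph_measure_def
proof (rule distr_cong_AE)
  show "AE \<omega> in \<nu>. (X \<omega>, \<omega>) = (Y \<omega>, \<omega>)" using AE_Omega by eventually_elim (simp add: assms(1))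
qed (use assms in \<open>auto intro!: meas_graph\<close>)

lemma graph_bounded_P2nu:
  assumes X: "X \<in> borel_measurable borel" and B: "\<And>\<omega>. \<omega> \<in> \<Omega> \<Longrightarrow> \<bar>X \<omega>\<bar> \<le> B"
  shows "graph_measure X \<in> P2nu \<nu>" "integrable \<nu> X"
proof -
  have b: "AE \<omega> in \<nu>. norm (X \<omega>) \<le> B" using AE_Omega by eventually_elim (simp add: B)
  have "AE \<omega> in \<nu>. norm ((X \<omega>)\<^sup>2) \<le> B\<^sup>2"
    using b by eventually_elim (simp add: abs_le_square_iff[symmetric])
  then have "integrable \<nu> (\<lambda>\<omega>. (X \<omega>)\<^sup>2)"
    by (rule \<nu>.integrable_const_bound) (use X in \<open>simp add: nu_borel\<close>)
  then show "graph_measure X \<in> P2nu \<nu>" by (rule graph_measure_P2nu[OF X])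
  show "integrable \<nu> X" by (rule \<nu>.integrable_const_bound[OF b]) (use X in \<open>simp add: nu_borel\<close>)
qed

lemma xc_graph: "X \<in> borel_measurable borel \<Longrightarrow> xc (graph_measure X) = (\<integral>\<omega>. X \<omega> \<partial>\<nu>)"
  unfolding xc_def graph_measure_def by (subst integral_distr[OF meas_graph]) auto

lemma wasserstein_graph:
  assumes "X \<in> borel_measurable borel" "Y \<in> borel_measurable borel" "0 < p"
    and d: "\<And>\<omega>. \<omega> \<in> \<Omega> \<Longrightarrow> \<bar>X \<omega> - Y \<omega>\<bar> \<le> d"
  shows "wasserstein p (graph_measure X) (graph_measure Y) \<le> d"
proof -
  obtain \<omega>0 where "\<omega>0 \<in> \<Omega>" using Omega_ne by blast
  then have "0 \<le> d" using d[of \<omega>0] by linarith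
  then show ?thesis
    unfolding graph_measure_def
    by (intro wasserstein_distr_le(2)[OF nu_prob] meas_graph assms)
       (use AE_Omega in \<open>auto elim!: eventually_mono simp: dist_Pair_Pair dist_real_def d\<close>)
qed

text \<open>Stated for functions without continuity in the frequency and with the equation only on
  \<Omega>, so that it covers the constructed trajectories, the characteristics of an arbitrary
  solution and time-shifted trajectories alike.\<close>

definition graph_sol :: "(real \<Rightarrow> real \<Rightarrow> real) \<Rightarrow> bool" where
  "graph_sol Y \<longleftrightarrow> (\<forall>t\<ge>0. Y t \<in> borel_measurable borel) \<and>
     (\<forall>T. \<exists>B. \<forall>t\<in>{0..T}. \<forall>\<omega>\<in>\<Omega>. \<bar>Y t \<omega>\<bar> \<le> B) \<and>
     (\<forall>\<omega>\<in>\<Omega>. \<forall>t\<ge>0. ((\<lambda>t. Y t \<omega>) has_real_derivative F (graph_measure (Y t)) (Y t \<omega>) \<omega>) (at t within {0..}))"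

lemma graph_sol_P2nu: "graph_sol Y \<Longrightarrow> 0 \<le> t \<Longrightarrow> graph_measure (Y t) \<in> P2nu \<nu>"
proof -
  assume a: "graph_sol Y" and t: "0 \<le> t"
  then obtain B where "\<forall>t\<in>{0..t}. \<forall>\<omega>\<in>\<Omega>. \<bar>Y t \<omega>\<bar> \<le> B" unfolding graph_sol_def by blast
  then show ?thesis using a t by (intro graph_bounded_P2nu(1)[of "Y t" B]) (auto simp: graph_sol_def)
qed

text \<open>The summand \<open>\<kappa> * I\<close> accounts for the position; the doubled
  \<open>\<kappa> * M\<close> leaves only half of the dependence on the measure in the weighted
  estimate.\<close>

definition "growth = \<kappa> * I + 2 * (\<kappa> * M)"

text \<open>The measures depend on all particles at once, so the particles cannot be compared one by
  one with a closed inequality. A weighted supremum over times and frequencies closes the estimate;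
  with \<open>d = 0\<close> it becomes uniqueness.\<close>

lemma graph_sol_stable:
  assumes Y: "graph_sol Y" and Z: "graph_sol Z" and d: "\<And>\<omega>. \<omega> \<in> \<Omega> \<Longrightarrow> \<bar>Y 0 \<omega> - Z 0 \<omega>\<bar> \<le> d"
    and t: "0 \<le> t" and \<omega>: "\<omega> \<in> \<Omega>"
  shows "\<bar>Y t \<omega> - Z t \<omega>\<bar> \<le> 2 * d * exp (growth * t)"
proof -
  have d0: "0 \<le> d" using d[OF \<omega>] by linarith
  define N where "N p = \<bar>Y (fst p) (snd p) - Z (fst p) (snd p)\<bar> * exp (- growth * fst p)" for p
  define S where "S = (SUP p\<in>{0..t} \<times> \<Omega>. N p)"
  have g0: "0 \<le> growth" using kI kM by (simp add: growth_def)
  obtain B1 B2 where B: "\<And>s w. s \<in> {0..t} \<Longrightarrow> w \<in> \<Omega> \<Longrightarrow> \<bar>Y s w\<bar> \<le> B1" "\<And>s w. s \<in> {0..t} \<Longrightarrow> w \<in> \<Omega> \<Longrightarrow> \<bar>Z s w\<bar> \<le> B2"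
    using Y Z unfolding graph_sol_def by metis
  have bdd: "bdd_above (N ` ({0..t} \<times> \<Omega>))"
  proof (rule bdd_aboveI2[where M="(B1 + B2) * 1"])
    fix p assume p: "p \<in> {0..t} \<times> \<Omega>"
    then have "\<bar>Y (fst p) (snd p) - Z (fst p) (snd p)\<bar> \<le> B1 + B2"
      using B(1)[of "fst p" "snd p"] B(2)[of "fst p" "snd p"] by auto
    then show "N p \<le> (B1 + B2) * 1"
      unfolding N_def using p g0 by (intro mult_mono) (auto simp: mult_nonneg_nonneg)
  qed
  have NS: "\<bar>Y s w - Z s w\<bar> \<le> S * exp (growth * s)" if "s \<in> {0..t}" "w \<in> \<Omega>" for s w
  proof -
    have "N (s, w) \<le> S" unfolding S_def by (rule cSUP_upper[OF _ bdd]) (use that in auto)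
    then have "N (s, w) * exp (growth * s) \<le> S * exp (growth * s)" by (rule mult_right_mono) simp
    then show ?thesis by (simp add: N_def mult.assoc exp_add[symmetric])
  qed
  have S0: "0 \<le> S"
  proof -
    have "0 \<le> N (0, \<omega>)" by (simp add: N_def)
    also have "\<dots> \<le> S" unfolding S_def by (rule cSUP_upper[OF _ bdd]) (use t \<omega> in auto)
    finally show ?thesis .
  qed
  have le: "a s w - b s w \<le> (d + S / 2) * exp (growth * s)"
    if ab: "graph_sol a" "graph_sol b" "\<And>s w. \<bar>a s w - b s w\<bar> = \<bar>Y s w - Z s w\<bar>"
      and s: "s \<in> {0..t}" and w: "w \<in> \<Omega>" for a b s w
  proof (rule diff_ineq_le[where a=0 and L="\<kappa> * I" and p="\<lambda>t. a t w - b t w"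
        and p'="\<lambda>t. F (graph_measure (a t)) (a t w) w - F (graph_measure (b t)) (b t w) w"
        and z="\<lambda>s. (d + S / 2) * exp (growth * s)" and z'="\<lambda>s. growth * ((d + S / 2) * exp (growth * s))"])
    show "0 \<le> s" using s by simp
    fix v assume v: "v \<in> {0..s}"
    have v0: "0 \<le> v" "v \<in> {0..t}" using v s by auto
    show "((\<lambda>t. a t w - b t w) has_real_derivative F (graph_measure (a v)) (a v w) w - F (graph_measure (b v)) (b v w) w) (at v within {0..s})"
      by (intro DERIV_diff; rule DERIV_subset[where s="{0..}"]) (use ab w v0 in \<open>auto simp: graph_sol_def\<close>)
    show "((\<lambda>s. (d + S / 2) * exp (growth * s)) has_real_derivative growth * ((d + S / 2) * exp (growth * v))) (at v within {0..s})"
      by (auto intro!: derivative_eq_intros)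
    let ?z = "(d + S / 2) * exp (growth * v)" and ?p = "a v w - b v w"
    assume g: "?z < ?p"
    have z0: "0 \<le> ?z" using d0 S0 by simp
    have ma: "graph_measure (a v) \<in> P2nu \<nu>" "graph_measure (b v) \<in> P2nu \<nu>" using graph_sol_P2nu ab v0 by auto
    have "wasserstein 1 (graph_measure (a v)) (graph_measure (b v)) \<le> S * exp (growth * v)"
      by (rule wasserstein_graph) (use ab NS[OF v0(2)] v0 in \<open>auto simp: graph_sol_def\<close>)
    then have "\<kappa> * M * wasserstein 1 (graph_measure (a v)) (graph_measure (b v)) \<le> \<kappa> * M * (S * exp (growth * v))"
      using kM by (rule mult_left_mono)
    then have 1: "F (graph_measure (a v)) (b v w) w - F (graph_measure (b v)) (b v w) w \<le> \<kappa> * M * (S * exp (growth * v))"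
      using A1[OF ma w, of "b v w"] by linarith
    have 2: "F (graph_measure (a v)) (a v w) w - F (graph_measure (a v)) (b v w) w \<le> \<kappa> * I * ?p"
      using F_lip_x[OF ma(1), of "a v w" w "b v w"] g z0 by simp
    have "growth * ?z = \<kappa> * I * ?z + \<kappa> * M * (2 * d * exp (growth * v)) + \<kappa> * M * (S * exp (growth * v))"
      by (simp add: growth_def algebra_simps)
    moreover have "0 \<le> \<kappa> * M * (2 * d * exp (growth * v))" using kM d0 by simp
    ultimately show "F (graph_measure (a v)) (a v w) w - F (graph_measure (b v)) (b v w) w - growth * ?z \<le> \<kappa> * I * (?p - ?z)"
      using 1 2 unfolding right_diff_distrib by linarith
  next
    show "a 0 w - b 0 w \<le> (d + S / 2) * exp (growth * 0)"
      using d[OF w] ab(3)[of 0 w] S0 by simp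
  qed
  have half: "\<bar>Y s w - Z s w\<bar> \<le> (d + S / 2) * exp (growth * s)" if "s \<in> {0..t}" "w \<in> \<Omega>" for s w
    using le[OF Y Z _ that] le[OF Z Y _ that] by (simp add: abs_le_iff abs_minus_commute)
  \<comment> \<open>Absorption: since \<open>S\<close> is finite, the term \<open>S / 2\<close>
    moves to the left. The boundedness clause of \<open>graph_sol\<close> ensures the
    finiteness.\<close>
  have "S \<le> d + S / 2"
    unfolding S_def
  proof (rule cSUP_least)
    show "{0..t} \<times> \<Omega> \<noteq> {}" using t \<omega> by auto
    fix p assume p: "p \<in> {0..t} \<times> \<Omega>"
    then have "\<bar>Y (fst p) (snd p) - Z (fst p) (snd p)\<bar> \<le> (d + S / 2) * exp (growth * fst p)" by (intro half) auto
    then have "N p \<le> (d + S / 2) * exp (growth * fst p) * exp (- growth * fst p)"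
      unfolding N_def by (rule mult_right_mono) simp
    then show "N p \<le> d + (SUP p\<in>{0..t} \<times> \<Omega>. N p) / 2"
      by (simp add: mult.assoc exp_add[symmetric] S_def)
  qed
  then have "S \<le> 2 * d" by simp
  then have "S * exp (growth * t) \<le> 2 * d * exp (growth * t)" by (intro mult_right_mono) auto
  moreover have "\<bar>Y t \<omega> - Z t \<omega>\<bar> \<le> S * exp (growth * t)" using NS[of t \<omega>] t \<omega> by simp
  ultimately show ?thesis by linarith
qed

section \<open>The motion of graphs as a differential equation for bounded continuous
  functions\<close>

abbreviation graph_of :: "(real \<Rightarrow>\<^sub>C real) \<Rightarrow> (real \<times> real) measure" where
  "graph_of X \<equiv> graph_measure (apply_bcontfun X)"

lemma bcontfun_measurable: "apply_bcontfun X \<in> borel_measurable borel" for X :: "real \<Rightarrow>\<^sub>C real"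
  by (rule borel_measurable_continuous_onI) simp

lemma graph_of_P2nu: "graph_of X \<in> P2nu \<nu>"
  by (rule graph_bounded_P2nu(1)[OF bcontfun_measurable, where B="norm X"])
     (use norm_bounded[of X] in simp)

lemma bcontfun_integrable: "integrable \<nu> (apply_bcontfun X)" for X :: "real \<Rightarrow>\<^sub>C real"
  by (rule graph_bounded_P2nu(2)[OF bcontfun_measurable, where B="norm X"])
     (use norm_bounded[of X] in simp)

definition field :: "(real \<Rightarrow>\<^sub>C real) \<Rightarrow> (real \<Rightarrow>\<^sub>C real)" where
  "field X = Bcontfun (\<lambda>u. vel (graph_of X) (apply_bcontfun X u) u)"

lemma vel_continuous: "m \<in> P2nu \<nu> \<Longrightarrow> continuous_on UNIV (\<lambda>z. vel m (fst z) (snd z))"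
proof (rule continuous_at_imp_continuous_on, rule ballI)
  fix z :: "real \<times> real" assume m: "m \<in> P2nu \<nu>"
  have "((\<lambda>z'. \<kappa> * I * \<bar>fst z' - fst z\<bar> + I * \<bar>snd z' - snd z\<bar>) \<longlongrightarrow>
     \<kappa> * I * \<bar>fst z - fst z\<bar> + I * \<bar>snd z - snd z\<bar>) (at z)"
    by (intro tendsto_intros)
  then have "((\<lambda>z'. \<kappa> * I * \<bar>fst z' - fst z\<bar> + I * \<bar>snd z' - snd z\<bar>) \<longlongrightarrow> 0) (at z)" by simp
  moreover have "\<forall>\<^sub>F z' in at z. norm (vel m (fst z') (snd z') - vel m (fst z) (snd z)) \<le> \<kappa> * I * \<bar>fst z' - fst z\<bar> + I * \<bar>snd z' - snd z\<bar>"
  proof (intro always_eventually allI)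
    fix z' show "norm (vel m (fst z') (snd z') - vel m (fst z) (snd z)) \<le> \<kappa> * I * \<bar>fst z' - fst z\<bar> + I * \<bar>snd z' - snd z\<bar>"
    using vel_lip_x[OF m, of "fst z'" "snd z'" "fst z"] vel_lip_w[OF m, of "fst z" "snd z'" "snd z"] unfolding real_norm_def by linarith
  qed
  ultimately have "((\<lambda>z'. vel m (fst z') (snd z') - vel m (fst z) (snd z)) \<longlongrightarrow> 0) (at z)"
    by (rule Lim_null_comparison[rotated])
  then show "isCont (\<lambda>z. vel m (fst z) (snd z)) z" by (simp add: isCont_def LIM_zero_iff)
qed

text \<open>What has to be checked is that the field takes values in the bounded continuous
  functions. Lipschitz dependence on the frequency alone would allow linear growth; clamping limits
  it to \<open>[-Rad, Rad]\<close>.\<close>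

lemma field_apply: "apply_bcontfun (field X) u = vel (graph_of X) (apply_bcontfun X u) u"
proof -
  have "(\<lambda>u. vel (graph_of X) (apply_bcontfun X u) u) \<in> bcontfun"
  proof (rule bcontfun_normI)
    show "continuous_on UNIV (\<lambda>u. vel (graph_of X) (apply_bcontfun X u) u)"
      using continuous_on_compose2[OF vel_continuous[OF graph_of_P2nu], of UNIV "\<lambda>u. (apply_bcontfun X u, u)"]
      by (simp add: continuous_on_Pair continuous_on_id)
    fix u
    have "\<bar>vel (graph_of X) (apply_bcontfun X u) u - vel (graph_of X) 0 u\<bar> \<le> \<kappa> * I * norm X"
      using vel_lip_x[OF graph_of_P2nu, of X "apply_bcontfun X u" u 0]
        mult_left_mono[OF norm_bounded[of X u] kI] by simp
    moreover have "\<bar>vel (graph_of X) 0 (clamp_sym Rad u) - vel (graph_of X) 0 0\<bar> \<le> I * Rad"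
      using vel_lip_w[OF graph_of_P2nu, of X 0 "clamp_sym Rad u" 0]
        mult_left_mono[OF clamp_sym_bound[of Rad u] I0] Rad(1) by simp
    ultimately show "norm (vel (graph_of X) (apply_bcontfun X u) u) \<le> \<kappa> * I * norm X + I * Rad + \<bar>vel (graph_of X) 0 0\<bar>"
      unfolding vel_clamp real_norm_def by linarith
  qed
  then show ?thesis by (simp add: field_def Bcontfun_inverse)
qed

lemma field_lipschitz: "norm (field X - field Y) \<le> \<kappa> * (I + M) * norm (X - Y)"
proof (rule norm_bound)
  fix u
  have "wasserstein 1 (graph_of X) (graph_of Y) \<le> norm (X - Y)"
    by (rule wasserstein_graph) (auto simp: bcontfun_measurable bcontfun_diff_bound)
  then have "\<kappa> * M * wasserstein 1 (graph_of X) (graph_of Y) \<le> \<kappa> * M * norm (X - Y)"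
    using kM by (rule mult_left_mono)
  then have 1: "\<bar>vel (graph_of X) (apply_bcontfun Y u) u - vel (graph_of Y) (apply_bcontfun Y u) u\<bar> \<le> \<kappa> * M * norm (X - Y)"
    using vel_lip_measure[OF graph_of_P2nu[of X] graph_of_P2nu[of Y], of "apply_bcontfun Y u" u] by linarith
  have 2: "\<bar>vel (graph_of X) (apply_bcontfun X u) u - vel (graph_of X) (apply_bcontfun Y u) u\<bar> \<le> \<kappa> * I * norm (X - Y)"
    using vel_lip_x[OF graph_of_P2nu, of X "apply_bcontfun X u" u "apply_bcontfun Y u"]
      mult_left_mono[OF bcontfun_diff_bound[of X u Y] kI] by linarith
  have "\<kappa> * (I + M) * norm (X - Y) = \<kappa> * I * norm (X - Y) + \<kappa> * M * norm (X - Y)" by (simp add: algebra_simps)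
  with 1 2 show "norm (apply_bcontfun (field X - field Y) u) \<le> \<kappa> * (I + M) * norm (X - Y)"
    unfolding minus_bcontfun.rep_eq field_apply real_norm_def by linarith
qed

lemma traj_ex: "\<exists>X. X 0 = X\<^sub>0 \<and> (\<forall>t\<ge>0. (X has_vector_derivative field (X t)) (at t within {0..}))"
  by (rule picard_lindelof_global[where L="\<kappa> * (I + M)" and f="\<lambda>t. field"])
     (use pos in \<open>auto intro: field_lipschitz\<close>)

definition traj :: "(real \<Rightarrow>\<^sub>C real) \<Rightarrow> real \<Rightarrow> (real \<Rightarrow>\<^sub>C real)" where
  "traj X\<^sub>0 = (SOME X. X 0 = X\<^sub>0 \<and> (\<forall>t\<ge>0. (X has_vector_derivative field (X t)) (at t within {0..})))"

lemma traj_0: "traj X\<^sub>0 0 = X\<^sub>0"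
  and traj_deriv: "0 \<le> t \<Longrightarrow> (traj X\<^sub>0 has_vector_derivative field (traj X\<^sub>0 t)) (at t within {0..})"
  using someI_ex[OF traj_ex[of X\<^sub>0]] by (simp_all add: traj_def)

lemma traj_continuous: "continuous_on {0..} (traj X\<^sub>0)"
  by (rule continuous_on_vector_derivative) (use traj_deriv in auto)

lemma traj_pointwise:
  assumes "0 \<le> t"
  shows "((\<lambda>t. apply_bcontfun (traj X\<^sub>0 t) u) has_real_derivative
    vel (graph_of (traj X\<^sub>0 t)) (apply_bcontfun (traj X\<^sub>0 t) u) u) (at t within {0..})"
  using bounded_linear.has_vector_derivative[OF bounded_linear_apply_bcontfun[of u] traj_deriv[OF assms, of X\<^sub>0]]
  by (simp add: field_apply has_real_derivative_iff_has_vector_derivative)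

lemma field_continuous: "continuous_on UNIV field"
proof (rule continuous_at_imp_continuous_on, rule ballI)
  fix X :: "real \<Rightarrow>\<^sub>C real"
  have "((\<lambda>Y. \<kappa> * (I + M) * norm (Y - X)) \<longlongrightarrow> \<kappa> * (I + M) * norm (X - X)) (at X)" by (intro tendsto_intros)
  then have "((\<lambda>Y. \<kappa> * (I + M) * norm (Y - X)) \<longlongrightarrow> 0) (at X)" by simp
  then have "((\<lambda>Y. field Y - field X) \<longlongrightarrow> 0) (at X)"
    by (rule Lim_null_comparison[rotated]) (simp add: field_lipschitz)
  then show "isCont field X" by (simp add: isCont_def LIM_zero_iff)
qed

lemma traj_bounds: "\<exists>B. \<forall>t\<in>{0..T}. norm (traj X\<^sub>0 t) \<le> B \<and> norm (field (traj X\<^sub>0 t)) \<le> B"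
proof -
  have c: "continuous_on {0..T} (traj X\<^sub>0)" by (rule continuous_on_subset[OF traj_continuous]) auto
  have "bounded (traj X\<^sub>0 ` {0..T})" "bounded ((\<lambda>t. field (traj X\<^sub>0 t)) ` {0..T})"
    by (auto intro!: compact_imp_bounded compact_continuous_image c continuous_on_compose2[OF field_continuous c])
  then obtain B1 B2 where "\<forall>t\<in>{0..T}. norm (traj X\<^sub>0 t) \<le> B1" "\<forall>t\<in>{0..T}. norm (field (traj X\<^sub>0 t)) \<le> B2"
    by (auto simp: bounded_iff)
  then show ?thesis by (intro exI[of _ "max B1 B2"]) fastforce
qed

lemma traj_graph_sol: "graph_sol (\<lambda>t. apply_bcontfun (traj X\<^sub>0 t))"
  unfolding graph_sol_def
proof (intro conjI allI impI ballI)
  fix T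
  obtain B where B: "\<forall>t\<in>{0..T}. norm (traj X\<^sub>0 t) \<le> B" using traj_bounds by blast
  have "\<bar>apply_bcontfun (traj X\<^sub>0 t) \<omega>\<bar> \<le> B" if "t \<in> {0..T}" for t \<omega>
    using norm_bounded[of "traj X\<^sub>0 t" \<omega>] B that by fastforce
  then show "\<exists>B. \<forall>t\<in>{0..T}. \<forall>\<omega>\<in>\<Omega>. \<bar>apply_bcontfun (traj X\<^sub>0 t) \<omega>\<bar> \<le> B" by blast
next
  fix \<omega> and t :: real assume "\<omega> \<in> \<Omega>" "0 \<le> t"
  then show "((\<lambda>t. apply_bcontfun (traj X\<^sub>0 t) \<omega>) has_real_derivative
      F (graph_of (traj X\<^sub>0 t)) (apply_bcontfun (traj X\<^sub>0 t) \<omega>) \<omega>) (at t within {0..})"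
    using traj_pointwise[of t X\<^sub>0 \<omega>] vel_eq[OF graph_of_P2nu] by simp
qed (rule bcontfun_measurable)

text \<open>All integrals against the graph measure become integrals over the fixed measure \<nu>.
  The weak equation is then the fundamental theorem of calculus, after differentiation of the test
  function along each particle.\<close>

theorem traj_mv_solution: "mv_solution F \<nu> (graph_of X\<^sub>0) (\<lambda>t. graph_of (traj X\<^sub>0 t))"
  unfolding mv_solution_def
proof (intro conjI allI impI)
  let ?X = "traj X\<^sub>0"
  show "graph_of (?X 0) = graph_of X\<^sub>0" by (simp add: traj_0)
  show "graph_of (?X t) \<in> P2nu \<nu>" for t by (rule graph_of_P2nu)
  have Xt: "(?X \<longlongrightarrow> ?X t) (at t within {0..})" if "0 \<le> t" for t
    using traj_continuous that by (auto simp: continuous_on_def)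
  show "((\<lambda>s. wasserstein 2 (graph_of (?X s)) (graph_of (?X t))) \<longlongrightarrow> 0) (at t within {0..})" if t: "0 \<le> t" for t
  proof (rule Lim_null_comparison)
    show "((\<lambda>s. norm (?X s - ?X t)) \<longlongrightarrow> 0) (at t within {0..})"
      using tendsto_norm_zero[OF LIM_zero[OF Xt[OF t]]] .
    have "wasserstein 2 (graph_of (?X s)) (graph_of (?X t)) \<le> norm (?X s - ?X t)" for s
      by (rule wasserstein_graph) (auto simp: bcontfun_measurable bcontfun_diff_bound)
    then show "\<forall>\<^sub>F s in at t within {0..}. norm (wasserstein 2 (graph_of (?X s)) (graph_of (?X t))) \<le> norm (?X s - ?X t)"
      by (simp add: wasserstein_def)
  qed
  have mg: "(\<lambda>\<omega>. (apply_bcontfun (?X s) \<omega>, \<omega>)) \<in> borel_measurable \<nu>" for s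
    by (rule meas_graph[OF bcontfun_measurable])
  have pc: "continuous_on UNIV (\<lambda>\<omega>. (apply_bcontfun (?X s) \<omega>, \<omega>))" for s
    by (intro continuous_on_Pair continuous_on_id) simp
  show "continuous_on {0..} (\<lambda>t. \<integral> z. \<phi> z \<partial>(graph_of (?X t)))" if C0: "C0_fun \<phi>" for \<phi>
  proof -
    have \<phi>c: "continuous_on UNIV \<phi>" using C0 by (simp add: C0_fun_def)
    have e: "(\<integral> z. \<phi> z \<partial>(graph_of (?X t))) = (\<integral>\<omega>. \<phi> (apply_bcontfun (?X t) \<omega>, \<omega>) \<partial>\<nu>)" for t
      unfolding graph_measure_def
      by (subst integral_distr[OF mg]) (use \<phi>c in \<open>auto intro: borel_measurable_continuous_onI\<close>)
    show ?thesis
      unfolding e continuous_on_sequentially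
    proof (intro allI ballI impI)
      fix ts and t :: real assume t: "t \<in> {0..}" and ts: "(\<forall>n. ts n \<in> {0..}) \<and> ts \<longlonglongrightarrow> t"
      have Xs: "(\<lambda>n. ?X (ts n)) \<longlonglongrightarrow> ?X t"
        using traj_continuous[of X\<^sub>0] t ts unfolding continuous_on_sequentially by (auto simp: o_def)
      then have "Bseq (\<lambda>n. ?X (ts n))" by (rule convergent_imp_Bseq[OF convergentI])
      then obtain B where B: "\<And>n. norm (?X (ts n)) \<le> B" by (auto simp: Bseq_def)
      have "compact (\<phi> ` ({- B..B} \<times> {- Rad..Rad}))"
        by (intro compact_continuous_image continuous_on_subset[OF \<phi>c] compact_Times) auto
      then obtain C where C: "\<And>x w. \<bar>x\<bar> \<le> B \<Longrightarrow> \<bar>w\<bar> \<le> Rad \<Longrightarrow> \<bar>\<phi> (x, w)\<bar> \<le> C"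
        by (force dest!: compact_imp_bounded simp: bounded_iff abs_le_iff)
      have \<phi>m: "(\<lambda>\<omega>. \<phi> (apply_bcontfun (?X s) \<omega>, \<omega>)) \<in> borel_measurable \<nu>" for s
        unfolding nu_borel by (rule borel_measurable_continuous_onI[OF continuous_on_compose2[OF \<phi>c pc]]) auto
      have "(\<lambda>n. \<integral>\<omega>. \<phi> (apply_bcontfun (?X (ts n)) \<omega>, \<omega>) \<partial>\<nu>) \<longlonglongrightarrow> (\<integral>\<omega>. \<phi> (apply_bcontfun (?X t) \<omega>, \<omega>) \<partial>\<nu>)"
      proof (rule integral_dominated_convergence[where w="\<lambda>_. C"])
        show "AE \<omega> in \<nu>. (\<lambda>n. \<phi> (apply_bcontfun (?X (ts n)) \<omega>, \<omega>)) \<longlonglongrightarrow> \<phi> (apply_bcontfun (?X t) \<omega>, \<omega>)"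
        proof (rule AE_I2)
          fix \<omega>
          have "(\<lambda>n. apply_bcontfun (?X (ts n)) \<omega>) \<longlonglongrightarrow> apply_bcontfun (?X t) \<omega>"
            by (rule bounded_linear.tendsto[OF bounded_linear_apply_bcontfun Xs])
          then have "(\<lambda>n. (apply_bcontfun (?X (ts n)) \<omega>, \<omega>)) \<longlonglongrightarrow> (apply_bcontfun (?X t) \<omega>, \<omega>)"
            by (intro tendsto_Pair tendsto_const)
          then show "(\<lambda>n. \<phi> (apply_bcontfun (?X (ts n)) \<omega>, \<omega>)) \<longlonglongrightarrow> \<phi> (apply_bcontfun (?X t) \<omega>, \<omega>)"
            using continuous_on_tendsto_compose[OF \<phi>c] by auto
        qed
        show "AE \<omega> in \<nu>. norm (\<phi> (apply_bcontfun (?X (ts n)) \<omega>, \<omega>)) \<le> C" for n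
          using AE_Omega
        proof eventually_elim
          case (elim \<omega>)
          show ?case using C[of "apply_bcontfun (?X (ts n)) \<omega>" \<omega>] norm_bounded[of "?X (ts n)" \<omega>] B[of n] Rad(2)[OF elim] by simp
        qed
      qed (use \<phi>m in auto)
      then show "((\<lambda>t. \<integral>\<omega>. \<phi> (apply_bcontfun (?X t) \<omega>, \<omega>) \<partial>\<nu>) \<circ> ts) \<longlonglongrightarrow> (\<integral>\<omega>. \<phi> (apply_bcontfun (?X t) \<omega>, \<omega>) \<partial>\<nu>)"
        by (simp add: o_def)
    qed
  qed
  fix \<phi> and t :: real assume test: "test_fun \<phi>" and t: "0 \<le> t"
  have C1\<phi>: "C1_fun \<phi>" using test by (simp add: test_fun_def)
  have \<phi>c: "continuous_on UNIV \<phi>" by (rule C1_fun_continuous[OF C1\<phi>])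
  obtain D\<phi> :: "real \<times> real \<times> real \<Rightarrow> (real \<times> real \<times> real) \<Rightarrow>\<^sub>L real" where
    D\<phi>: "\<And>z. (\<phi> has_derivative blinfun_apply (D\<phi> z)) (at z)" and D\<phi>c: "continuous_on UNIV D\<phi>"
    using C1\<phi> unfolding C1_fun_def by blast
  have scale: "blinfun_apply L (h, 0) = h * blinfun_apply L (1, 0)" "blinfun_apply L (0, h, 0) = h * blinfun_apply L (0, 1, 0)"
    for L :: "(real \<times> real \<times> real) \<Rightarrow>\<^sub>L real" and h
    using blinfun.scaleR_right[of L h "(1, 0)"] blinfun.scaleR_right[of L h "(0, 1, 0)"] by (simp_all only: scaleR_Pair) simp_all
  have scalef: "(\<lambda>h. blinfun_apply L (h, 0)) = (*) (blinfun_apply L (1, 0))" "(\<lambda>h. blinfun_apply L (0, h, 0)) = (*) (blinfun_apply L (0, 1, 0))"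
    for L :: "(real \<times> real \<times> real) \<Rightarrow>\<^sub>L real"
    by (rule ext, subst scale, rule mult.commute)+
  have dt: "deriv (\<lambda>r. \<phi> (r, z)) s = blinfun_apply (D\<phi> (s, z)) (1, 0)" for s z
  proof (rule DERIV_imp_deriv)
    have "((\<lambda>r. (r, z)) has_derivative (\<lambda>h. (h, 0))) (at s)" by (auto intro!: derivative_eq_intros)
    from has_derivative_compose[OF this D\<phi>] show "((\<lambda>r. \<phi> (r, z)) has_real_derivative blinfun_apply (D\<phi> (s, z)) (1, 0)) (at s)"
      by (simp only: has_field_derivative_def scalef)
  qed
  have dx: "deriv (\<lambda>y. \<phi> (s, (y, w))) x = blinfun_apply (D\<phi> (s, (x, w))) (0, 1, 0)" for s x w
  proof (rule DERIV_imp_deriv)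
    have "((\<lambda>y. (s, (y, w))) has_derivative (\<lambda>h. (0, h, 0))) (at x)" by (auto intro!: derivative_eq_intros)
    from has_derivative_compose[OF this D\<phi>] show "((\<lambda>y. \<phi> (s, (y, w))) has_real_derivative blinfun_apply (D\<phi> (s, (x, w))) (0, 1, 0)) (at x)"
      by (simp only: has_field_derivative_def scalef)
  qed
  define f where "f s \<omega> = \<phi> (s, (apply_bcontfun (?X s) \<omega>, \<omega>))" for s \<omega>
  \<comment> \<open>Written with \<open>F\<close> so that it matches the weak equation and is
    visibly measurable; its bound uses the extended velocity, which is equal to \<open>F\<close> at
    almost every frequency and is bounded through the norm of the field.\<close>
  define f' where "f' s \<omega> = blinfun_apply (D\<phi> (s, (apply_bcontfun (?X s) \<omega>, \<omega>))) (1, 0) +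
      F (graph_of (?X s)) (apply_bcontfun (?X s) \<omega>) \<omega> * blinfun_apply (D\<phi> (s, (apply_bcontfun (?X s) \<omega>, \<omega>))) (0, 1, 0)" for s \<omega>
  obtain B where B: "\<And>s. s \<in> {0..t} \<Longrightarrow> norm (?X s) \<le> B" "\<And>s. s \<in> {0..t} \<Longrightarrow> norm (field (?X s)) \<le> B"
    using traj_bounds by blast
  have cb: "\<exists>C. \<forall>s x w. s \<in> {0..t} \<longrightarrow> \<bar>x\<bar> \<le> B \<longrightarrow> \<bar>w\<bar> \<le> Rad \<longrightarrow> norm (g (s, (x, w))) \<le> C"
    if "continuous_on UNIV g" for g :: "real \<times> real \<times> real \<Rightarrow> 'n::real_normed_vector"
  proof -
    have "compact (g ` ({0..t} \<times> {- B..B} \<times> {- Rad..Rad}))"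
      by (intro compact_continuous_image continuous_on_subset[OF that] compact_Times) auto
    then obtain C where "\<forall>z \<in> {0..t} \<times> {- B..B} \<times> {- Rad..Rad}. norm (g z) \<le> C"
      by (auto dest!: compact_imp_bounded simp: bounded_iff)
    then show ?thesis by (intro exI[of _ C]) (auto simp: abs_le_iff)
  qed
  obtain C\<phi> where C\<phi>: "\<And>s x w. s \<in> {0..t} \<Longrightarrow> \<bar>x\<bar> \<le> B \<Longrightarrow> \<bar>w\<bar> \<le> Rad \<Longrightarrow> norm (\<phi> (s, (x, w))) \<le> C\<phi>"
    using cb[OF \<phi>c] by blast
  obtain CD where CD: "\<And>s x w. s \<in> {0..t} \<Longrightarrow> \<bar>x\<bar> \<le> B \<Longrightarrow> \<bar>w\<bar> \<le> Rad \<Longrightarrow> norm (D\<phi> (s, (x, w))) \<le> CD"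
    using cb[OF D\<phi>c] by blast
  have XB: "\<bar>apply_bcontfun (?X s) \<omega>\<bar> \<le> B" "\<bar>vel (graph_of (?X s)) (apply_bcontfun (?X s) \<omega>) \<omega>\<bar> \<le> B" if "s \<in> {0..t}" for s \<omega>
    using B[OF that] norm_bounded[of "?X s" \<omega>] norm_bounded[of "field (?X s)" \<omega>] by (auto simp: field_apply)
  have fm: "f s \<in> borel_measurable \<nu>" for s
    unfolding nu_borel f_def
    by (intro borel_measurable_continuous_onI continuous_on_compose2[OF \<phi>c] continuous_on_Pair continuous_on_const pc[simplified]) (auto intro: continuous_on_id)
  have Dc: "continuous_on UNIV (\<lambda>\<omega>. D\<phi> (s, (apply_bcontfun (?X s) \<omega>, \<omega>)))" for s
    by (intro continuous_on_compose2[OF D\<phi>c] continuous_on_Pair continuous_on_const) (auto intro: continuous_on_id)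
  have Fc: "continuous_on UNIV (\<lambda>\<omega>. F (graph_of (?X s)) (apply_bcontfun (?X s) \<omega>) \<omega>)" for s
    using continuous_on_compose2[OF F_continuous[OF graph_of_P2nu] pc[of s]] by simp
  have f'm: "f' s \<in> borel_measurable \<nu>" for s
    unfolding nu_borel f'_def
    by (intro borel_measurable_continuous_onI continuous_intros Dc Fc)
  have u: "((\<lambda>s. \<integral>\<omega>. f s \<omega> \<partial>\<nu>) has_real_derivative (\<integral>\<omega>. f' s \<omega> \<partial>\<nu>)) (at s within {0..t})" if s: "s \<in> {0..t}" for s
  proof (rule has_real_derivative_integral_dominated[OF \<nu>.finite_measure_axioms s])
    show "integrable \<nu> (f r)" if r: "r \<in> {0..t}" for r
    proof (rule \<nu>.integrable_const_bound[OF _ fm])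
      show "AE \<omega> in \<nu>. norm (f r \<omega>) \<le> C\<phi>"
        using AE_Omega by eventually_elim (use C\<phi>[OF r] XB(1)[OF r] Rad(2) in \<open>auto simp: f_def\<close>)
    qed
    show "AE \<omega> in \<nu>. \<forall>r\<in>{0..t}. ((\<lambda>r. f r \<omega>) has_real_derivative f' r \<omega>) (at r within {0..t}) \<and> \<bar>f' r \<omega>\<bar> \<le> CD * 1 + B * (CD * 1)"
      using AE_Omega
    proof (eventually_elim, intro ballI conjI)
      fix \<omega> r assume o: "\<omega> \<in> \<Omega>" and r: "r \<in> {0..t}"
      let ?z = "(r, (apply_bcontfun (?X r) \<omega>, \<omega>))"
      define v where "v = F (graph_of (?X r)) (apply_bcontfun (?X r) \<omega>) \<omega>"
      have v: "v = vel (graph_of (?X r)) (apply_bcontfun (?X r) \<omega>) \<omega>"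
        unfolding v_def by (rule vel_eq[OF graph_of_P2nu o, symmetric])
      have "((\<lambda>t. apply_bcontfun (?X t) \<omega>) has_real_derivative v) (at r within {0..t})"
        unfolding v by (rule DERIV_subset[OF traj_pointwise]) (use r in auto)
      then have "((\<lambda>r. (r, (apply_bcontfun (?X r) \<omega>, \<omega>))) has_derivative (\<lambda>h. (h, (v * h, 0)))) (at r within {0..t})"
        by (auto intro!: derivative_eq_intros simp: has_field_derivative_def)
      from has_derivative_compose[OF this D\<phi>]
      have "((\<lambda>r. f r \<omega>) has_derivative (\<lambda>h. blinfun_apply (D\<phi> ?z) (h, (v * h, 0)))) (at r within {0..t})"
        by (simp add: f_def)
      moreover have "(\<lambda>h. blinfun_apply (D\<phi> ?z) (h, (v * h, 0))) = (*) (f' r \<omega>)"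
      proof (rule ext)
        fix h
        have hv: "(h, (v * h, 0)) = h *\<^sub>R ((1, 0) + v *\<^sub>R (0, 1, 0))" by (simp add: mult.commute zero_prod_def)
        have "blinfun_apply (D\<phi> ?z) (h, (v * h, 0)) = h *\<^sub>R (blinfun_apply (D\<phi> ?z) (1, 0) + v *\<^sub>R blinfun_apply (D\<phi> ?z) (0, 1, 0))"
          unfolding hv blinfun.scaleR_right blinfun.add_right ..
        then show "blinfun_apply (D\<phi> ?z) (h, (v * h, 0)) = f' r \<omega> * h" by (simp add: f'_def v_def)
      qed
      ultimately show "((\<lambda>r. f r \<omega>) has_real_derivative f' r \<omega>) (at r within {0..t})"
        by (simp add: has_field_derivative_def)
      have nb: "\<bar>blinfun_apply (D\<phi> ?z) e\<bar> \<le> CD * 1" if "norm e \<le> 1" for e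
      proof -
        have n: "norm (D\<phi> ?z) \<le> CD" by (rule CD[OF r XB(1)[OF r] Rad(2)[OF o]])
        have "\<bar>blinfun_apply (D\<phi> ?z) e\<bar> \<le> norm (D\<phi> ?z) * norm e"
          using norm_blinfun[of "D\<phi> ?z" e] by simp
        also have "\<dots> \<le> CD * 1" using n that order_trans[OF norm_ge_zero n] by (intro mult_mono) auto
        finally show ?thesis .
      qed
      have "\<bar>v * blinfun_apply (D\<phi> ?z) (0, 1, 0)\<bar> \<le> B * (CD * 1)"
        unfolding abs_mult using XB(2)[OF r, of \<omega>] nb[of "(0, 1, 0)"] order_trans[OF abs_ge_zero XB(2)[OF r, of \<omega>]]
        by (intro mult_mono) (auto simp: v norm_Pair)
      moreover have "\<bar>blinfun_apply (D\<phi> ?z) (1, 0)\<bar> \<le> CD * 1" by (rule nb) (simp add: norm_Pair)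
      ultimately show "\<bar>f' r \<omega>\<bar> \<le> CD * 1 + B * (CD * 1)" unfolding f'_def v_def[symmetric] by linarith
    qed
  qed (rule f'm)
  have "((\<lambda>s. \<integral>\<omega>. f' s \<omega> \<partial>\<nu>) has_integral (\<integral>\<omega>. f t \<omega> \<partial>\<nu>) - (\<integral>\<omega>. f 0 \<omega> \<partial>\<nu>)) {0..t}"
    by (rule fundamental_theorem_of_calculus[OF t]) (use u in \<open>simp add: has_real_derivative_iff_has_vector_derivative\<close>)
  then have ftc: "integral {0..t} (\<lambda>s. \<integral>\<omega>. f' s \<omega> \<partial>\<nu>) = (\<integral>\<omega>. f t \<omega> \<partial>\<nu>) - (\<integral>\<omega>. f 0 \<omega> \<partial>\<nu>)" by (rule integral_unique)
  have fe: "(\<integral> z. \<phi> (s, z) \<partial>(graph_of (?X s))) = (\<integral>\<omega>. f s \<omega> \<partial>\<nu>)" for s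
  proof -
    have "(\<lambda>z. \<phi> (s, z)) \<in> borel_measurable borel"
      by (intro borel_measurable_continuous_onI continuous_on_compose2[OF \<phi>c] continuous_intros) auto
    then show ?thesis unfolding graph_measure_def f_def by (subst integral_distr[OF mg]) auto
  qed
  have f'e: "(\<integral> z. (deriv (\<lambda>r. \<phi> (r, z)) s + F (graph_of (?X s)) (fst z) (snd z) * deriv (\<lambda>y. \<phi> (s, (y, snd z))) (fst z)) \<partial>(graph_of (?X s)))
     = (\<integral>\<omega>. f' s \<omega> \<partial>\<nu>)" for s
  proof -
    have c1: "continuous_on UNIV (\<lambda>z. D\<phi> (s, z))"
      by (intro continuous_on_compose2[OF D\<phi>c] continuous_intros) auto
    have m: "(\<lambda>z. blinfun_apply (D\<phi> (s, z)) (1, 0) + F (graph_of (?X s)) (fst z) (snd z) * blinfun_apply (D\<phi> (s, z)) (0, 1, 0)) \<in> borel_measurable borel"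
      by (intro borel_measurable_continuous_onI continuous_intros c1 F_continuous graph_of_P2nu)
    show ?thesis
      unfolding dt dx prod.collapse
      unfolding graph_measure_def[of "apply_bcontfun (?X s)"]
      by (subst integral_distr[OF mg]) (use m in \<open>auto simp: f'_def[abs_def] graph_measure_def\<close>)
  qed
  show "(\<integral> z. \<phi> (t, z) \<partial>(graph_of (?X t))) = (\<integral> z. \<phi> (0, z) \<partial>graph_of X\<^sub>0) +
      integral {0..t} (\<lambda>s. \<integral> z. (deriv (\<lambda>r. \<phi> (r, z)) s
           + F (graph_of (?X s)) (fst z) (snd z) * deriv (\<lambda>y. \<phi> (s, (y, snd z))) (fst z)) \<partial>(graph_of (?X s)))"
    unfolding f'e ftc fe[of t] using fe[of 0] by (simp add: traj_0)
qed

end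

section \<open>The return map and its fixed point\<close>

context kinetic
begin

interpretation \<nu>: prob_space \<nu> by (rule nu_prob)

text \<open>Invariance under clamping makes convergence on \<open>[-Rad, Rad]\<close> uniform on the
  whole line, which yields compactness. Mean 0 normalizes the centre, so the bounds of the invariant
  set are evaluated at phase 0.\<close>

definition slice :: "(real \<Rightarrow>\<^sub>C real) set" where
  "slice = {X. (\<forall>u v. \<bar>apply_bcontfun X u - apply_bcontfun X v\<bar> \<le> \<Delta>\<^sub>t 0 * \<bar>u - v\<bar>) \<and>
     (\<forall>u. apply_bcontfun X (clamp_sym Rad u) = apply_bcontfun X u) \<and>
     (\<forall>\<omega>\<in>\<Omega>. \<forall>\<omega>'\<in>\<Omega>. \<bar>apply_bcontfun X \<omega> - apply_bcontfun X \<omega>'\<bar> \<le> \<Delta> 0) \<and>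
     (\<integral>\<omega>. apply_bcontfun X \<omega> \<partial>\<nu>) = 0}"

lemma Dt_pos: "0 < \<Delta>\<^sub>t s"
  using lip_pos Delta_range[of s] by (simp add: \<Delta>\<^sub>t_def)

lemma xc_graph_of: "xc (graph_of X) = (\<integral>\<omega>. apply_bcontfun X \<omega> \<partial>\<nu>)"
  by (rule xc_graph[OF bcontfun_measurable])

lemma xc_graph_of_diff:
  assumes "\<And>\<omega>. \<omega> \<in> \<Omega> \<Longrightarrow> \<bar>apply_bcontfun X \<omega> - apply_bcontfun Y \<omega>\<bar> \<le> d"
  shows "\<bar>xc (graph_of X) - xc (graph_of Y)\<bar> \<le> d"
proof -
  have "\<bar>\<integral>\<omega>. apply_bcontfun X \<omega> - apply_bcontfun Y \<omega> \<partial>\<nu>\<bar> \<le> (\<integral>\<omega>. \<bar>apply_bcontfun X \<omega> - apply_bcontfun Y \<omega>\<bar> \<partial>\<nu>)"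
    by (rule integral_abs_bound)
  also have "\<dots> \<le> (\<integral>\<omega>. d \<partial>\<nu>)"
  proof (rule integral_mono_AE)
    show "AE \<omega> in \<nu>. \<bar>apply_bcontfun X \<omega> - apply_bcontfun Y \<omega>\<bar> \<le> d"
      using AE_Omega by eventually_elim (rule assms)
  qed (intro integrable_abs Bochner_Integration.integrable_diff bcontfun_integrable \<nu>.integrable_const)+
  finally show ?thesis by (simp add: xc_graph_of bcontfun_integrable \<nu>.prob_space)
qed

lemma slice_flow:
  assumes X: "X \<in> slice"
  shows "kinetic_flow \<nu> F A I M \<kappa> D \<gamma> \<omega>c \<Delta> (graph_of X) (\<lambda>t. graph_of (traj X t))
    ((\<lambda>\<omega>. (apply_bcontfun X \<omega>, \<omega>)) ` \<Omega>) (\<lambda>t z. apply_bcontfun (traj X t) (snd z))"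
proof (unfold_locales)
  let ?P = "(\<lambda>\<omega>. (apply_bcontfun X \<omega>, \<omega>)) ` \<Omega>"
  have "compact ?P"
    by (intro compact_continuous_image Omega_compact continuous_on_Pair continuous_on_id) simp
  then have Pm: "?P \<in> sets borel" by (intro borel_closed compact_imp_closed)
  show "AE z in graph_of X. z \<in> ?P"
    unfolding graph_measure_def
    by (subst AE_distr_iff[OF meas_graph[OF bcontfun_measurable]])
       (use Pm AE_Omega in \<open>auto elim!: eventually_mono\<close>)
  show "(\<lambda>z :: real \<times> real. apply_bcontfun (traj X t) (snd z)) \<in> borel_measurable borel" for t
    by (intro measurable_compose[OF borel_measurable_fst_snd(2) bcontfun_measurable])
  show "graph_of (traj X t) = distr (graph_of X) borel (\<lambda>z. (apply_bcontfun (traj X t) (snd z), snd z))" for t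
  proof -
    have "(\<lambda>z :: real \<times> real. (apply_bcontfun (traj X t) (snd z), snd z)) \<in> borel_measurable borel"
      by (intro borel_measurable_Pair measurable_compose[OF borel_measurable_fst_snd(2) bcontfun_measurable] borel_measurable_fst_snd(2))
    then show ?thesis
      unfolding graph_measure_def by (subst distr_distr[OF _ meas_graph[OF bcontfun_measurable]]) (simp_all add: o_def)
  qed
  show "((\<lambda>t. apply_bcontfun (traj X t) (snd z)) has_real_derivative
      F (graph_of (traj X t)) (apply_bcontfun (traj X t) (snd z)) (snd z)) (at t within {0..})"
    if "z \<in> ?P" "0 \<le> t" for z t
    using traj_graph_sol[of X] that by (auto simp: graph_sol_def)
  have "xc (graph_of X) = 0" using X by (simp add: slice_def xc_graph_of)
  then show "\<bar>fst z - fst z'\<bar> \<le> \<Delta> (xc (graph_of X))" if "z \<in> ?P" "z' \<in> ?P" for z z'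
    using X that by (auto simp: slice_def)
qed (auto simp: graph_of_P2nu traj_0)

text \<open>Time in which the slowest admissible centre, moving at speed
  \<open>A - \<epsilon>\<close>, covers one period.\<close>

definition "T\<^sub>m\<^sub>a\<^sub>x = 2 * pi / (A - \<epsilon>)"

text \<open>The intermediate value theorem gives existence within that time; the strict drift of the
  centre gives uniqueness.\<close>

lemma hit_ex1:
  assumes X: "X \<in> slice"
  shows "\<exists>!T. 0 \<le> T \<and> xc (graph_of (traj X T)) = 2 * pi"
    and "0 \<le> T \<Longrightarrow> xc (graph_of (traj X T)) = 2 * pi \<Longrightarrow> T \<le> T\<^sub>m\<^sub>a\<^sub>x"
proof -
  interpret fl: kinetic_flow \<nu> F A I M \<kappa> D \<gamma> \<omega>c \<Delta> "graph_of X" "\<lambda>t. graph_of (traj X t)"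
    "(\<lambda>\<omega>. (apply_bcontfun X \<omega>, \<omega>)) ` \<Omega>" "\<lambda>t z. apply_bcontfun (traj X t) (snd z)"
    by (rule slice_flow[OF X])
  have Ae: "0 < A - \<epsilon>" using eps_less by simp
  have x0: "xc (graph_of (traj X 0)) = 0" using X by (simp add: slice_def xc_graph_of traj_0)
  have T0: "0 \<le> T\<^sub>m\<^sub>a\<^sub>x" using Ae by (simp add: T\<^sub>m\<^sub>a\<^sub>x_def)
  have "2 * pi \<le> xc (graph_of (traj X T\<^sub>m\<^sub>a\<^sub>x))"
    using fl.xc_increase[of 0 T\<^sub>m\<^sub>a\<^sub>x] T0 x0 Ae by (simp add: T\<^sub>m\<^sub>a\<^sub>x_def)
  then obtain T where "0 \<le> T" "T \<le> T\<^sub>m\<^sub>a\<^sub>x" "xc (graph_of (traj X T)) = 2 * pi"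
    using IVT'[of "\<lambda>t. xc (graph_of (traj X t))" 0 "2 * pi" T\<^sub>m\<^sub>a\<^sub>x] x0 T0 fl.xc_continuous by auto
  moreover have inj: "S = T" if "0 \<le> S" "0 \<le> T" "xc (graph_of (traj X S)) = xc (graph_of (traj X T))" for S T
  proof -
    have "a = b" if "0 \<le> a" "a \<le> b" "xc (graph_of (traj X a)) = xc (graph_of (traj X b))" for a b
    proof -
      have "(A - \<epsilon>) * (b - a) \<le> 0" using fl.xc_increase[OF that(1,2)] that(3) by simp
      then show ?thesis using Ae that by (simp add: mult_le_0_iff)
    qed
    then show ?thesis using that by (metis linear)
  qed
  ultimately show "\<exists>!T. 0 \<le> T \<and> xc (graph_of (traj X T)) = 2 * pi"
    and "0 \<le> T \<Longrightarrow> xc (graph_of (traj X T)) = 2 * pi \<Longrightarrow> T \<le> T\<^sub>m\<^sub>a\<^sub>x" for T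
    by metis+
qed

definition "hit X = (THE T. 0 \<le> T \<and> xc (graph_of (traj X T)) = 2 * pi)"

lemma hit:
  assumes "X \<in> slice"
  shows "0 \<le> hit X" "xc (graph_of (traj X (hit X))) = 2 * pi" "hit X \<le> T\<^sub>m\<^sub>a\<^sub>x"
    "0 \<le> T \<Longrightarrow> xc (graph_of (traj X T)) = 2 * pi \<Longrightarrow> T = hit X"
proof -
  from theI'[OF hit_ex1(1)[OF assms]]
  show h: "0 \<le> hit X" "xc (graph_of (traj X (hit X))) = 2 * pi" by (simp_all add: hit_def)
  show "hit X \<le> T\<^sub>m\<^sub>a\<^sub>x" by (rule hit_ex1(2)[OF assms h])
  show "0 \<le> T \<Longrightarrow> xc (graph_of (traj X T)) = 2 * pi \<Longrightarrow> T = hit X"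
    using hit_ex1(1)[OF assms] h by blast
qed

lemma Delta_2pi: "\<Delta> (2 * pi) = \<Delta> 0" using Delta_periodic[of 0] by simp

text \<open>At arrival the centre has advanced by one period, so \<Delta> has returned to its
  initial value and the bounds at departure and arrival coincide. The initial ratio is at most the
  equilibrium ratio, hence so is the convex combination of the two.\<close>

lemma arrival:
  assumes X: "X \<in> slice" and o: "\<omega> \<in> \<Omega>" "\<omega>' \<in> \<Omega>"
  defines "Y \<equiv> traj X (hit X)"
  shows "\<bar>apply_bcontfun Y \<omega> - apply_bcontfun Y \<omega>'\<bar> \<le> \<Delta> 0"
    "\<bar>apply_bcontfun Y \<omega> - apply_bcontfun Y \<omega>'\<bar> \<le> \<Delta>\<^sub>t 0 * \<bar>\<omega> - \<omega>'\<bar>"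
proof -
  interpret fl: kinetic_flow \<nu> F A I M \<kappa> D \<gamma> \<omega>c \<Delta> "graph_of X" "\<lambda>t. graph_of (traj X t)"
    "(\<lambda>\<omega>. (apply_bcontfun X \<omega>, \<omega>)) ` \<Omega>" "\<lambda>t z. apply_bcontfun (traj X t) (snd z)"
    by (rule slice_flow[OF X])
  note h = hit[OF X]
  have rT: "fl.r (hit X) = \<Delta> 0" by (simp add: fl.r_def h(2) Delta_2pi)
  have "xc (graph_of X) = 0" using X by (simp add: slice_def xc_graph_of)
  then have r0: "fl.r 0 = \<Delta> 0" by (simp add: fl.r_def traj_0)
  show "\<bar>apply_bcontfun Y \<omega> - apply_bcontfun Y \<omega>'\<bar> \<le> \<Delta> 0"
    using fl.diam_invariant[OF h(1)] o by (auto simp: fl.diam_def rT Y_def)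
  define \<theta> where "\<theta> = exp (- rate * hit X)"
  have \<theta>: "0 \<le> \<theta>" by (simp add: \<theta>_def)
  have "\<bar>apply_bcontfun X \<omega> - apply_bcontfun X \<omega>'\<bar> \<le> \<Delta>\<^sub>t 0 * \<bar>\<omega> - \<omega>'\<bar>" using X by (simp add: slice_def)
  then have q: "\<bar>apply_bcontfun X \<omega> - apply_bcontfun X \<omega>'\<bar> / \<Delta> 0 \<le> lip * \<bar>\<omega> - \<omega>'\<bar>"
    using Delta_range[of 0] by (simp add: \<Delta>\<^sub>t_def divide_le_eq mult_ac)
  have "\<bar>apply_bcontfun Y \<omega> - apply_bcontfun Y \<omega>'\<bar> \<le> \<Delta> 0 * (\<theta> * (\<bar>apply_bcontfun X \<omega> - apply_bcontfun X \<omega>'\<bar> / \<Delta> 0) + (1 - \<theta>) * (lip * \<bar>\<omega> - \<omega>'\<bar>))"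
    using fl.lipschitz_invariant[OF h(1), of "(apply_bcontfun X \<omega>, \<omega>)" "(apply_bcontfun X \<omega>', \<omega>')"] o
    by (simp add: rT r0 Y_def \<theta>_def)
  also have "\<dots> \<le> \<Delta> 0 * (\<theta> * (lip * \<bar>\<omega> - \<omega>'\<bar>) + (1 - \<theta>) * (lip * \<bar>\<omega> - \<omega>'\<bar>))"
    using Delta_range[of 0] by (intro mult_left_mono add_right_mono q \<theta>) auto
  also have "\<dots> = \<Delta>\<^sub>t 0 * \<bar>\<omega> - \<omega>'\<bar>" by (simp add: \<Delta>\<^sub>t_def algebra_simps)
  finally show "\<bar>apply_bcontfun Y \<omega> - apply_bcontfun Y \<omega>'\<bar> \<le> \<Delta>\<^sub>t 0 * \<bar>\<omega> - \<omega>'\<bar>" .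
qed

text \<open>The contraction estimate controls the arriving graph over \<Omega> only. Extending its
  values there afresh restores the Lipschitz bound on the line and the invariance under clamping;
  the graph measure depends only on the values over \<Omega>.\<close>

definition ret :: "(real \<Rightarrow>\<^sub>C real) \<Rightarrow> (real \<Rightarrow>\<^sub>C real)" where
  "ret X = Bcontfun (mcshane \<Omega> Rad (\<Delta>\<^sub>t 0) (\<lambda>\<omega>. apply_bcontfun (traj X (hit X)) \<omega> - 2 * pi))"

lemma shifted_lower: "- norm Y - 2 * pi \<le> apply_bcontfun Y \<omega> - 2 * pi" for Y :: "real \<Rightarrow>\<^sub>C real"
  using norm_bounded[of Y \<omega>] by (simp add: abs_le_iff)

lemma ret_apply:
  "apply_bcontfun (ret X) u = mcshane \<Omega> Rad (\<Delta>\<^sub>t 0) (\<lambda>\<omega>. apply_bcontfun (traj X (hit X)) \<omega> - 2 * pi) u"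
proof -
  let ?g = "mcshane \<Omega> Rad (\<Delta>\<^sub>t 0) (\<lambda>\<omega>. apply_bcontfun (traj X (hit X)) \<omega> - 2 * pi)"
  have l: "\<bar>?g u - ?g v\<bar> \<le> \<Delta>\<^sub>t 0 * \<bar>u - v\<bar>" for u v
    by (rule mcshane_lipschitz[OF Omega_ne Rad(2) _ shifted_lower]) (use Dt_pos[of 0] in auto)
  have "?g \<in> bcontfun"
  proof (rule bcontfun_normI)
    show "continuous_on UNIV ?g"
    proof (rule continuous_at_imp_continuous_on, rule ballI)
      fix u
      have "((\<lambda>v. \<Delta>\<^sub>t 0 * \<bar>v - u\<bar>) \<longlongrightarrow> \<Delta>\<^sub>t 0 * \<bar>u - u\<bar>) (at u)" by (intro tendsto_intros)
      then have "((\<lambda>v. \<Delta>\<^sub>t 0 * \<bar>v - u\<bar>) \<longlongrightarrow> 0) (at u)" by simp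
      then have "((\<lambda>v. ?g v - ?g u) \<longlongrightarrow> 0) (at u)"
        by (rule Lim_null_comparison[rotated]) (simp add: l)
      then show "isCont ?g u" by (simp add: isCont_def LIM_zero_iff)
    qed
    fix u
    have "\<bar>?g (clamp_sym Rad u) - ?g 0\<bar> \<le> \<Delta>\<^sub>t 0 * \<bar>clamp_sym Rad u\<bar>" using l[of "clamp_sym Rad u" 0] by simp
    also have "\<dots> \<le> \<Delta>\<^sub>t 0 * Rad"
      using Dt_pos[of 0] Rad(1) by (intro mult_left_mono clamp_sym_bound) auto
    also have "?g (clamp_sym Rad u) = ?g u"
      by (rule mcshane_clamp[OF Omega_ne Rad(2) less_imp_le[OF Dt_pos]])
    finally show "norm (?g u) \<le> \<Delta>\<^sub>t 0 * Rad + \<bar>?g 0\<bar>" unfolding real_norm_def by linarith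
  qed
  then show ?thesis by (simp add: ret_def Bcontfun_inverse)
qed

lemma ret_Omega:
  assumes "X \<in> slice" "\<omega> \<in> \<Omega>"
  shows "apply_bcontfun (ret X) \<omega> = apply_bcontfun (traj X (hit X)) \<omega> - 2 * pi"
  unfolding ret_apply
  by (rule mcshane_eq[OF Omega_ne Rad(2) less_imp_le[OF Dt_pos] assms(2)])
     (use arrival(2)[OF assms(1)] in auto)

lemma ret_slice:
  assumes X: "X \<in> slice"
  shows "ret X \<in> slice"
proof -
  have "(\<integral>\<omega>. apply_bcontfun (ret X) \<omega> \<partial>\<nu>) = (\<integral>\<omega>. apply_bcontfun (traj X (hit X)) \<omega> - 2 * pi \<partial>\<nu>)"
  proof (rule integral_cong_AE)
    show "AE \<omega> in \<nu>. apply_bcontfun (ret X) \<omega> = apply_bcontfun (traj X (hit X)) \<omega> - 2 * pi"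
      using AE_Omega by eventually_elim (rule ret_Omega[OF X])
  qed (use bcontfun_integrable in auto)
  also have "\<dots> = 0" using hit(2)[OF X] by (simp add: bcontfun_integrable \<nu>.prob_space xc_graph_of)
  finally have 1: "(\<integral>\<omega>. apply_bcontfun (ret X) \<omega> \<partial>\<nu>) = 0" .
  have 2: "\<bar>apply_bcontfun (ret X) u - apply_bcontfun (ret X) v\<bar> \<le> \<Delta>\<^sub>t 0 * \<bar>u - v\<bar>" for u v
    unfolding ret_apply
    by (rule mcshane_lipschitz[OF Omega_ne Rad(2) _ shifted_lower]) (use Dt_pos[of 0] in auto)
  have 3: "apply_bcontfun (ret X) (clamp_sym Rad u) = apply_bcontfun (ret X) u" for u
    unfolding ret_apply by (rule mcshane_clamp[OF Omega_ne Rad(2) less_imp_le[OF Dt_pos]])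
  show ?thesis
    unfolding slice_def using 1 2 3 arrival(1)[OF X] ret_Omega[OF X] by simp
qed

lemma traj_stable:
  assumes "0 \<le> t" "t \<le> T\<^sub>m\<^sub>a\<^sub>x" "\<omega> \<in> \<Omega>"
  shows "\<bar>apply_bcontfun (traj X t) \<omega> - apply_bcontfun (traj Y t) \<omega>\<bar> \<le> 2 * exp (growth * T\<^sub>m\<^sub>a\<^sub>x) * norm (X - Y)"
proof -
  have g0: "0 \<le> growth" using kI kM by (simp add: growth_def)
  have "\<bar>apply_bcontfun (traj X t) \<omega> - apply_bcontfun (traj Y t) \<omega>\<bar> \<le> 2 * norm (X - Y) * exp (growth * t)"
    by (rule graph_sol_stable[OF traj_graph_sol traj_graph_sol _ assms(1,3)]) (simp add: traj_0 bcontfun_diff_bound)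
  also have "\<dots> \<le> 2 * norm (X - Y) * exp (growth * T\<^sub>m\<^sub>a\<^sub>x)"
    using assms g0 by (intro mult_left_mono) (auto intro: mult_left_mono)
  finally show ?thesis by (simp add: mult_ac)
qed

text \<open>At the later passage time the centre that passed first is already beyond the target by
  at least \<open>A - \<epsilon>\<close> times the delay, while stability keeps it close to the
  other centre, which is at the target.\<close>

lemma hit_lipschitz:
  assumes X: "X \<in> slice" "Y \<in> slice"
  shows "\<bar>hit X - hit Y\<bar> \<le> 2 * exp (growth * T\<^sub>m\<^sub>a\<^sub>x) / (A - \<epsilon>) * norm (X - Y)"
proof -
  have Ae: "0 < A - \<epsilon>" using eps_less by simp
  have le: "hit Y - hit X \<le> 2 * exp (growth * T\<^sub>m\<^sub>a\<^sub>x) / (A - \<epsilon>) * norm (X - Y)"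
    if X: "X \<in> slice" "Y \<in> slice" "hit X \<le> hit Y" for X Y
  proof -
    interpret fl: kinetic_flow \<nu> F A I M \<kappa> D \<gamma> \<omega>c \<Delta> "graph_of X" "\<lambda>t. graph_of (traj X t)"
      "(\<lambda>\<omega>. (apply_bcontfun X \<omega>, \<omega>)) ` \<Omega>" "\<lambda>t z. apply_bcontfun (traj X t) (snd z)"
      by (rule slice_flow[OF X(1)])
    have "\<bar>xc (graph_of (traj X (hit Y))) - xc (graph_of (traj Y (hit Y)))\<bar> \<le> 2 * exp (growth * T\<^sub>m\<^sub>a\<^sub>x) * norm (X - Y)"
      by (rule xc_graph_of_diff, rule traj_stable[OF hit(1)[OF X(2)] hit(3)[OF X(2)]])
    moreover have "2 * pi + (A - \<epsilon>) * (hit Y - hit X) \<le> xc (graph_of (traj X (hit Y)))"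
      using fl.xc_increase[OF hit(1)[OF X(1)] X(3)] hit(2)[OF X(1)] by simp
    ultimately have "(A - \<epsilon>) * (hit Y - hit X) \<le> 2 * exp (growth * T\<^sub>m\<^sub>a\<^sub>x) * norm (X - Y)"
      using hit(2)[OF X(2)] by linarith
    then show ?thesis using Ae by (simp add: pos_le_divide_eq mult_ac)
  qed
  show ?thesis
  proof (cases "hit X \<le> hit Y")
    case True
    then show ?thesis using le[OF X True] by simp
  next
    case False
    then show ?thesis using le[OF X(2) X(1)] by (simp add: norm_minus_commute)
  qed
qed

text \<open>Two effects are separated at the passage time of the nearby datum: stability in the
  datum, known over \<Omega>, and continuity in time of a fixed trajectory. Nonexpansiveness of the
  extension converts the bound over \<Omega> into one in the supremum norm.\<close>

lemma ret_continuous: "continuous_on slice ret"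
  unfolding continuous_on_def
proof
  fix X assume X: "X \<in> slice"
  define c where "c = 2 * exp (growth * T\<^sub>m\<^sub>a\<^sub>x)"
  have nX: "((\<lambda>Y. norm (Y - X)) \<longlongrightarrow> 0) (at X within slice)"
    by (rule tendsto_norm_zero, rule LIM_zero) (rule tendsto_ident_at)
  have cn: "((\<lambda>Y. k * norm (Y - X)) \<longlongrightarrow> 0) (at X within slice)" for k
    using tendsto_mult[OF tendsto_const nX, of k] by simp
  have ev: "\<forall>\<^sub>F Y in at X within slice. Y \<in> slice" by (simp add: eventually_at_filter)
  have "((\<lambda>Y. hit Y - hit X) \<longlongrightarrow> 0) (at X within slice)"
  proof (rule Lim_null_comparison[OF _ cn])
    show "\<forall>\<^sub>F Y in at X within slice. norm (hit Y - hit X) \<le> c / (A - \<epsilon>) * norm (Y - X)"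
      using ev by eventually_elim (use hit_lipschitz[OF _ X] in \<open>simp add: c_def\<close>)
  qed
  then have hl: "(hit \<longlongrightarrow> hit X) (at X within slice)" by (simp add: LIM_zero_iff)
  have "((\<lambda>Y. traj X (hit Y)) \<longlongrightarrow> traj X (hit X)) (at X within slice)"
    by (rule continuous_on_tendsto_compose[OF traj_continuous hl])
       (use hit(1)[OF X] ev hit(1) in \<open>auto elim!: eventually_mono\<close>)
  then have t1: "((\<lambda>Y. norm (traj X (hit Y) - traj X (hit X))) \<longlongrightarrow> 0) (at X within slice)"
    by (intro tendsto_norm_zero LIM_zero)
  have "((\<lambda>Y. norm (traj X (hit Y) - traj X (hit X)) + c * norm (Y - X)) \<longlongrightarrow> 0 + 0) (at X within slice)"
    by (rule tendsto_add[OF t1 cn])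
  then have t2: "((\<lambda>Y. norm (traj X (hit Y) - traj X (hit X)) + c * norm (Y - X)) \<longlongrightarrow> 0) (at X within slice)" by simp
  have "((\<lambda>Y. ret Y - ret X) \<longlongrightarrow> 0) (at X within slice)"
  proof (rule Lim_null_comparison[OF _ t2])
    show "\<forall>\<^sub>F Y in at X within slice. norm (ret Y - ret X) \<le> norm (traj X (hit Y) - traj X (hit X)) + c * norm (Y - X)"
      using ev
    proof eventually_elim
      case (elim Y)
      show ?case
      proof (rule norm_bound)
        fix u
        have "\<bar>apply_bcontfun (ret Y) u - apply_bcontfun (ret X) u\<bar> \<le> norm (traj X (hit Y) - traj X (hit X)) + c * norm (Y - X)"
          unfolding ret_apply
        proof (rule mcshane_nonexpansive[OF Omega_ne Rad(2) less_imp_le[OF Dt_pos] shifted_lower shifted_lower])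
          fix \<omega> assume o: "\<omega> \<in> \<Omega>"
          have "\<bar>apply_bcontfun (traj Y (hit Y)) \<omega> - apply_bcontfun (traj X (hit Y)) \<omega>\<bar> \<le> c * norm (Y - X)"
            unfolding c_def by (rule traj_stable[OF hit(1)[OF elim] hit(3)[OF elim] o])
          moreover have "\<bar>apply_bcontfun (traj X (hit Y)) \<omega> - apply_bcontfun (traj X (hit X)) \<omega>\<bar> \<le> norm (traj X (hit Y) - traj X (hit X))"
            by (rule bcontfun_diff_bound)
          ultimately show "\<bar>(apply_bcontfun (traj Y (hit Y)) \<omega> - 2 * pi) - (apply_bcontfun (traj X (hit X)) \<omega> - 2 * pi)\<bar>
              \<le> norm (traj X (hit Y) - traj X (hit X)) + c * norm (Y - X)" by linarith
        qed
        then show "norm (apply_bcontfun (ret Y - ret X) u) \<le> norm (traj X (hit Y) - traj X (hit X)) + c * norm (Y - X)"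
          by (simp add: minus_bcontfun.rep_eq)
      qed
    qed
  qed
  then show "(ret \<longlongrightarrow> ret X) (at X within slice)" by (simp add: LIM_zero_iff)
qed

lemma slice_nonempty: "slice \<noteq> {}"
proof -
  have "0 \<in> slice" using Dt_pos[of 0] Delta_range[of 0] by (simp add: slice_def zero_bcontfun.rep_eq less_imp_le)
  then show ?thesis by blast
qed

lemma slice_convex: "convex slice"
proof (rule convexI)
  fix X Y and a b :: real assume X: "X \<in> slice" "Y \<in> slice" and ab: "0 \<le> a" "0 \<le> b" "a + b = 1"
  let ?Z = "a *\<^sub>R X + b *\<^sub>R Y"
  have Z: "apply_bcontfun ?Z u = a * apply_bcontfun X u + b * apply_bcontfun Y u" for u
    by (simp add: plus_bcontfun.rep_eq scaleR_bcontfun.rep_eq)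
  have comb: "\<bar>apply_bcontfun ?Z u - apply_bcontfun ?Z v\<bar> \<le> d"
    if "\<bar>apply_bcontfun X u - apply_bcontfun X v\<bar> \<le> d" "\<bar>apply_bcontfun Y u - apply_bcontfun Y v\<bar> \<le> d" for u v d
  proof -
    have "\<bar>apply_bcontfun ?Z u - apply_bcontfun ?Z v\<bar> = \<bar>a * (apply_bcontfun X u - apply_bcontfun X v) + b * (apply_bcontfun Y u - apply_bcontfun Y v)\<bar>"
      unfolding Z by (simp add: algebra_simps)
    also have "\<dots> \<le> \<bar>a * (apply_bcontfun X u - apply_bcontfun X v)\<bar> + \<bar>b * (apply_bcontfun Y u - apply_bcontfun Y v)\<bar>"
      by (rule abs_triangle_ineq)
    also have "\<dots> \<le> a * d + b * d"
      using ab that by (intro add_mono) (auto simp: abs_mult intro: mult_left_mono)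
    also have "\<dots> = d" using ab by (simp add: distrib_right[symmetric])
    finally show ?thesis .
  qed
  have "(\<integral>\<omega>. apply_bcontfun ?Z \<omega> \<partial>\<nu>) = a * (\<integral>\<omega>. apply_bcontfun X \<omega> \<partial>\<nu>) + b * (\<integral>\<omega>. apply_bcontfun Y \<omega> \<partial>\<nu>)"
    unfolding Z by (simp add: bcontfun_integrable)
  moreover have "\<bar>apply_bcontfun ?Z u - apply_bcontfun ?Z v\<bar> \<le> \<Delta>\<^sub>t 0 * \<bar>u - v\<bar>" for u v
    by (rule comb) (use X in \<open>auto simp: slice_def\<close>)
  moreover have "\<bar>apply_bcontfun ?Z \<omega> - apply_bcontfun ?Z \<omega>'\<bar> \<le> \<Delta> 0" if "\<omega> \<in> \<Omega>" "\<omega>' \<in> \<Omega>" for \<omega> \<omega>'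
    by (rule comb) (use X that in \<open>auto simp: slice_def\<close>)
  moreover have "apply_bcontfun ?Z (clamp_sym Rad u) = apply_bcontfun ?Z u" for u
    using X by (simp add: Z slice_def)
  ultimately show "?Z \<in> slice" using X by (simp add: slice_def)
qed

lemma slice_closed_seq:
  assumes f: "\<And>n. f n \<in> slice" and lim: "f \<longlonglongrightarrow> l"
  shows "l \<in> slice"
proof -
  have pt: "(\<lambda>n. apply_bcontfun (f n) u) \<longlonglongrightarrow> apply_bcontfun l u" for u
    by (rule bounded_linear.tendsto[OF bounded_linear_apply_bcontfun lim])
  have d: "\<bar>apply_bcontfun l u - apply_bcontfun l v\<bar> \<le> c"
    if "\<And>n. \<bar>apply_bcontfun (f n) u - apply_bcontfun (f n) v\<bar> \<le> c" for u v c
    by (rule LIMSEQ_le_const2[OF tendsto_rabs[OF tendsto_diff[OF pt pt]]]) (use that in blast)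
  have "apply_bcontfun l (clamp_sym Rad u) = apply_bcontfun l u" for u
  proof -
    have "(\<lambda>n. apply_bcontfun (f n) (clamp_sym Rad u)) = (\<lambda>n. apply_bcontfun (f n) u)"
      using f by (auto simp: slice_def)
    then show ?thesis using pt[of "clamp_sym Rad u"] pt[of u] LIMSEQ_unique by metis
  qed
  moreover have "(\<integral>\<omega>. apply_bcontfun l \<omega> \<partial>\<nu>) = 0"
  proof -
    have "\<bar>xc (graph_of (f n)) - xc (graph_of l)\<bar> \<le> norm (f n - l)" for n
      by (rule xc_graph_of_diff) (rule bcontfun_diff_bound)
    moreover have "xc (graph_of (f n)) = 0" for n using f[of n] by (simp add: slice_def xc_graph_of)
    ultimately have "\<bar>xc (graph_of l)\<bar> \<le> norm (f n - l)" for n by (metis abs_minus_cancel diff_0)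
    moreover have "(\<lambda>n. norm (f n - l)) \<longlonglongrightarrow> 0" by (intro tendsto_norm_zero LIM_zero lim)
    ultimately have "\<bar>xc (graph_of l)\<bar> \<le> 0" by (intro LIMSEQ_le_const[of "\<lambda>n. norm (f n - l)"]) auto
    then show ?thesis by (simp add: xc_graph_of)
  qed
  ultimately show ?thesis using d f by (auto simp: slice_def)
qed

text \<open>Arzela-Ascoli on \<open>[-Rad, Rad]\<close>; invariance under clamping turns uniform
  convergence there into the Cauchy property in the supremum norm on the line.\<close>

lemma slice_compact: "compact slice"
  unfolding compact_def
proof (intro allI impI)
  fix f :: "nat \<Rightarrow> (real \<Rightarrow>\<^sub>C real)" assume f: "\<forall>n. f n \<in> slice"
  have L: "\<bar>apply_bcontfun (f n) u - apply_bcontfun (f n) v\<bar> \<le> \<Delta>\<^sub>t 0 * \<bar>u - v\<bar>" for n u v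
    using f by (auto simp: slice_def)
  \<comment> \<open>Mean 0 fixes the additive constant: the value at \<open>u\<close> is the average
    of its differences to the values over \<Omega>.\<close>
  have bd: "norm (apply_bcontfun (f n) u) \<le> \<Delta>\<^sub>t 0 * (2 * Rad)" if u: "u \<in> {- Rad..Rad}" for n u
  proof -
    have "apply_bcontfun (f n) u = (\<integral>v. apply_bcontfun (f n) u - apply_bcontfun (f n) v \<partial>\<nu>)"
      using f by (simp add: slice_def bcontfun_integrable \<nu>.prob_space)
    also have "\<bar>\<dots>\<bar> \<le> (\<integral>v. \<bar>apply_bcontfun (f n) u - apply_bcontfun (f n) v\<bar> \<partial>\<nu>)" by (rule integral_abs_bound)
    also have "\<dots> \<le> (\<integral>v. \<Delta>\<^sub>t 0 * (2 * Rad) \<partial>\<nu>)"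
    proof (rule integral_mono_AE)
      show "AE v in \<nu>. \<bar>apply_bcontfun (f n) u - apply_bcontfun (f n) v\<bar> \<le> \<Delta>\<^sub>t 0 * (2 * Rad)"
        using AE_Omega
      proof eventually_elim
        case (elim v)
        have "\<bar>u - v\<bar> \<le> 2 * Rad" using Rad(2)[OF elim] u by (auto simp: abs_le_iff)
        then have "\<Delta>\<^sub>t 0 * \<bar>u - v\<bar> \<le> \<Delta>\<^sub>t 0 * (2 * Rad)" using Dt_pos[of 0] by (intro mult_left_mono) auto
        then show ?case using L[of n u v] by linarith
      qed
    qed (intro integrable_abs Bochner_Integration.integrable_diff bcontfun_integrable \<nu>.integrable_const)+
    finally show ?thesis by (simp add: \<nu>.prob_space)
  qed
  have eq: "\<exists>d>0. \<forall>n v. v \<in> {- Rad..Rad} \<and> norm (u - v) < d \<longrightarrow> norm (apply_bcontfun (f n) u - apply_bcontfun (f n) v) < e"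
    if e: "0 < e" for u e
  proof (intro exI conjI allI impI)
    show "0 < e / \<Delta>\<^sub>t 0" using e Dt_pos[of 0] by simp
    fix n v assume "v \<in> {- Rad..Rad} \<and> norm (u - v) < e / \<Delta>\<^sub>t 0"
    then have "\<Delta>\<^sub>t 0 * \<bar>u - v\<bar> < e" using Dt_pos[of 0] by (simp add: pos_less_divide_eq mult.commute)
    then show "norm (apply_bcontfun (f n) u - apply_bcontfun (f n) v) < e" using L[of n u v] by simp
  qed
  obtain g k where k: "strict_mono (k :: nat \<Rightarrow> nat)"
    and conv: "\<And>e. 0 < e \<Longrightarrow> \<exists>N. \<forall>n x. n \<ge> N \<and> x \<in> {- Rad..Rad} \<longrightarrow> norm (apply_bcontfun (f (k n)) x - g x) < e"
    by (rule Arzela_Ascoli[of "{- Rad..Rad}" "\<lambda>n. apply_bcontfun (f n)" "\<Delta>\<^sub>t 0 * (2 * Rad)"])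
       (use bd eq in auto)
  have "Cauchy (f \<circ> k)"
  proof (rule metric_CauchyI)
    fix e :: real assume e: "0 < e"
    obtain N where N: "\<And>n x. n \<ge> N \<Longrightarrow> x \<in> {- Rad..Rad} \<Longrightarrow> norm (apply_bcontfun (f (k n)) x - g x) < e / 3"
      using conv[of "e / 3"] e by auto
    have "norm (f (k m) - f (k n)) < e" if "m \<ge> N" "n \<ge> N" for m n
    proof -
      have "norm (f (k m) - f (k n)) \<le> 2 * (e / 3)"
      proof (rule norm_bound)
        fix u
        let ?u = "clamp_sym Rad u"
        have u: "?u \<in> {- Rad..Rad}" using clamp_sym_bound[of Rad u] Rad(1) by (auto simp: abs_le_iff)
        have "\<bar>apply_bcontfun (f (k m)) ?u - apply_bcontfun (f (k n)) ?u\<bar> \<le> 2 * (e / 3)"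
          using N[OF that(1) u] N[OF that(2) u] unfolding real_norm_def by linarith
        then show "norm (apply_bcontfun (f (k m) - f (k n)) u) \<le> 2 * (e / 3)"
          using f by (simp add: minus_bcontfun.rep_eq slice_def)
      qed
      then show ?thesis using e by simp
    qed
    then show "\<exists>N. \<forall>m\<ge>N. \<forall>n\<ge>N. dist ((f \<circ> k) m) ((f \<circ> k) n) < e"
      by (auto simp: dist_norm)
  qed
  then obtain l where l: "(f \<circ> k) \<longlonglongrightarrow> l" using Cauchy_convergent convergent_def by blast
  then have "l \<in> slice" by (intro slice_closed_seq[of "f \<circ> k" l]) (use f in auto)
  with k l show "\<exists>l\<in>slice. \<exists>r. strict_mono r \<and> (f \<circ> r) \<longlonglongrightarrow> l" by blast
qed

text \<open>The conditional measures of a graph are point masses, so the Wasserstein condition is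
  the Lipschitz bound of the function.\<close>

lemma slice_C_nu:
  assumes X: "X \<in> slice"
  shows "graph_of X \<in> C_nu \<nu> \<Delta> \<Delta>\<^sub>t"
proof -
  have x0: "xc (graph_of X) = 0" using X by (simp add: slice_def xc_graph_of)
  have m: "graph_of X \<in> P2nu \<nu>" by (rule graph_of_P2nu)
  let ?P = "(\<lambda>\<omega>. (apply_bcontfun X \<omega>, \<omega>)) ` \<Omega>"
  have Pc: "closed ?P"
    by (intro compact_imp_closed compact_continuous_image Omega_compact continuous_on_Pair continuous_on_id) simp
  have "AE z in graph_of X. z \<in> ?P"
    using kinetic_flow.AE_P[OF slice_flow[OF X]] .
  then have sub: "msupp (graph_of X) \<subseteq> ?P" by (rule msupp_subset_closed[OF P2nu_sets[OF m] Pc])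
  have dia: "\<bar>fst z - fst z'\<bar> \<le> \<Delta> (xc (graph_of X))" if zz: "z \<in> msupp (graph_of X)" "z' \<in> msupp (graph_of X)" for z z'
  proof -
    obtain \<omega> \<omega>' where "\<omega> \<in> \<Omega>" "\<omega>' \<in> \<Omega>" "z = (apply_bcontfun X \<omega>, \<omega>)" "z' = (apply_bcontfun X \<omega>', \<omega>')"
      using subsetD[OF sub zz(1)] subsetD[OF sub zz(2)] by blast
    then show ?thesis using X by (simp add: slice_def x0)
  qed
  define K where "K \<omega> = return borel (apply_bcontfun X \<omega>)" for \<omega>
  have dis: "disintegration \<nu> (graph_of X) K"
    unfolding disintegration_def
  proof (intro conjI allI ballI)
    show "prob_space (K \<omega>)" "sets (K \<omega>) = sets borel" for \<omega>
      unfolding K_def by (auto intro: prob_space_return)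
    fix B :: "(real \<times> real) set" assume B: "B \<in> sets borel"
    have sec: "{x. (x, \<omega>) \<in> B} \<in> sets borel" for \<omega>
      using measurable_sets[of "\<lambda>x. (x, \<omega>)" borel borel B] B
      by (auto simp: vimage_def intro!: borel_measurable_continuous_onI continuous_intros)
    have e: "emeasure (K \<omega>) {x. (x, \<omega>) \<in> B} = indicator B (apply_bcontfun X \<omega>, \<omega>)" for \<omega>
      unfolding K_def using sec by (simp add: indicator_def)
    show "(\<lambda>\<omega>. emeasure (K \<omega>) {x. (x, \<omega>) \<in> B}) \<in> borel_measurable \<nu>"
      unfolding e using measurable_compose[OF meas_graph[OF bcontfun_measurable] borel_measurable_indicator[OF B]] .
    have "emeasure (graph_of X) B = (\<integral>\<^sup>+ z. indicator B z \<partial>graph_of X)"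
      using B P2nu_sets[OF m] by simp
    also have "\<dots> = (\<integral>\<^sup>+ \<omega>. indicator B (apply_bcontfun X \<omega>, \<omega>) \<partial>\<nu>)"
      unfolding graph_measure_def using B
      by (subst nn_integral_distr[OF meas_graph[OF bcontfun_measurable]]) auto
    finally show "emeasure (graph_of X) B = (\<integral>\<^sup>+ \<omega>. emeasure (K \<omega>) {x. (x, \<omega>) \<in> B} \<partial>\<nu>)"
      unfolding e .
  qed
  have "wcost 2 (K \<omega>) (K \<omega>') < \<top> \<and> wasserstein 2 (K \<omega>) (K \<omega>') \<le> \<Delta>\<^sub>t (xc (graph_of X)) * \<bar>\<omega> - \<omega>'\<bar>"
    for \<omega> \<omega>'
  proof -
    have Kd: "K w = distr \<nu> borel (\<lambda>_. apply_bcontfun X w)" for w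
      unfolding K_def by (rule \<nu>.distr_const[symmetric]) simp
    let ?d = "\<Delta>\<^sub>t 0 * \<bar>\<omega> - \<omega>'\<bar>"
    have d: "0 \<le> ?d" "dist (apply_bcontfun X \<omega>) (apply_bcontfun X \<omega>') \<le> ?d"
      using X Dt_pos[of 0] by (auto simp: slice_def dist_real_def)
    have "wcost 2 (K \<omega>) (K \<omega>') \<le> ennreal (?d powr 2)" "wasserstein 2 (K \<omega>) (K \<omega>') \<le> ?d"
      unfolding Kd using d by (intro wasserstein_distr_le[OF nu_prob]; simp)+
    then show ?thesis using le_less_trans[OF _ ennreal_less_top] x0 by simp
  qed
  then show ?thesis unfolding C_nu_def using m dia dis by blast
qed

section \<open>From the fixed point of the return map to the periodic solution\<close>

lemma graph_shift:
  assumes "X \<in> borel_measurable borel"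
  shows "graph_measure (\<lambda>\<omega>. X \<omega> + 2 * pi) = distr (graph_measure X) borel tau2pi"
proof -
  have "tau2pi \<in> borel_measurable borel"
    unfolding tau2pi_def by (intro borel_measurable_continuous_onI continuous_intros)
  then show ?thesis
    unfolding graph_measure_def
    by (subst distr_distr[OF _ meas_graph[OF assms]]) (simp_all add: o_def tau2pi_def)
qed

text \<open>Uniqueness for graph data: any solution is transported by its characteristics and hence
  remains a graph, its profile solves the same equation, and the stability estimate with initial
  distance 0 identifies it with the constructed trajectory over \<Omega>.\<close>

lemma solution_eq_traj:
  assumes X: "X \<in> slice" and sol: "mv_solution F \<nu> (graph_of X) \<mu>" and t: "0 \<le> t"
  shows "\<mu> t = graph_of (traj X t)"
proof -
  interpret s: kinetic_invariant \<nu> F A I M \<kappa> D \<gamma> \<omega>c \<Delta> "graph_of X" \<mu>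
    by unfold_locales (use sol slice_C_nu[OF X] in auto)
  define Y where "Y t \<omega> = s.charac (apply_bcontfun X \<omega>) \<omega> t" for t \<omega>
  have Ym: "Y t \<in> borel_measurable borel" if "0 \<le> t" for t
    unfolding Y_def
    using continuous_on_compose2[OF s.charac_continuous_space[OF that], of UNIV "\<lambda>\<omega>. (apply_bcontfun X \<omega>, \<omega>)"]
    by (intro borel_measurable_continuous_onI) (simp add: continuous_on_Pair continuous_on_id)
  have rep: "\<mu> t = graph_measure (Y t)" if "0 \<le> t" for t
    unfolding s.solution_transported[OF that] graph_measure_def
    by (subst distr_distr[OF _ meas_graph[OF bcontfun_measurable]])
       (auto simp: o_def Y_def intro!: borel_measurable_continuous_onI continuous_on_Pair s.charac_continuous_space that continuous_intros)
  have "graph_sol Y"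
    unfolding graph_sol_def
  proof (intro conjI allI impI ballI)
    show "Y t \<in> borel_measurable borel" if "0 \<le> t" for t by (rule Ym[OF that])
    fix T :: real
    obtain \<omega>0 where o: "\<omega>0 \<in> \<Omega>" using Omega_ne by blast
    have "compact (s.charac (apply_bcontfun X \<omega>0) \<omega>0 ` {0..T})"
      by (intro compact_continuous_image continuous_on_subset[OF s.charac_continuous]) auto
    then obtain B where B: "\<And>t. t \<in> {0..T} \<Longrightarrow> \<bar>Y t \<omega>0\<bar> \<le> B"
      by (force dest!: compact_imp_bounded simp: bounded_iff Y_def)
    have "\<bar>Y t \<omega>\<bar> \<le> B + D" if t: "t \<in> {0..T}" and w: "\<omega> \<in> \<Omega>" for t \<omega>
    proof -
      have "\<bar>Y t \<omega> - Y t \<omega>0\<bar> \<le> exp ((\<kappa> * I + I) * t) * (\<bar>apply_bcontfun X \<omega> - apply_bcontfun X \<omega>0\<bar> + \<bar>\<omega> - \<omega>0\<bar>)"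
        unfolding Y_def by (rule s.charac_lipschitz) (use t in auto)
      \<comment> \<open>By continuity of \<open>X\<close> the whole graph over \<Omega> lies in the
        support of its measure. The diameter bound therefore applies to all these characteristics,
        and one bounded reference particle bounds them all.\<close>
      have "(apply_bcontfun X w, w) \<in> msupp (graph_of X)" if w: "w \<in> \<Omega>" for w
        unfolding msupp_def
      proof (intro CollectI allI impI)
        fix U :: "(real \<times> real) set" assume U: "open U" "(apply_bcontfun X w, w) \<in> U"
        have pc: "continuous_on UNIV (\<lambda>\<omega>. (apply_bcontfun X \<omega>, \<omega>))"
          by (intro continuous_on_Pair continuous_on_id) simp
        have "open {\<omega>. (apply_bcontfun X \<omega>, \<omega>) \<in> U}"
          using open_vimage[OF U(1) pc] by (simp add: vimage_def)
        moreover have "w \<in> {\<omega>. (apply_bcontfun X \<omega>, \<omega>) \<in> U}" using U(2) by simp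
        ultimately have "emeasure \<nu> {\<omega>. (apply_bcontfun X \<omega>, \<omega>) \<in> U} \<noteq> 0"
          using w unfolding msupp_def by blast
        then show "emeasure (graph_of X) U \<noteq> 0"
          unfolding graph_measure_def using U(1)
          by (subst emeasure_distr[OF meas_graph[OF bcontfun_measurable]]) (auto simp: vimage_def nu_space)
      qed
      then have "\<bar>Y t \<omega> - Y t \<omega>0\<bar> \<le> D"
        using s.solution_flow.diam_D[of t] t w o unfolding s.solution_flow.diam_def Y_def by force
      then show ?thesis using B[OF t] by linarith
    qed
    then show "\<exists>B. \<forall>t\<in>{0..T}. \<forall>\<omega>\<in>\<Omega>. \<bar>Y t \<omega>\<bar> \<le> B" by blast
  next
    fix \<omega> and t :: real assume w: "\<omega> \<in> \<Omega>" and t: "0 \<le> t"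
    show "((\<lambda>t. Y t \<omega>) has_real_derivative F (graph_measure (Y t)) (Y t \<omega>) \<omega>) (at t within {0..})"
      using s.charac_deriv[OF t, of "apply_bcontfun X \<omega>" \<omega>] vel_eq[OF s.mu[OF t] w] rep[OF t]
      by (simp add: Y_def[abs_def])
  qed
  then have "\<bar>Y t \<omega> - apply_bcontfun (traj X t) \<omega>\<bar> \<le> 2 * 0 * exp (growth * t)" if "\<omega> \<in> \<Omega>" for \<omega>
    by (rule graph_sol_stable[OF _ traj_graph_sol _ t that]) (simp add: Y_def s.charac_0 traj_0)
  then have "graph_measure (Y t) = graph_of (traj X t)"
    by (intro graph_cong Ym t bcontfun_measurable) simp
  then show ?thesis using rep[OF t] by simp
qed

text \<open>By A3, moving a solution forward by its passage time and back by one period in space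
  gives a solution again. Its initial values over \<Omega> are those of \<open>X\<close> because
  \<open>ret X = X\<close>, so uniqueness applies.\<close>

lemma traj_periodic:
  assumes X: "X \<in> slice" and fixed: "ret X = X" and t: "0 \<le> t"
  shows "graph_of (traj X (t + hit X)) = distr (graph_of (traj X t)) borel tau2pi"
proof -
  let ?T = "hit X"
  have T: "0 \<le> ?T" by (rule hit(1)[OF X])
  define Y where "Y t \<omega> = apply_bcontfun (traj X (t + ?T)) \<omega> - 2 * pi" for t \<omega>
  have Ym: "Y t \<in> borel_measurable borel" for t
    unfolding Y_def using bcontfun_measurable[of "traj X (t + ?T)"] by simp
  have gs: "graph_of (traj X (t + ?T)) = distr (graph_measure (Y t)) borel tau2pi" for t
    using graph_shift[OF Ym[of t]] by (simp add: Y_def)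
  have tr: "graph_sol (\<lambda>t. apply_bcontfun (traj X t))" by (rule traj_graph_sol)
  have YP: "graph_measure (Y t) \<in> P2nu \<nu>" for t
  proof (rule graph_bounded_P2nu(1)[OF Ym])
    show "\<bar>Y t \<omega>\<bar> \<le> norm (traj X (t + ?T)) + 2 * pi" for \<omega>
      using norm_bounded[of "traj X (t + ?T)" \<omega>] pi_gt_zero unfolding Y_def real_norm_def by linarith
  qed
  have "graph_sol Y"
    unfolding graph_sol_def
  proof (intro conjI allI impI ballI)
    fix S :: real
    obtain B where B: "\<forall>t\<in>{0..S + ?T}. \<forall>\<omega>\<in>\<Omega>. \<bar>apply_bcontfun (traj X t) \<omega>\<bar> \<le> B"
      using tr unfolding graph_sol_def by blast
    have "\<bar>Y t \<omega>\<bar> \<le> B + 2 * pi" if "t \<in> {0..S}" "\<omega> \<in> \<Omega>" for t \<omega>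
    proof -
      have "\<bar>apply_bcontfun (traj X (t + ?T)) \<omega>\<bar> \<le> B" using B that T by auto
      then show ?thesis using pi_gt_zero unfolding Y_def by linarith
    qed
    then show "\<exists>B. \<forall>t\<in>{0..S}. \<forall>\<omega>\<in>\<Omega>. \<bar>Y t \<omega>\<bar> \<le> B" by blast
  next
    fix \<omega> and t :: real assume w: "\<omega> \<in> \<Omega>" and t: "0 \<le> t"
    have "((\<lambda>t. apply_bcontfun (traj X t) \<omega>) has_real_derivative
        F (graph_of (traj X (t + ?T))) (apply_bcontfun (traj X (t + ?T)) \<omega>) \<omega>) (at (t + ?T) within (\<lambda>s. s + ?T) ` {0..})"
      by (rule DERIV_subset[where s="{0..}"]) (use tr w t T in \<open>auto simp: graph_sol_def\<close>)
    then have "((\<lambda>t. apply_bcontfun (traj X t) \<omega>) \<circ> (\<lambda>s. s + ?T) has_real_derivative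
        F (graph_of (traj X (t + ?T))) (apply_bcontfun (traj X (t + ?T)) \<omega>) \<omega> * 1) (at t within {0..})"
      by (rule DERIV_image_chain) (auto intro!: derivative_eq_intros)
    then have "((\<lambda>t. Y t \<omega>) has_real_derivative
        F (graph_of (traj X (t + ?T))) (apply_bcontfun (traj X (t + ?T)) \<omega>) \<omega>) (at t within {0..})"
      unfolding Y_def by (auto intro!: derivative_eq_intros simp: o_def)
    moreover have "F (graph_of (traj X (t + ?T))) (apply_bcontfun (traj X (t + ?T)) \<omega>) \<omega> = F (graph_measure (Y t)) (Y t \<omega>) \<omega>"
      unfolding gs using A3[OF YP[of t], of "Y t \<omega>" \<omega>] by (simp add: Y_def)
    ultimately show "((\<lambda>t. Y t \<omega>) has_real_derivative F (graph_measure (Y t)) (Y t \<omega>) \<omega>) (at t within {0..})" by simp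
  qed (rule Ym)
  then have "\<bar>Y t \<omega> - apply_bcontfun (traj X t) \<omega>\<bar> \<le> 2 * 0 * exp (growth * t)" if "\<omega> \<in> \<Omega>" for \<omega>
    by (rule graph_sol_stable[OF _ tr _ t that]) (use ret_Omega[OF X] fixed in \<open>simp add: Y_def traj_0\<close>)
  then have "graph_measure (Y t) = graph_of (traj X t)"
    by (intro graph_cong Ym bcontfun_measurable) simp
  then show ?thesis using gs[of t] by simp
qed

text \<open>The claim quantifies over every solution from the fixed datum; the existence clause and
  the nonempty set of passage times keep it from holding vacuously.\<close>

theorem periodic_solution:
  "\<exists>\<mu>s \<in> C_nu \<nu> \<Delta> \<Delta>\<^sub>t.
      (\<exists>\<mu>. mv_solution F \<nu> \<mu>s \<mu>) \<and>
      (\<forall>\<mu>. mv_solution F \<nu> \<mu>s \<mu> \<longrightarrow>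
         (let Ts = Inf {t. t \<ge> 0 \<and> xc (\<mu> t) = xc (\<mu> 0) + 2 * pi} in
            {t. t \<ge> 0 \<and> xc (\<mu> t) = xc (\<mu> 0) + 2 * pi} \<noteq> {} \<and>
            (\<forall>t\<ge>0. \<mu> (t + Ts) = distr (\<mu> t) borel tau2pi)))"
proof -
  obtain X where X: "X \<in> slice" "ret X = X"
    using schauder_fixed_point[OF slice_compact slice_convex slice_nonempty ret_continuous] ret_slice by blast
  show ?thesis
  proof (intro bexI[of _ "graph_of X"] conjI allI impI)
    show "graph_of X \<in> C_nu \<nu> \<Delta> \<Delta>\<^sub>t" by (rule slice_C_nu[OF X(1)])
    show "\<exists>\<mu>. mv_solution F \<nu> (graph_of X) \<mu>" using traj_mv_solution by blast
    fix \<mu> assume sol: "mv_solution F \<nu> (graph_of X) \<mu>"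
    note eq = solution_eq_traj[OF X(1) sol]
    have x0: "xc (\<mu> 0) = 0" using eq[of 0] X(1) by (simp add: slice_def xc_graph_of traj_0)
    \<comment> \<open>The centre passes the target exactly once, so the infimum is taken over a
      singleton and equals the passage time of the return map.\<close>
    have "{t. t \<ge> 0 \<and> xc (\<mu> t) = xc (\<mu> 0) + 2 * pi} = {hit X}"
    proof (intro equalityI subsetI)
      fix t assume "t \<in> {t. t \<ge> 0 \<and> xc (\<mu> t) = xc (\<mu> 0) + 2 * pi}"
      then show "t \<in> {hit X}" using hit(4)[OF X(1), of t] eq[of t] x0 by simp
    next
      fix t assume "t \<in> {hit X}"
      then show "t \<in> {t. t \<ge> 0 \<and> xc (\<mu> t) = xc (\<mu> 0) + 2 * pi}"
        using hit(1,2)[OF X(1)] eq[of t] x0 by simp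
    qed
    then show "let Ts = Inf {t. t \<ge> 0 \<and> xc (\<mu> t) = xc (\<mu> 0) + 2 * pi} in
            {t. t \<ge> 0 \<and> xc (\<mu> t) = xc (\<mu> 0) + 2 * pi} \<noteq> {} \<and>
            (\<forall>t\<ge>0. \<mu> (t + Ts) = distr (\<mu> t) borel tau2pi)"
      using traj_periodic[OF X] eq hit(1)[OF X(1)] by (simp add: Let_def)
  qed
qed

end

theorem theorem2p7:
  fixes \<nu> :: "real measure" and F :: flux
    and A B I M \<kappa> D :: real and \<Delta> :: "real \<Rightarrow> real"
  defines "\<Omega> \<equiv> msupp \<nu>"
      and "\<gamma> \<equiv> (SUP p \<in> msupp \<nu> \<times> msupp \<nu>. \<bar>fst p - snd p\<bar>)"
      and "\<omega>c \<equiv> (\<integral> \<omega>. \<omega> \<partial>\<nu>)"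
  assumes nu_prob: "prob_space \<nu>" and nu_sets: "sets \<nu> = sets borel"
      and nu_moment: "integrable \<nu> (\<lambda>\<omega>. \<omega>^2)"
      and nu_bdd: "bounded \<Omega>"
      and pos: "A > 0" "B > 0" "I > 0" "M > 0" "\<kappa> > 0"
      and A1: "\<And>\<mu> \<mu>' x \<omega>. \<mu> \<in> P2nu \<nu> \<Longrightarrow> \<mu>' \<in> P2nu \<nu> \<Longrightarrow> \<omega> \<in> \<Omega> \<Longrightarrow>
                 \<bar>F \<mu> x \<omega> - F \<mu>' x \<omega>\<bar> \<le> \<kappa> * M * wasserstein 1 \<mu> \<mu>' \<and>
                 \<bar>dxF F \<mu> x \<omega> - dxF F \<mu>' x \<omega>\<bar> \<le> \<kappa> * M * wasserstein 1 \<mu> \<mu>'"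
      and A2_C2: "\<And>\<mu>. \<mu> \<in> P2nu \<nu> \<Longrightarrow> C2_fun (\<lambda>z. F \<mu> (fst z) (snd z))"
      and A2_bounds: "\<And>\<mu> x \<omega>. \<mu> \<in> P2nu \<nu> \<Longrightarrow>
                 \<bar>dxF F \<mu> x \<omega>\<bar> \<le> \<kappa> * I \<and> \<bar>dxxF F \<mu> x \<omega>\<bar> \<le> \<kappa> * I \<and> \<bar>dwF F \<mu> x \<omega>\<bar> \<le> I"
      and A3: "\<And>\<mu> x \<omega>. \<mu> \<in> P2nu \<nu> \<Longrightarrow> F (distr \<mu> borel tau2pi) (x + 2 * pi) \<omega> = F \<mu> x \<omega>"
      and A4: "\<And>x. F (return borel x \<Otimes>\<^sub>M \<nu>) x \<omega>c \<ge> A"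
      and A5: "integral {0..2 * pi}
                 (\<lambda>x. dxF F (return borel x \<Otimes>\<^sub>M \<nu>) x \<omega>c / F (return borel x \<Otimes>\<^sub>M \<nu>) x \<omega>c)
               \<le> - \<kappa> * B"
      and D_pos: "D > 0"
      and cond_i: "A - ((\<kappa> + 1) * I + \<kappa> * M) * D - I * \<gamma> > 0"
      and cond_ii: "2 * pi * C2c A \<kappa> M I D \<gamma> * exp (2 * pi * \<kappa> * I / A) / (\<kappa> * B) \<le> D"
      and cond_iii: "E2c A \<kappa> M I D \<gamma> < \<kappa> * B"
      and Delta_range: "\<And>s. 0 < \<Delta> s \<and> \<Delta> s < D"
      and Delta_periodic: "\<And>s. \<Delta> (s + 2 * pi) = \<Delta> s"
      and Delta_ode: "\<And>s. (\<Delta> has_real_derivative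
                 (C2c A \<kappa> M I D \<gamma> +
                  dxF F (return borel s \<Otimes>\<^sub>M \<nu>) s \<omega>c / F (return borel s \<Otimes>\<^sub>M \<nu>) s \<omega>c * \<Delta> s)) (at s)"
  shows "\<exists>\<Delta>t :: real \<Rightarrow> real. (\<forall>s. \<Delta>t s > 0 \<and> \<Delta>t (s + 2 * pi) = \<Delta>t s) \<and>
           (\<forall>\<mu>0 \<mu>. \<mu>0 \<in> C_nu \<nu> \<Delta> \<Delta>t \<longrightarrow> mv_solution F \<nu> \<mu>0 \<mu> \<longrightarrow>
                (\<forall>t\<ge>0. \<mu> t \<in> C_nu \<nu> \<Delta> \<Delta>t)) \<and>
           (\<exists>\<mu>s \<in> C_nu \<nu> \<Delta> \<Delta>t.
                (\<exists>\<mu>. mv_solution F \<nu> \<mu>s \<mu>) \<and>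
                (\<forall>\<mu>. mv_solution F \<nu> \<mu>s \<mu> \<longrightarrow>
                   (let Ts = Inf {t. t \<ge> 0 \<and> xc (\<mu> t) = xc (\<mu> 0) + 2 * pi} in
                      {t. t \<ge> 0 \<and> xc (\<mu> t) = xc (\<mu> 0) + 2 * pi} \<noteq> {} \<and>
                      (\<forall>t\<ge>0. \<mu> (t + Ts) = distr (\<mu> t) borel tau2pi))))"
proof -
  interpret kinetic \<nu> F A I M \<kappa> D \<gamma> \<omega>c \<Delta>
    by (rule kinetic.intro; (fact nu_prob nu_sets nu_moment nu_bdd[unfolded \<Omega>_def] \<gamma>_def \<omega>c_def pos
          A1[unfolded \<Omega>_def] A2_C2 A2_bounds A3 A4 D_pos cond_i Delta_range Delta_periodic Delta_ode
          meta_eq_to_obj_eq[OF \<gamma>_def] meta_eq_to_obj_eq[OF \<omega>c_def])?)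
  show ?thesis
  proof (intro exI[of _ \<Delta>\<^sub>t] conjI allI impI)
    show "0 < \<Delta>\<^sub>t s" "\<Delta>\<^sub>t (s + 2 * pi) = \<Delta>\<^sub>t s" for s
      using Dt_pos Delta_periodic by (auto simp: \<Delta>\<^sub>t_def)
    fix \<mu>0 \<mu> and t :: real
    assume "\<mu>0 \<in> C_nu \<nu> \<Delta> \<Delta>\<^sub>t" "mv_solution F \<nu> \<mu>0 \<mu>" and t: "0 \<le> t"
    then interpret kinetic_invariant \<nu> F A I M \<kappa> D \<gamma> \<omega>c \<Delta> \<mu>0 \<mu>
      by unfold_locales auto
    show "\<mu> t \<in> C_nu \<nu> \<Delta> \<Delta>\<^sub>t" by (rule C_nu_invariant[OF t])
  qed (rule periodic_solution)
qed

end
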